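(* For any $\delta>0$ there exists an initial datum $0\le u_{0,\delta}\in\mathrm{L}^1_\gamma(\mathbb{R}^d)$, $u_{0,\delta}\ne0$, such that the corresponding solution $u_\delta(t,x)$ to (CP) satisfies, with $M=\|u_{0,\delta}\|_{\mathrm{L}^1_\gamma(\mathbb{R}^d)}$, $$\lim_{t\to\infty}t^{\delta+(d-\gamma)\vartheta}\|u_\delta(t)-\mathfrak{B}(t;M)\|_{\mathrm{L}^\infty(\mathbb{R}^d)}=\infty\qquad\text{and}\qquad\lim_{t\to\infty}t^{\delta}\|u_\delta(t)-\mathfrak{B}(t;M)\|_{\mathrm{L}^1_\gamma(\mathbb{R}^d)}=\infty .$$
   Context: Parameters: $d\ge 3$ is an integer, $\gamma,\beta\in\mathbb{R}$ satisfy $\gamma<d$ and $\gamma-2<\beta\le\gamma(d-2)/d$, and $m\in(m_c,1)$ with $m_c:=\frac{d-2-\beta}{d-\gamma}$. Set $\sigma:=2+\beta-\gamma>0$ and $\vartheta:=\frac{1}{(d-\gamma)(m-m_c)}>0$. Spaces: $\mathrm{L}^1_\gamma(\mathbb{R}^d)$ is the space of measurable $f$ with $\|f\|_{\mathrm{L}^1_\gamma(\mathbb{R}^d)}=\int_{\mathbb{R}^d}|f(x)||x|^{-\gamma}\,dx<\infty$. Problem (CP): $\partial_t u=|x|^\gamma\nabla\cdot(|x|^{-\beta}\nabla u^m)$ in $(0,\infty)\times\mathbb{R}^d$, $u(0,\cdot)=u_0$ in $\mathbb{R}^d$. A solution with datum $0\le u_0\in\mathrm{L}^1_{\gamma}(\mathbb{R}^d)$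 is a nonnegative weak solution: $u\in C([0,\infty);\mathrm{L}^1_\gamma(\mathbb{R}^d))$, $u(0)=u_0$, $\nabla u^m\in \mathrm{L}^2_{loc}((0,\infty)\times\mathbb{R}^d;|x|^{-\beta}dx\,dt)$, and $\int_0^\infty\!\int_{\mathbb{R}^d}\big(u\,\partial_t\varphi\,|x|^{-\gamma}-|x|^{-\beta}\nabla u^m\cdot\nabla\varphi\big)dx\,dt=0$ for all $\varphi\in C_c^\infty((0,\infty)\times\mathbb{R}^d)$. It is known that such a solution exists, is unique, satisfies the comparison principle and conserves the mass $\int u(t,x)|x|^{-\gamma}dx$. Barenblatt solutions: for $M>0$ let $\mathcal{B}_M(x)=(C(M)+|x|^\sigma)^{-\frac1{1-m}}$, with $C(M)>0$ the unique constant such that $\int_{\mathbb{R}^d}\mathcal{B}_M|x|^{-\gamma}dx=M$. Let $R_\star(t)=(t/\vartheta)^\vartheta$ and $\zeta>0$ be given by $\zeta^{1/\vartheta}=\frac{1-m}{\sigma m}$. For $t>0$, $\mathfrak{B}(t;M)$ is the function $x\mapsto\frac{\zeta^{d-\gamma}}{R_\star(t)^{d-\gamma}}\mathcal{B}_M\!\left(\frac{\zeta x}{R_\star(t)}\right)$. *)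

theory Defs
  imports "HOL-Probability.Essential_Supremum"
begin

text \<open>The space $R^d$ is rendered by a Euclidean space \<open>'a\<close> with \<open>d = DIM('a)\<close>, and space-time by
  \<open>real \<times> 'a\<close> (time first). Elements of Lebesgue spaces are represented by Borel measurable
  functions, with all conditions understood almost everywhere. Since \<open>0 powr a = 0\<close> for
  every \<open>a\<close>, the power weights take the value 0 at the origin; this only affects a null set.\<close>

text \<open>\<open>C\<^sup>k\<close> functions on the whole space, by recursion through the partial derivatives.\<close>

primrec continuously_differentiable :: "nat \<Rightarrow> ('b::euclidean_space \<Rightarrow> real) \<Rightarrow> bool" where
  "continuously_differentiable 0 f \<longleftrightarrow> continuous_on UNIV f"
| "continuously_differentiable (Suc k) f \<longleftrightarrow>
     (\<forall>x. f differentiable (at x)) \<and>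
     (\<forall>b\<in>Basis. continuously_differentiable k (\<lambda>x. frechet_derivative f (at x) b))"

text \<open>Test functions on an open set \<open>\<Omega>\<close> are extended by zero to the whole space.\<close>

definition test_function :: "'b::euclidean_space set \<Rightarrow> ('b \<Rightarrow> real) \<Rightarrow> bool" where
  "test_function \<Omega> \<phi> \<longleftrightarrow>
     (\<forall>k. continuously_differentiable k \<phi>) \<and>
     (\<exists>K. compact K \<and> K \<subseteq> \<Omega> \<and> (\<forall>z. z \<notin> K \<longrightarrow> \<phi> z = 0))"

definition time_deriv :: "(real \<times> 'a::euclidean_space \<Rightarrow> real) \<Rightarrow> real \<times> 'a \<Rightarrow> real" where
  "time_deriv \<phi> z = frechet_derivative \<phi> (at z) (1, 0)"

definition space_grad :: "(real \<times> 'a::euclidean_space \<Rightarrow> real) \<Rightarrow> real \<times> 'a \<Rightarrow> 'a" where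
  "space_grad \<phi> z = (\<Sum>b\<in>Basis. frechet_derivative \<phi> (at z) (0, b) *\<^sub>R b)"

definition locally_integrable ::
  "'b::euclidean_space set \<Rightarrow> ('b \<Rightarrow> 'c::euclidean_space) \<Rightarrow> bool" where
  "locally_integrable \<Omega> f \<longleftrightarrow> (\<forall>K. compact K \<and> K \<subseteq> \<Omega> \<longrightarrow> set_integrable lborel K f)"

definition weak_space_grad ::
  "(real \<times> 'a::euclidean_space) set \<Rightarrow> (real \<times> 'a \<Rightarrow> real) \<Rightarrow> (real \<times> 'a \<Rightarrow> 'a) \<Rightarrow> bool" where
  "weak_space_grad \<Omega> w G \<longleftrightarrow>
     locally_integrable \<Omega> w \<and> locally_integrable \<Omega> G \<and>
     (\<forall>\<phi>. test_function \<Omega> \<phi> \<longrightarrow>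
        (LINT z:\<Omega>|lborel. w z *\<^sub>R space_grad \<phi> z) = - (LINT z:\<Omega>|lborel. \<phi> z *\<^sub>R G z))"

definition L1w_norm :: "real \<Rightarrow> ('a::euclidean_space \<Rightarrow> real) \<Rightarrow> ennreal" where
  "L1w_norm \<gamma> f = (\<integral>\<^sup>+ x. ennreal (\<bar>f x\<bar> * norm x powr (- \<gamma>)) \<partial>lborel)"

definition L1w :: "real \<Rightarrow> ('a::euclidean_space \<Rightarrow> real) set" where
  "L1w \<gamma> = {f \<in> borel_measurable borel. L1w_norm \<gamma> f < \<infinity>}"

definition Linf_norm :: "('a::euclidean_space \<Rightarrow> real) \<Rightarrow> ennreal" where
  "Linf_norm f = esssup lborel (\<lambda>x. ennreal \<bar>f x\<bar>)"

text \<open>Nonnegative weak solutions of \<open>\<partial>\<^sub>t u = |x|\<^sup>\<gamma> div(|x|\<^sup>-\<^sup>\<beta> \<nabla>u\<^sup>m)\<close> with datum \<open>u0\<close>. The field \<open>G\<close> is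
  \<open>\<nabla>u\<^sup>m\<close>; it is determined almost everywhere. It is taken in the sense of distributions
  away from \<open>x = 0\<close>: membership in the weighted spaces does not imply that \<open>u\<^sup>m\<close> and \<open>G\<close> are locally
  integrable at the origin with respect to Lebesgue measure (\<open>\<beta> \<le> - d\<close> is possible). The
  equation itself is tested with functions that need not vanish near \<open>x = 0\<close>. Values of \<open>u\<close> at
  negative times are irrelevant.\<close>

definition weak_solution ::
  "real \<Rightarrow> real \<Rightarrow> real \<Rightarrow> ('a::euclidean_space \<Rightarrow> real) \<Rightarrow> (real \<Rightarrow> 'a \<Rightarrow> real) \<Rightarrow> bool" where
  "weak_solution \<gamma> \<beta> m u0 u \<longleftrightarrow>
     (\<forall>t\<ge>0. u t \<in> L1w \<gamma> \<and> (AE x in lborel. 0 \<le> u t x)) \<and>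
     (\<forall>t\<ge>0. ((\<lambda>s. L1w_norm \<gamma> (\<lambda>x. u s x - u t x)) \<longlongrightarrow> 0) (at t within {0..})) \<and>
     (AE x in lborel. u 0 x = u0 x) \<and>
     set_borel_measurable lborel ({0<..} \<times> UNIV) (\<lambda>(t, x). u t x) \<and>
     (\<exists>G :: real \<times> 'a \<Rightarrow> 'a.
        weak_space_grad ({0<..} \<times> (- {0})) (\<lambda>(t, x). u t x powr m) G \<and>
        locally_integrable ({0<..} \<times> UNIV) (\<lambda>(t, x). (norm (G (t, x)))\<^sup>2 * norm x powr (- \<beta>)) \<and>
        (\<forall>\<phi>. test_function ({0<..} \<times> UNIV) \<phi> \<longrightarrow>
           (LINT (t, x):{0<..} \<times> UNIV|lborel.
              u t x * time_deriv \<phi> (t, x) * norm x powr (- \<gamma>)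
              - norm x powr (- \<beta>) * (G (t, x) \<bullet> space_grad \<phi> (t, x))) = 0))"

definition m_crit :: "real \<Rightarrow> real \<Rightarrow> real \<Rightarrow> real" where
  "m_crit d \<gamma> \<beta> = (d - 2 - \<beta>) / (d - \<gamma>)"

definition sigma_exp :: "real \<Rightarrow> real \<Rightarrow> real" where
  "sigma_exp \<gamma> \<beta> = 2 + \<beta> - \<gamma>"

definition theta_exp :: "real \<Rightarrow> real \<Rightarrow> real \<Rightarrow> real \<Rightarrow> real" where
  "theta_exp d \<gamma> \<beta> m = 1 / ((d - \<gamma>) * (m - m_crit d \<gamma> \<beta>))"

definition profile :: "real \<Rightarrow> real \<Rightarrow> real \<Rightarrow> real \<Rightarrow> 'a::euclidean_space \<Rightarrow> real" where
  "profile \<gamma> \<beta> m C x = (C + norm x powr sigma_exp \<gamma> \<beta>) powr (- 1 / (1 - m))"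

definition barenblatt_const :: "'a::euclidean_space itself \<Rightarrow> real \<Rightarrow> real \<Rightarrow> real \<Rightarrow> real \<Rightarrow> real" where
  "barenblatt_const _ \<gamma> \<beta> m M =
     (THE C. 0 < C \<and>
        (\<integral>\<^sup>+ x. ennreal (profile \<gamma> \<beta> m C (x::'a) * norm x powr (- \<gamma>)) \<partial>lborel) = ennreal M)"

definition barenblatt_profile :: "real \<Rightarrow> real \<Rightarrow> real \<Rightarrow> real \<Rightarrow> 'a::euclidean_space \<Rightarrow> real" where
  "barenblatt_profile \<gamma> \<beta> m M = profile \<gamma> \<beta> m (barenblatt_const TYPE('a) \<gamma> \<beta> m M)"

text \<open>\<open>\<zeta>\<close> is the positive solution of \<open>\<zeta>\<^bsup>1/\<theta>\<^esup> = (1 - m) / (\<sigma> m)\<close>.\<close>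

definition barenblatt ::
  "real \<Rightarrow> real \<Rightarrow> real \<Rightarrow> real \<Rightarrow> real \<Rightarrow> 'a::euclidean_space \<Rightarrow> real" where
  "barenblatt \<gamma> \<beta> m M t x =
     (let d = real DIM('a);
          \<theta> = theta_exp d \<gamma> \<beta> m;
          \<zeta> = ((1 - m) / (sigma_exp \<gamma> \<beta> * m)) powr \<theta>;
          R = (t / \<theta>) powr \<theta>
      in \<zeta> powr (d - \<gamma>) / R powr (d - \<gamma>) * barenblatt_profile \<gamma> \<beta> m M ((\<zeta> / R) *\<^sub>R x))"

end

theory Submission
  imports Defs
begin

text \<open>Mass moves outward slowly. Test the equation with a cutoff \<open>\<psi>\<^sub>R\<close> that is \<open>1\<close> on \<open>|x| \<le> R\<close> and
  \<open>0\<close> on \<open>|x| > 2R\<close>, and integrate by parts once more, so that no gradient of the solution remains. The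
  derivative of \<open>\<integral> u \<psi>\<^sub>R |x|\<^sup>-\<^sup>\<gamma>\<close> in time is then \<open>\<integral> u\<^sup>m div(|x|\<^sup>-\<^sup>\<beta> \<nabla>\<psi>\<^sub>R)\<close>, an integral over the annulus
  \<open>R \<le> |x| \<le> 2R\<close>. Since \<open>m < 1\<close>, it is at most \<open>C R\<^bsup>-1/\<theta>\<^esup> (1 + S)\<close> for a solution of mass at most \<open>S\<close>
  (\<open>annulus_power_bound\<close>, \<open>local_mass_lipschitz\<close>); the exponent is negative because \<open>m > m\<^sub>c\<close>. For
  \<open>R \<longrightarrow> \<infinity>\<close> this bounds the mass of the solution by that of the datum (\<open>weak_solution_mass_le\<close>),
  which makes the constant uniform in time.

  Now let the datum have the tail \<open>u\<^sub>0(x) = |x|\<^bsup>-(d-\<gamma>)-\<epsilon>\<^esup>\<close> on \<open>|x| \<ge> 1\<close> and vanish inside, so that its mass outside the ball of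
  radius \<open>R\<close> is a multiple of \<open>R\<^sup>-\<^sup>\<epsilon>\<close>. Take \<open>R = t\<^bsup>\<theta>(1+\<kappa>)\<^esup>\<close>, slightly beyond the diffusive scale \<open>t\<^sup>\<theta>\<close>.
  Up to time \<open>t\<close> at most \<open>C t R\<^bsup>-1/\<theta>\<^esup> = C t\<^sup>-\<^sup>\<kappa>\<close> of mass crosses that radius. The Barenblatt function has the
  same total mass \<open>M\<close>, but outside radius \<open>R\<close> only \<open>O(t\<^bsup>-\<kappa>/(1-m)\<^esup>)\<close> of it (\<open>barenblatt_mass_and_tail\<close>).
  Hence
    \<open>D(t) = \<integral> (B(t) - u(t)) \<psi>\<^sub>R |x|\<^sup>-\<^sup>\<gamma> \<ge> c t\<^bsup>-\<theta>(1+\<kappa>)\<epsilon>\<^esup> - C' t\<^sup>-\<^sup>\<kappa>\<close>,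
  and the first term dominates when \<open>\<epsilon>\<close> is small compared with \<open>\<kappa>\<close>. The weighted \<open>L\<^sup>1\<close> distance is at least \<open>D(t)\<close>.
  The \<open>L\<^sup>\<infinity>\<close> distance is at least \<open>D(t)\<close> divided by the weight of a ball of radius \<open>2R\<close>, which is a multiple of
  \<open>t\<^bsup>(d-\<gamma>)\<theta>(1+\<kappa>)\<^esup>\<close>. Small \<open>\<kappa>\<close>, and then small \<open>\<epsilon>\<close>, bring the loss in both rates below \<open>\<delta>\<close>.

  Along the way, smooth cutoffs are built from \<open>exp(-1/x)\<close>, power weights are integrated by summing over
  dyadic annuli, and the existence and uniqueness of the Barenblatt constant follow from scaling.\<close>

section \<open>Smooth functions\<close>

abbreviation smooth :: "('b::euclidean_space \<Rightarrow> real) \<Rightarrow> bool" where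
  "smooth f \<equiv> \<forall>k. continuously_differentiable k f"

lemma cd_SucI:
  assumes "\<And>x. (f has_derivative f' x) (at x)"
    and "\<And>b. b \<in> Basis \<Longrightarrow> continuously_differentiable k (\<lambda>x. f' x b)"
  shows "continuously_differentiable (Suc k) f"
proof -
  have "frechet_derivative f (at x) = f' x" for x
    using frechet_derivative_at[OF assms(1)] by simp
  then show ?thesis
    using assms by (auto simp: differentiable_def)
qed

lemma cd_SucD:
  assumes "continuously_differentiable (Suc k) f"
  shows "(f has_derivative frechet_derivative f (at x)) (at x)"
    and "b \<in> Basis \<Longrightarrow> continuously_differentiable k (\<lambda>x. frechet_derivative f (at x) b)"
  using assms by (auto simp: frechet_derivative_works[symmetric])

lemma cd_Suc_imp: "continuously_differentiable (Suc k) f \<Longrightarrow> continuously_differentiable k f"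
proof (induction k arbitrary: f)
  case 0
  then have "f differentiable (at x)" for x by simp
  then show ?case
    by (simp add: continuous_at_imp_continuous_on differentiable_imp_continuous_within)
next
  case (Suc k)
  show ?case
    by (rule cd_SucI[OF cd_SucD(1)[OF Suc.prems]]) (rule Suc.IH[OF cd_SucD(2)[OF Suc.prems]])
qed

lemma cd_const: "continuously_differentiable k (\<lambda>x. c)"
proof (induction k arbitrary: c)
  case (Suc k)
  then show ?case by (intro cd_SucI[where f' = "\<lambda>x y. 0"]) auto
qed simp

lemma cd_add:
  assumes "continuously_differentiable k f" "continuously_differentiable k g"
  shows "continuously_differentiable k (\<lambda>x. f x + g x)"
  using assms
proof (induction k arbitrary: f g)
  case 0
  then show ?case by (simp add: continuous_on_add)
next
  case (Suc k)
  show ?case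
    by (rule cd_SucI[OF has_derivative_add[OF cd_SucD(1)[OF Suc.prems(1)] cd_SucD(1)[OF Suc.prems(2)]]])
      (intro Suc.IH cd_SucD(2)[OF Suc.prems(1)] cd_SucD(2)[OF Suc.prems(2)])
qed

lemma cd_mult:
  assumes "continuously_differentiable k f" "continuously_differentiable k g"
  shows "continuously_differentiable k (\<lambda>x. f x * g x)"
  using assms
proof (induction k arbitrary: f g)
  case 0
  then show ?case by (simp add: continuous_on_mult)
next
  case (Suc k)
  show ?case
    by (rule cd_SucI[OF has_derivative_mult[OF cd_SucD(1)[OF Suc.prems(1)] cd_SucD(1)[OF Suc.prems(2)]]])
      (intro cd_add Suc.IH cd_SucD(2)[OF Suc.prems(1)] cd_SucD(2)[OF Suc.prems(2)]
        cd_Suc_imp[OF Suc.prems(1)] cd_Suc_imp[OF Suc.prems(2)])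
qed

lemma cd_bounded_linear:
  assumes "bounded_linear f"
  shows "continuously_differentiable k f"
proof (cases k)
  case 0
  then show ?thesis using assms by (simp add: linear_continuous_on)
next
  case (Suc j)
  show ?thesis unfolding Suc
    by (rule cd_SucI[OF bounded_linear_imp_has_derivative[OF assms]]) (rule cd_const)
qed

lemma cd_compose:
  fixes h :: "real \<Rightarrow> real"
  assumes "continuously_differentiable k h" "continuously_differentiable k f"
  shows "continuously_differentiable k (\<lambda>x. h (f x))"
  using assms
proof (induction k arbitrary: h f)
  case 0
  then show ?case using continuous_on_compose2[of UNIV h UNIV f] by simp
next
  case (Suc k)
  let ?h' = "\<lambda>s. frechet_derivative h (at s) 1"
  have h': "frechet_derivative h (at s) v = ?h' s * v" for s v
    using linear_scale[OF has_derivative_linear[OF cd_SucD(1)[OF Suc.prems(1), of s]], of v 1] by (simp add: mult.commute)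
  have deriv: "((\<lambda>x. h (f x)) has_derivative (\<lambda>v. ?h' (f x) * frechet_derivative f (at x) v)) (at x)" for x
    using has_derivative_compose[OF cd_SucD(1)[OF Suc.prems(2)] cd_SucD(1)[OF Suc.prems(1)], of x]
    by (simp add: h'[of _ "frechet_derivative f _ _"])
  show ?case
  proof (rule cd_SucI[OF deriv])
    fix b :: 'a assume b: "b \<in> Basis"
    show "continuously_differentiable k (\<lambda>x. ?h' (f x) * frechet_derivative f (at x) b)"
    proof (rule cd_mult)
      show "continuously_differentiable k (\<lambda>x. ?h' (f x))"
        by (rule Suc.IH[OF cd_SucD(2)[OF Suc.prems(1)] cd_Suc_imp[OF Suc.prems(2)]]) simp
    qed (rule cd_SucD(2)[OF Suc.prems(2) b])
  qed
qed

lemma cd_Suc_realI: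
  fixes f :: "real \<Rightarrow> real"
  assumes "\<And>x. (f has_real_derivative f' x) (at x)" and "continuously_differentiable k f'"
  shows "continuously_differentiable (Suc k) f"
  using assms by (intro cd_SucI[of f "\<lambda>x v. f' x * v"]) (auto simp: has_field_derivative_def)

lemma smooth_real_derivative:
  fixes f :: "real \<Rightarrow> real"
  assumes "smooth f"
  obtains f' where "smooth f'" and "\<And>x. (f has_real_derivative f' x) (at x)"
proof
  show "smooth (\<lambda>x. frechet_derivative f (at x) 1)"
    using assms cd_SucD(2)[of _ f 1] by auto
  fix x
  have "(f has_derivative frechet_derivative f (at x)) (at x)"
    using assms cd_SucD(1)[of 0 f] by blast
  moreover have "frechet_derivative f (at x) v = frechet_derivative f (at x) 1 * v" for v
    using linear_scale[OF has_derivative_linear[OF calculation], of v 1] by (simp add: mult.commute)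
  then have "frechet_derivative f (at x) = (*) (frechet_derivative f (at x) 1)" by blast
  ultimately show "(f has_real_derivative frechet_derivative f (at x) 1) (at x)"
    unfolding has_field_derivative_def by simp
qed

lemma smooth_continuous: "smooth f \<Longrightarrow> continuous_on S f"
  using continuous_on_subset[of UNIV f S] by (metis continuously_differentiable.simps(1) subset_UNIV)

text \<open>The functions \<open>x \<mapsto> p(1/x) exp(-1/x)\<close>, cut off at \<open>0\<close>, with a polynomial \<open>p\<close>, form a class
  that is closed under differentiation; this makes \<open>exp(-1/x)\<close> smooth.\<close>

definition flat_exp :: "real poly \<Rightarrow> real \<Rightarrow> real" where
  "flat_exp p x = (if 0 < x then poly p (1 / x) * exp (- (1 / x)) else 0)"

lemma poly_times_exp_neg_tendsto_0: "((\<lambda>y. poly p y * exp (- y)) \<longlongrightarrow> (0::real)) at_top"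
proof -
  have "((\<lambda>y. \<Sum>i\<le>degree p. coeff p i * (y ^ i / exp y)) \<longlongrightarrow> (\<Sum>i\<le>degree p. coeff p i * 0)) at_top"
    by (intro tendsto_intros tendsto_power_div_exp_0)
  then show ?thesis
    by (simp add: poly_altdef sum_distrib_right exp_minus divide_inverse mult.assoc)
qed

lemma flat_exp_tendsto_0: "(flat_exp p \<longlongrightarrow> 0) (at 0)"
proof -
  have "((\<lambda>x. poly p (inverse x) * exp (- inverse x)) \<longlongrightarrow> 0) (at_right 0)"
    by (rule filterlim_compose[OF poly_times_exp_neg_tendsto_0 filterlim_inverse_at_top_right])
  then have "(flat_exp p \<longlongrightarrow> 0) (at_right 0)"
    by (rule Lim_transform_eventually)
      (auto simp: flat_exp_def eventually_at_filter inverse_eq_divide)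
  moreover have "(flat_exp p \<longlongrightarrow> 0) (at_left 0)"
    by (rule tendsto_eventually) (auto simp: flat_exp_def eventually_at_filter)
  ultimately show ?thesis by (simp add: filterlim_at_split)
qed

lemma flat_exp_has_derivative:
  "(flat_exp p has_real_derivative flat_exp ([:0, 0, 1:] * (p - pderiv p)) x) (at x)"
proof -
  consider "x < 0" | "x = 0" | "0 < x" by linarith
  then show ?thesis
  proof cases
    case 1
    have "((\<lambda>_. 0) has_real_derivative 0) (at x)" by simp
    then have "(flat_exp p has_real_derivative 0) (at x)"
      by (rule has_field_derivative_transform_within_open[of _ _ _ "{..<0}"])
        (use 1 in \<open>auto simp: flat_exp_def\<close>)
    with 1 show ?thesis by (simp add: flat_exp_def)
  next
    case 2
    have "(\<lambda>h. flat_exp p h / h) = flat_exp (pCons 0 p)"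
      by (auto simp: flat_exp_def fun_eq_iff)
    with flat_exp_tendsto_0[of "pCons 0 p"] 2 show ?thesis
      by (simp add: DERIV_def) (simp add: flat_exp_def)
  next
    case 3
    have "((\<lambda>x. poly p (1 / x) * exp (- (1 / x))) has_real_derivative
        flat_exp ([:0, 0, 1:] * (p - pderiv p)) x) (at x)"
      using 3 by (auto intro!: derivative_eq_intros DERIV_chain2[OF poly_DERIV]
          simp: flat_exp_def power2_eq_square field_simps)
    then show ?thesis
      by (rule has_field_derivative_transform_within_open[of _ _ _ "{0<..}"])
        (use 3 in \<open>auto simp: flat_exp_def\<close>)
  qed
qed

lemma smooth_flat_exp: "smooth (flat_exp p)"
proof
  show "continuously_differentiable k (flat_exp p)" for k
  proof (induction k arbitrary: p)
    case 0
    have "isCont (flat_exp p) x" for x by (rule DERIV_isCont[OF flat_exp_has_derivative])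
    then show ?case by (simp add: continuous_at_imp_continuous_on)
  next
    case (Suc k)
    then show ?case by (intro cd_Suc_realI[OF flat_exp_has_derivative])
  qed
qed

text \<open>The normalized antiderivative of the bump \<open>b(s) = e(s) e(1 - s)\<close>, where \<open>e(s) = exp(-1/s)\<close> for
  \<open>s > 0\<close>. The derivative is part of the statement because averages against it recover pointwise
  values in time.\<close>

lemma smooth_step_exists:
  obtains H \<eta> :: "real \<Rightarrow> real" where "smooth H" "smooth \<eta>"
    "\<And>s. (H has_real_derivative \<eta> s) (at s)" "\<And>s. 0 \<le> \<eta> s"
    "\<And>s. s \<le> 0 \<Longrightarrow> H s = 0" "\<And>s. 1 \<le> s \<Longrightarrow> H s = 1" "\<And>s. s \<notin> {0<..<1} \<Longrightarrow> \<eta> s = 0"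
    "\<And>s. 0 \<le> H s" "\<And>s. H s \<le> 1"
proof -
  define b where "b s = flat_exp 1 s * flat_exp 1 (1 - s)" for s :: real
  have "smooth (\<lambda>s::real. 1 + - s)"
    by (intro allI cd_add cd_const cd_bounded_linear bounded_linear_minus bounded_linear_ident)
  then have "smooth (\<lambda>s::real. 1 - s)" by simp
  then have smooth_b: "smooth b"
    unfolding b_def
    by (intro allI cd_mult cd_compose[where h = "flat_exp 1" and f = "\<lambda>s. 1 - s"])
      (simp_all add: smooth_flat_exp)
  have b_pos: "0 < b s" if "0 < s" "s < 1" for s using that by (simp add: b_def flat_exp_def)
  have b_0: "b s = 0" if "s \<notin> {0<..<1}" for s using that by (auto simp: b_def flat_exp_def)
  have b_nonneg: "0 \<le> b s" for s by (simp add: b_def flat_exp_def)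
  have cont: "continuous_on S b" for S by (rule smooth_continuous[OF smooth_b])
  then have int: "b integrable_on {u..v}" for u v by (rule integrable_continuous_interval)
  define I where "I s = integral {0..s} b" for s
  have deriv: "(I has_real_derivative b s) (at s)" for s
  proof (cases "0 < s")
    case True
    have "((\<lambda>u. integral {0..u} b) has_real_derivative b s) (at s within {0..s + 1})"
      using True cont by (intro integral_has_real_derivative) auto
    then show ?thesis using True
      unfolding I_def by (simp add: at_within_Icc_at)
  next
    case False
    have *: "I u = 0" if "u \<le> 0" for u
      using that by (cases "u = 0") (auto simp: I_def)
    show ?thesis
    proof (cases "s = 0")
      case True
      have "((\<lambda>u. integral {-1..u} b) has_real_derivative b s) (at s within {-1..1})"
        using True cont by (intro integral_has_real_derivative) auto
      then have "((\<lambda>u. integral {-1..u} b) has_real_derivative b s) (at s)"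
        using True by (simp add: at_within_Icc_at)
      then show ?thesis
      proof (rule has_field_derivative_transform_within_open[of _ _ _ "{-1<..<1}"])
        fix u :: real assume u: "u \<in> {-1<..<1}"
        have z: "integral {-1..v} b = 0" if "v \<le> 0" for v
        proof -
          have "integral {-1..v} b = integral {-1..v} (\<lambda>_. 0)"
            by (rule integral_cong) (use that b_0 in auto)
          then show ?thesis by simp
        qed
        show "integral {-1..u} b = I u"
        proof (cases "u \<le> 0")
          case True
          then show ?thesis using z * by simp
        next
          case False
          then have "integral {-1..0} b + integral {0..u} b = integral {-1..u} b"
            using int by (intro Henstock_Kurzweil_Integration.integral_combine) auto
          then show ?thesis using z[of 0] by (simp add: I_def)
        qed
      qed (use True in auto)
    next
      case sn: False
      have "((\<lambda>_. 0) has_real_derivative 0) (at s)" by simp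
      then have "(I has_real_derivative 0) (at s)"
        by (rule has_field_derivative_transform_within_open[of _ _ _ "{..<0}"])
          (use False sn * in auto)
      then show ?thesis using b_0[of s] False by simp
    qed
  qed
  have mono: "I u \<le> I v" if "u \<le> v" for u v
    by (rule DERIV_nonneg_imp_nondecreasing[OF that]) (use deriv b_nonneg in blast)
  have I0: "I s = 0" if "s \<le> 0" for s
    using that by (cases "s = 0") (auto simp: I_def)
  have I1: "I s = I 1" if "1 \<le> s" for s
  proof -
    have "integral {0..1} b + integral {1..s} b = integral {0..s} b"
      using that int by (intro Henstock_Kurzweil_Integration.integral_combine) auto
    moreover have "integral {1..s} b = integral {1..s} (\<lambda>_. 0)"
      by (rule integral_cong) (use b_0 in auto)
    ultimately show ?thesis by (simp add: I_def)
  qed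
  have "I 0 < I 1"
  proof (rule DERIV_pos_imp_increasing_open[OF zero_less_one])
    show "\<exists>y. (I has_real_derivative y) (at x) \<and> 0 < y" if "0 < x" "x < 1" for x
      using deriv b_pos that by blast
    show "continuous_on {0..1} I"
      using deriv by (meson DERIV_isCont continuous_at_imp_continuous_on)
  qed
  then have c: "0 < I 1" using I0[of 0] by simp
  have s\<eta>: "smooth (\<lambda>s. (1 / I 1) * b s)" using smooth_b by (intro allI cd_mult cd_const) auto
  have dH: "((\<lambda>s. I s / I 1) has_real_derivative (1 / I 1) * b s) (at s)" for s
    using DERIV_cdivide[OF deriv, where c = "I 1"] by simp
  have sH: "smooth (\<lambda>s. I s / I 1)"
  proof
    show "continuously_differentiable k (\<lambda>s. I s / I 1)" for k
      using cd_Suc_imp[OF cd_Suc_realI[OF dH]] s\<eta> by blast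
  qed
  show thesis
  proof (rule that[OF sH s\<eta> dH])
    show "0 \<le> (1 / I 1) * b s" for s using c b_nonneg by simp
    show "I s / I 1 = 0" if "s \<le> 0" for s using I0[OF that] by simp
    show "I s / I 1 = 1" if "1 \<le> s" for s using I1[OF that] c by simp
    show "(1 / I 1) * b s = 0" if "s \<notin> {0<..<1}" for s using b_0[OF that] by simp
    show "0 \<le> I s / I 1" for s using c mono[of "min 0 s" s] I0[of "min 0 s"] by simp
    show "I s / I 1 \<le> 1" for s using c mono[of s "max 1 s"] I1[of "max 1 s"] by simp
  qed
qed

text \<open>The power is singular only at \<open>0\<close>, away from the support of \<open>f\<close>. This makes the flux
  \<open>|x|\<^sup>-\<^sup>\<beta> \<nabla>\<psi>\<close> of a cutoff that is constant near the origin a smooth field.\<close>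

lemma smooth_powr_mult:
  fixes f :: "real \<Rightarrow> real"
  assumes "smooth f" and "\<And>s. s < 1 \<Longrightarrow> f s = 0"
  shows "smooth (\<lambda>s. s powr a * f s)"
proof
  show "continuously_differentiable k (\<lambda>s. s powr a * f s)" for k
    using assms
  proof (induction k arbitrary: a f)
    case (Suc k)
    obtain f' where f': "smooth f'" "\<And>x. (f has_real_derivative f' x) (at x)"
      using smooth_real_derivative[OF Suc.prems(1)] by blast
    have f'0: "f' s = 0" if "s < 1" for s
    proof (rule DERIV_unique[OF f'(2)])
      have "((\<lambda>_. 0) has_real_derivative 0) (at s)" by simp
      then show "(f has_real_derivative 0) (at s)"
        by (rule has_field_derivative_transform_within_open[of _ _ _ "{..<1}"])
          (use that Suc.prems(2) in auto)
    qed
    show ?case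
    proof (rule cd_Suc_realI)
      show "continuously_differentiable k (\<lambda>s. a * (s powr (a - 1) * f s) + s powr a * f' s)"
        by (rule cd_add[OF cd_mult[OF cd_const Suc.IH[OF Suc.prems]] Suc.IH[OF f'(1) f'0]])
      show "((\<lambda>s. s powr a * f s) has_real_derivative
          a * (s powr (a - 1) * f s) + s powr a * f' s) (at s)" for s
      proof (cases "s < 1")
        case True
        have "((\<lambda>_. 0) has_real_derivative 0) (at s)" by simp
        then have "((\<lambda>s. s powr a * f s) has_real_derivative 0) (at s)"
          by (rule has_field_derivative_transform_within_open[of _ _ _ "{..<1}"])
            (use True Suc.prems(2) in auto)
        then show ?thesis using Suc.prems(2)[OF True] f'0[OF True] by simp
      next
        case False
        then show ?thesis
          using DERIV_mult[OF has_real_derivative_powr[of s a] f'(2)[of s]]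
          by (simp add: algebra_simps)
      qed
    qed
  next
    case 0
    have "isCont (\<lambda>s. s powr a * f s) s" for s
    proof (cases "s < 1")
      case True
      have "isCont (\<lambda>_. 0) s" by simp
      moreover have "eventually (\<lambda>x. 0 = x powr a * f x) (nhds s)"
        using eventually_nhds_in_open[of "{..<1}" s] True 0(2) by (auto elim: eventually_mono)
      ultimately show ?thesis using isCont_cong[of "\<lambda>_. 0" "\<lambda>s. s powr a * f s" s] by simp
    next
      case False
      have "isCont f s" using smooth_continuous[OF 0(1), of UNIV] by (simp add: continuous_on_eq_continuous_at)
      moreover have "isCont (\<lambda>s. s powr a) s"
        using False by (intro continuous_at_within_powr continuous_ident continuous_const) auto
      ultimately show ?thesis by (rule isCont_mult[rotated])
    qed
    then show ?case by (simp add: continuous_at_imp_continuous_on)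
  qed
qed

section \<open>Power weights and Barenblatt functions\<close>

lemma nn_integral_power_weight_scale:
  fixes f :: "'a::euclidean_space \<Rightarrow> ennreal"
  assumes [measurable]: "f \<in> borel_measurable borel" and c: "0 < c"
  shows "(\<integral>\<^sup>+ x. f (c *\<^sub>R x) * ennreal (norm x powr (- q)) \<partial>lborel)
    = ennreal (c powr (q - real DIM('a))) * (\<integral>\<^sup>+ x. f x * ennreal (norm x powr (- q)) \<partial>lborel)"
proof -
  let ?g = "\<lambda>x. f x * ennreal (norm x powr (- q))"
  have cd: "ennreal (c powr (q - real DIM('a))) * ennreal (\<bar>c\<bar> ^ DIM('a)) = ennreal (c powr q)"
    using c by (simp add: ennreal_mult[symmetric] powr_diff powr_realpow)
  have w: "c powr q * norm (c *\<^sub>R x) powr (- q) = norm x powr (- q)" for x :: 'a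
    using c by (simp add: powr_mult powr_minus)
  have w': "ennreal (c powr q) * ennreal (norm (c *\<^sub>R x) powr (- q)) = ennreal (norm x powr (- q))"
    for x :: 'a
    unfolding ennreal_mult[OF powr_ge_zero powr_ge_zero, symmetric] w ..
  have "(\<integral>\<^sup>+ x. ?g x \<partial>lborel)
      = (\<integral>\<^sup>+ x. ?g x \<partial>density (distr lborel borel (\<lambda>x. 0 + c *\<^sub>R x)) (\<lambda>_. ennreal (\<bar>c\<bar> ^ DIM('a))))"
    by (subst lborel_affine[of c 0]) (use c in auto)
  also have "\<dots> = (\<integral>\<^sup>+ x. ennreal (\<bar>c\<bar> ^ DIM('a)) * ?g (c *\<^sub>R x) \<partial>lborel)"
    by (simp add: nn_integral_density nn_integral_distr)
  also have "\<dots> = ennreal (\<bar>c\<bar> ^ DIM('a)) * (\<integral>\<^sup>+ x. ?g (c *\<^sub>R x) \<partial>lborel)"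
    by (rule nn_integral_cmult) measurable
  finally have "ennreal (c powr (q - real DIM('a))) * (\<integral>\<^sup>+ x. ?g x \<partial>lborel)
      = ennreal (c powr q) * (\<integral>\<^sup>+ x. ?g (c *\<^sub>R x) \<partial>lborel)"
    by (simp only: cd[symmetric] mult.assoc)
  also have "\<dots> = (\<integral>\<^sup>+ x. ennreal (c powr q) * ?g (c *\<^sub>R x) \<partial>lborel)"
    by (rule nn_integral_cmult[symmetric]) measurable
  also have "\<dots> = (\<integral>\<^sup>+ x. f (c *\<^sub>R x) * ennreal (norm x powr (- q)) \<partial>lborel)"
    by (intro nn_integral_cong) (simp only: mult.left_commute[of "ennreal (c powr q)"] w')
  finally show ?thesis by simp
qed

text \<open>The dilates \<open>r\<^sup>n S\<close> of a subset of an annulus have weights in geometric progression. With \<open>r = 2\<close> they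
  cover the exterior of a ball, with \<open>r = 1/2\<close> a punctured ball.\<close>

lemma nn_integral_power_weight_annuli:
  fixes S :: "'a::euclidean_space set"
  assumes [measurable]: "S \<in> sets borel" and S: "S \<subseteq> {x. 1 / 2 \<le> norm x \<and> norm x \<le> 2}"
    and r: "0 < r" "r powr (real DIM('a) - q) < 1"
  shows "(\<integral>\<^sup>+ x. indicator {x. \<exists>n. (1 / r ^ n) *\<^sub>R x \<in> S} x * ennreal (norm x powr (- q)) \<partial>lborel) < \<infinity>"
proof -
  let ?w = "\<lambda>x::'a. ennreal (norm x powr (- q))"
  let ?A = "\<integral>\<^sup>+ x. indicator S x * ?w x \<partial>lborel"
  let ?l = "r powr (real DIM('a) - q)"
  have bound: "norm x powr (- q) \<le> 2 powr \<bar>q\<bar>" if "x \<in> S" for x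
  proof (cases "0 \<le> q")
    case True
    have "norm x powr (- q) \<le> (1 / 2) powr (- q)"
      using S that True by (intro powr_mono2') auto
    then show ?thesis using True by (simp add: powr_minus powr_divide)
  next
    case False
    then show ?thesis using S that by (auto intro!: powr_mono2)
  qed
  have "?A \<le> (\<integral>\<^sup>+ x. ennreal (2 powr \<bar>q\<bar>) * indicator S x \<partial>lborel)"
    by (intro nn_integral_mono) (auto simp: indicator_def bound intro: ennreal_leI)
  also have "\<dots> = ennreal (2 powr \<bar>q\<bar>) * emeasure lborel S"
    by (simp add: nn_integral_cmult_indicator)
  also have "\<dots> < \<infinity>"
    using S emeasure_lborel_cball_finite[of 0 2] emeasure_mono[of S "cball 0 2" lborel]
    by (auto simp: ennreal_mult_less_top subset_iff intro: le_less_trans)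
  finally have A: "?A < \<infinity>" .
  have "(\<integral>\<^sup>+ x. indicator {x. \<exists>n. (1 / r ^ n) *\<^sub>R x \<in> S} x * ?w x \<partial>lborel)
      \<le> (\<integral>\<^sup>+ x. (\<Sum>n. indicator S ((1 / r ^ n) *\<^sub>R x) * ?w x) \<partial>lborel)"
  proof (intro nn_integral_mono)
    fix x :: 'a
    show "indicator {x. \<exists>n. (1 / r ^ n) *\<^sub>R x \<in> S} x * ?w x
        \<le> (\<Sum>n. indicator S ((1 / r ^ n) *\<^sub>R x) * ?w x)"
    proof (cases "\<exists>n. (1 / r ^ n) *\<^sub>R x \<in> S")
      case True
      then obtain n where "(1 / r ^ n) *\<^sub>R x \<in> S" by blast
      then have "?w x = (\<Sum>n\<in>{n}. indicator S ((1 / r ^ n) *\<^sub>R x) * ?w x)" by simp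
      also have "\<dots> \<le> (\<Sum>n. indicator S ((1 / r ^ n) *\<^sub>R x) * ?w x)"
        by (rule sum_le_suminf) auto
      finally show ?thesis using True by simp
    qed simp
  qed
  also have "\<dots> = (\<Sum>n. \<integral>\<^sup>+ x. indicator S ((1 / r ^ n) *\<^sub>R x) * ?w x \<partial>lborel)"
    by (rule nn_integral_suminf) measurable
  also have "\<dots> = (\<Sum>n. ennreal (?l ^ n) * ?A)"
  proof (intro suminf_cong)
    fix n
    have "(1 / r ^ n) powr (q - real DIM('a)) = ?l ^ n"
    proof -
      have "1 / r ^ n = r powr (- real n)"
        using r(1) by (simp add: powr_minus powr_realpow divide_inverse)
      moreover have "?l ^ n = ?l powr real n" using r(1) by (simp add: powr_realpow)
      ultimately show ?thesis by (simp add: powr_powr algebra_simps)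
    qed
    then show "(\<integral>\<^sup>+ x. indicator S ((1 / r ^ n) *\<^sub>R x) * ?w x \<partial>lborel) = ennreal (?l ^ n) * ?A"
      using nn_integral_power_weight_scale[of "indicator S" "1 / r ^ n" q] r(1) by simp
  qed
  also have "\<dots> = (\<Sum>n. ennreal (?l ^ n)) * ?A" by (rule ennreal_suminf_multc)
  also have "\<dots> = ennreal (\<Sum>n. ?l ^ n) * ?A"
    using r(2) by (subst suminf_ennreal2) (auto intro: summable_geometric)
  also have "\<dots> < \<infinity>" using A by (simp add: ennreal_mult_less_top)
  finally show ?thesis .
qed

lemma real_dyadic_interval:
  fixes y :: real
  assumes "1 \<le> y"
  shows "\<exists>n. 2 ^ n \<le> y \<and> y < 2 ^ Suc n"
proof -
  obtain k where k: "y < 2 ^ k" using real_arch_pow[of 2 y] by auto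
  define n where "n = (LEAST k. y < 2 ^ k)"
  have n: "y < 2 ^ n" unfolding n_def by (rule LeastI[of _ k]) (rule k)
  then obtain j where j: "n = Suc j" using assms by (cases n) auto
  have "\<not> y < 2 ^ j" using not_less_Least[of j "\<lambda>k. y < 2 ^ k"] j by (simp add: n_def)
  then show ?thesis using n j by (auto simp: not_less)
qed

lemma power_weight_integrable_at_infinity:
  assumes "real DIM('a::euclidean_space) < q"
  shows "(\<integral>\<^sup>+ (x::'a). indicator {x. 1 \<le> norm x} x * ennreal (norm x powr (- q)) \<partial>lborel) < \<infinity>"
proof -
  let ?S = "{x::'a. 1 \<le> norm x \<and> norm x \<le> 2}"
  have "(\<integral>\<^sup>+ (x::'a). indicator {x. 1 \<le> norm x} x * ennreal (norm x powr (- q)) \<partial>lborel)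
      \<le> (\<integral>\<^sup>+ x. indicator {x. \<exists>n. (1 / 2 ^ n) *\<^sub>R x \<in> ?S} x * ennreal (norm x powr (- q)) \<partial>lborel)"
  proof (intro nn_integral_mono mult_right_mono)
    fix x :: 'a
    have "\<exists>n. (1 / 2 ^ n) *\<^sub>R x \<in> ?S" if x: "1 \<le> norm x"
    proof -
      obtain n where "2 ^ n \<le> norm x" "norm x < 2 ^ Suc n" using real_dyadic_interval[OF x] by blast
      then show ?thesis by (intro exI[of _ n]) (auto simp: field_simps)
    qed
    then show "indicator {x. 1 \<le> norm x} x \<le> (indicator {x. \<exists>n. (1 / 2 ^ n) *\<^sub>R x \<in> ?S} x :: ennreal)"
      by (auto simp: indicator_def)
  qed simp
  also have "\<dots> < \<infinity>"
    using assms powr_less_mono[of "real DIM('a) - q" 0 2]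
    by (intro nn_integral_power_weight_annuli) auto
  finally show ?thesis .
qed

lemma power_weight_integrable_at_origin:
  assumes "q < real DIM('a::euclidean_space)"
  shows "(\<integral>\<^sup>+ (x::'a). indicator {x. norm x \<le> 1} x * ennreal (norm x powr (- q)) \<partial>lborel) < \<infinity>"
proof -
  let ?S = "{x::'a. 1 / 2 \<le> norm x \<and> norm x \<le> 1}"
  have "(\<integral>\<^sup>+ (x::'a). indicator {x. norm x \<le> 1} x * ennreal (norm x powr (- q)) \<partial>lborel)
      \<le> (\<integral>\<^sup>+ x. indicator {x. \<exists>n. (1 / (1 / 2) ^ n) *\<^sub>R x \<in> ?S} x * ennreal (norm x powr (- q)) \<partial>lborel)"
  proof (intro nn_integral_mono)
    fix x :: 'a
    have "\<exists>n. (1 / (1 / 2) ^ n) *\<^sub>R x \<in> ?S" if x: "norm x \<le> 1" "x \<noteq> 0"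
    proof -
      obtain n where "2 ^ n \<le> 1 / norm x" "1 / norm x < 2 ^ Suc n"
        using real_dyadic_interval[of "1 / norm x"] x by auto
      then show ?thesis using x by (intro exI[of _ n]) (auto simp: field_simps)
    qed
    then show "indicator {x. norm x \<le> 1} x * ennreal (norm x powr (- q))
        \<le> indicator {x. \<exists>n. (1 / (1 / 2) ^ n) *\<^sub>R x \<in> ?S} x * ennreal (norm x powr (- q))"
      by (cases "x = 0") (auto simp: indicator_def)
  qed
  also have "\<dots> < \<infinity>"
    using assms powr_less_mono[of 0 "real DIM('a) - q" 2]
    by (intro nn_integral_power_weight_annuli) (auto simp: powr_divide)
  finally show ?thesis .
qed

lemma power_weight_mass_ball:
  assumes "q < real DIM('a::euclidean_space)" "0 < \<rho>"
  shows "(\<integral>\<^sup>+ (x::'a). indicator {x. norm x \<le> \<rho>} x * ennreal (norm x powr (- q)) \<partial>lborel)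
    = ennreal (\<rho> powr (real DIM('a) - q))
      * (\<integral>\<^sup>+ (x::'a). indicator {x. norm x \<le> 1} x * ennreal (norm x powr (- q)) \<partial>lborel)"
proof -
  have "indicator {x. norm x \<le> 1} ((1 / \<rho>) *\<^sub>R x) = (indicator {x. norm x \<le> \<rho>} x :: ennreal)" for x :: 'a
    using assms by (auto simp: indicator_def field_simps)
  moreover have "(1 / \<rho>) powr (q - real DIM('a)) = \<rho> powr (real DIM('a) - q)"
    using assms(2) powr_minus_divide[of \<rho> "q - real DIM('a)"] by (simp add: powr_divide)
  ultimately show ?thesis
    using nn_integral_power_weight_scale[of "indicator {x::'a. norm x \<le> 1}" "1 / \<rho>" q] assms by simp
qed

lemma power_weight_mass_outside:
  assumes "real DIM('a::euclidean_space) < q" "0 < \<rho>"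
  shows "(\<integral>\<^sup>+ (x::'a). indicator {x. \<rho> \<le> norm x} x * ennreal (norm x powr (- q)) \<partial>lborel)
    = ennreal (\<rho> powr (real DIM('a) - q))
      * (\<integral>\<^sup>+ (x::'a). indicator {x. 1 \<le> norm x} x * ennreal (norm x powr (- q)) \<partial>lborel)"
proof -
  have "indicator {x. 1 \<le> norm x} ((1 / \<rho>) *\<^sub>R x) = (indicator {x. \<rho> \<le> norm x} x :: ennreal)" for x :: 'a
    using assms by (auto simp: indicator_def field_simps)
  moreover have "(1 / \<rho>) powr (q - real DIM('a)) = \<rho> powr (real DIM('a) - q)"
    using assms(2) powr_minus_divide[of \<rho> "q - real DIM('a)"] by (simp add: powr_divide)
  ultimately show ?thesis
    using nn_integral_power_weight_scale[of "indicator {x::'a. 1 \<le> norm x}" "1 / \<rho>" q] assms by simp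
qed

lemma AE_lborel_nonzero: "AE x::'a::euclidean_space in lborel. x \<noteq> 0"
  by (rule AE_lborel_singleton)

lemma profile_pos:
  assumes "0 < C"
  shows "0 < profile \<gamma> \<beta> m C x"
proof -
  have "0 < C + norm x powr sigma_exp \<gamma> \<beta>" using assms by (simp add: add_pos_nonneg)
  then show ?thesis by (simp add: profile_def)
qed

lemma profile_measurable [measurable]: "profile \<gamma> \<beta> m C \<in> borel_measurable borel"
  unfolding profile_def by measurable

lemma profile_le:
  assumes "0 < C" "m < 1"
  shows "profile \<gamma> \<beta> m C x \<le> C powr (- 1 / (1 - m))"
    and "x \<noteq> 0 \<Longrightarrow> profile \<gamma> \<beta> m C x \<le> norm x powr (- (sigma_exp \<gamma> \<beta> / (1 - m)))"
proof -
  show "profile \<gamma> \<beta> m C x \<le> C powr (- 1 / (1 - m))"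
    unfolding profile_def using assms by (intro powr_mono2') auto
  assume x: "x \<noteq> 0"
  have "profile \<gamma> \<beta> m C x \<le> (norm x powr sigma_exp \<gamma> \<beta>) powr (- 1 / (1 - m))"
    unfolding profile_def using assms x by (intro powr_mono2') auto
  then show "profile \<gamma> \<beta> m C x \<le> norm x powr (- (sigma_exp \<gamma> \<beta> / (1 - m)))"
    by (simp add: powr_powr)
qed

text \<open>Substitute \<open>x = C\<^bsup>1/\<sigma>\<^esup> y\<close>; then \<open>C + |x|\<^sup>\<sigma> = C (1 + |y|\<^sup>\<sigma>)\<close>.\<close>

lemma profile_mass_scale:
  fixes C :: real
  assumes C: "0 < C" and \<sigma>: "0 < sigma_exp \<gamma> \<beta>"
  shows "(\<integral>\<^sup>+ (x::'a::euclidean_space). ennreal (profile \<gamma> \<beta> m C x * norm x powr (- \<gamma>)) \<partial>lborel)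
    = ennreal (C powr ((real DIM('a) - \<gamma>) / sigma_exp \<gamma> \<beta> - 1 / (1 - m)))
      * (\<integral>\<^sup>+ (x::'a). ennreal (profile \<gamma> \<beta> m 1 x * norm x powr (- \<gamma>)) \<partial>lborel)"
proof -
  let ?\<sigma> = "sigma_exp \<gamma> \<beta>" and ?d = "real DIM('a)"
  let ?c = "C powr (1 / ?\<sigma>)"
  let ?I = "\<lambda>C. \<integral>\<^sup>+ (x::'a). ennreal (profile \<gamma> \<beta> m C x) * ennreal (norm x powr (- \<gamma>)) \<partial>lborel"
  have c: "0 < ?c" using C by simp
  have p: "profile \<gamma> \<beta> m C (?c *\<^sub>R x) = C powr (- 1 / (1 - m)) * profile \<gamma> \<beta> m 1 x" for x :: 'a
  proof -
    have "C + norm (?c *\<^sub>R x) powr ?\<sigma> = C * (1 + norm x powr ?\<sigma>)"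
      using C \<sigma> by (simp add: powr_mult powr_powr algebra_simps)
    then show ?thesis using C by (simp add: profile_def powr_mult)
  qed
  have "ennreal (?c powr (\<gamma> - ?d)) * ?I C
      = (\<integral>\<^sup>+ (x::'a). ennreal (profile \<gamma> \<beta> m C (?c *\<^sub>R x)) * ennreal (norm x powr (- \<gamma>)) \<partial>lborel)"
    using c by (intro nn_integral_power_weight_scale[symmetric]) auto
  also have "\<dots> = (\<integral>\<^sup>+ (x::'a). ennreal (C powr (- 1 / (1 - m))) *
      (ennreal (profile \<gamma> \<beta> m 1 x) * ennreal (norm x powr (- \<gamma>))) \<partial>lborel)"
    by (simp only: p ennreal_mult[OF powr_ge_zero less_imp_le[OF profile_pos[OF zero_less_one]]] mult.assoc)
  also have "\<dots> = ennreal (C powr (- 1 / (1 - m))) * ?I 1"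
    by (rule nn_integral_cmult) measurable
  finally have *: "ennreal (?c powr (\<gamma> - ?d)) * ?I C = ennreal (C powr (- 1 / (1 - m))) * ?I 1" .
  have "?I C = ennreal (?c powr (?d - \<gamma>)) * (ennreal (?c powr (\<gamma> - ?d)) * ?I C)"
    using c by (simp add: mult.assoc[symmetric] ennreal_mult[symmetric] powr_add[symmetric])
  also have "\<dots> = ennreal (?c powr (?d - \<gamma>) * C powr (- 1 / (1 - m))) * ?I 1"
    unfolding * by (simp add: ennreal_mult mult.assoc)
  also have "?c powr (?d - \<gamma>) * C powr (- 1 / (1 - m)) = C powr ((?d - \<gamma>) / ?\<sigma> - 1 / (1 - m))"
    by (simp add: powr_powr powr_add[symmetric])
  finally show ?thesis
    by (simp add: ennreal_mult'')
qed

text \<open>The exponents of \<open>R\<close> in the weighted mass of a profile outside radius \<open>R\<close> and in the flux of mass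
  through radius \<open>R\<close>. Both are negative because \<open>m > m\<^sub>c\<close>.\<close>

lemma tail_exponent:
  assumes "\<gamma> < d" "m_crit d \<gamma> \<beta> < m" "m < 1"
  shows "0 < theta_exp d \<gamma> \<beta> m"
    and "d - (sigma_exp \<gamma> \<beta> / (1 - m) + \<gamma>) = - (1 / (theta_exp d \<gamma> \<beta> m * (1 - m)))"
    and "d - 2 - \<beta> - (d - \<gamma>) * m = - (1 / theta_exp d \<gamma> \<beta> m)"
proof -
  show "0 < theta_exp d \<gamma> \<beta> m" using assms by (simp add: theta_exp_def)
  show *: "d - 2 - \<beta> - (d - \<gamma>) * m = - (1 / theta_exp d \<gamma> \<beta> m)"
    using assms by (simp add: theta_exp_def m_crit_def field_simps)
  have "d - (sigma_exp \<gamma> \<beta> / (1 - m) + \<gamma>) = (d - 2 - \<beta> - (d - \<gamma>) * m) / (1 - m)"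
    using assms by (simp add: sigma_exp_def field_simps)
  then show "d - (sigma_exp \<gamma> \<beta> / (1 - m) + \<gamma>) = - (1 / (theta_exp d \<gamma> \<beta> m * (1 - m)))"
    unfolding * by simp
qed

lemma profile_mass_finite_pos:
  assumes d: "\<gamma> < real DIM('a::euclidean_space)" and m: "m_crit (real DIM('a)) \<gamma> \<beta> < m" "m < 1"
  shows "(\<integral>\<^sup>+ (x::'a). ennreal (profile \<gamma> \<beta> m 1 x * norm x powr (- \<gamma>)) \<partial>lborel) \<in> {0<..<\<infinity>}"
proof -
  let ?I = "\<integral>\<^sup>+ (x::'a). ennreal (profile \<gamma> \<beta> m 1 x * norm x powr (- \<gamma>)) \<partial>lborel"
  let ?\<alpha> = "sigma_exp \<gamma> \<beta> / (1 - m)"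
  have "?I \<le> (\<integral>\<^sup>+ (x::'a). indicator {x. norm x \<le> 1} x * ennreal (norm x powr (- \<gamma>))
      + indicator {x. 1 \<le> norm x} x * ennreal (norm x powr (- (?\<alpha> + \<gamma>))) \<partial>lborel)"
  proof (rule nn_integral_mono)
    fix x :: 'a
    show "ennreal (profile \<gamma> \<beta> m 1 x * norm x powr (- \<gamma>))
        \<le> indicator {x. norm x \<le> 1} x * ennreal (norm x powr (- \<gamma>))
          + indicator {x. 1 \<le> norm x} x * ennreal (norm x powr (- (?\<alpha> + \<gamma>)))"
    proof (cases "norm x \<le> 1")
      case True
      have "profile \<gamma> \<beta> m 1 x * norm x powr (- \<gamma>) \<le> norm x powr (- \<gamma>)"
        using profile_le(1)[of 1 m \<gamma> \<beta> x] m by (intro mult_left_le_one_le) (auto simp: profile_def)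
      then have "ennreal (profile \<gamma> \<beta> m 1 x * norm x powr (- \<gamma>)) \<le> ennreal (norm x powr (- \<gamma>))"
        by (rule ennreal_leI)
      with True show ?thesis by (simp add: add_increasing2)
    next
      case False
      then have "profile \<gamma> \<beta> m 1 x * norm x powr (- \<gamma>) \<le> norm x powr (- ?\<alpha>) * norm x powr (- \<gamma>)"
        using m by (intro mult_right_mono profile_le(2)) auto
      also have "\<dots> = norm x powr (- (?\<alpha> + \<gamma>))" by (simp add: powr_add[symmetric])
      finally show ?thesis using False by (simp add: ennreal_leI)
    qed
  qed
  also have "\<dots> = (\<integral>\<^sup>+ (x::'a). indicator {x. norm x \<le> 1} x * ennreal (norm x powr (- \<gamma>)) \<partial>lborel)
      + (\<integral>\<^sup>+ (x::'a). indicator {x. 1 \<le> norm x} x * ennreal (norm x powr (- (?\<alpha> + \<gamma>))) \<partial>lborel)"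
    by (intro nn_integral_add) measurable
  also have "\<dots> < \<infinity>"
  proof -
    have "0 < 1 / (theta_exp (real DIM('a)) \<gamma> \<beta> m * (1 - m))"
      using tail_exponent(1)[OF d m] m by simp
    then have "real DIM('a) < ?\<alpha> + \<gamma>"
      using tail_exponent(2)[OF d m] by linarith
    then show ?thesis
      using power_weight_integrable_at_infinity[of "?\<alpha> + \<gamma>", where ?'a = 'a]
        power_weight_integrable_at_origin[of \<gamma>, where ?'a = 'a] d by simp
  qed
  finally have fin: "?I < \<infinity>" .
  have "?I \<noteq> 0"
  proof
    assume "?I = 0"
    then have "AE x::'a in lborel. ennreal (profile \<gamma> \<beta> m 1 x * norm x powr (- \<gamma>)) = 0"
      by (subst (asm) nn_integral_0_iff_AE) measurable
    then have "AE x::'a in lborel. False"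
      using AE_lborel_nonzero
    proof eventually_elim
      case (elim x)
      have "0 < profile \<gamma> \<beta> m 1 x * norm x powr (- \<gamma>)"
        using elim(2) by (intro mult_pos_pos profile_pos) auto
      then show ?case using elim(1) by (simp add: ennreal_eq_0_iff)
    qed
    then show False by (simp add: eventually_False ae_filter_eq_bot_iff)
  qed
  with fin show ?thesis by (simp add: zero_less_iff_neq_zero)
qed

text \<open>By \<open>profile_mass_scale\<close> the mass is a power of \<open>C\<close> with a negative exponent, so the equation for
  \<open>C\<close> can be solved explicitly.\<close>

lemma barenblatt_const_spec:
  fixes M :: real
  assumes d: "\<gamma> < real DIM('a::euclidean_space)" and \<sigma>: "0 < sigma_exp \<gamma> \<beta>"
    and m: "m_crit (real DIM('a)) \<gamma> \<beta> < m" "m < 1" and M: "0 < M"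
  defines "C \<equiv> barenblatt_const TYPE('a) \<gamma> \<beta> m M"
  shows "0 < C"
    and "(\<integral>\<^sup>+ (x::'a). ennreal (profile \<gamma> \<beta> m C x * norm x powr (- \<gamma>)) \<partial>lborel) = ennreal M"
proof -
  let ?I = "\<lambda>C. \<integral>\<^sup>+ (x::'a). ennreal (profile \<gamma> \<beta> m C x * norm x powr (- \<gamma>)) \<partial>lborel"
  let ?p = "(real DIM('a) - \<gamma>) / sigma_exp \<gamma> \<beta> - 1 / (1 - m)"
  obtain I1 where I1: "?I 1 = ennreal I1" "0 < I1"
    using profile_mass_finite_pos[OF d m] by (cases "?I 1") auto
  have p: "?p < 0"
  proof -
    have "?p = (real DIM('a) - (sigma_exp \<gamma> \<beta> / (1 - m) + \<gamma>)) / sigma_exp \<gamma> \<beta>"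
      using \<sigma> by (simp add: diff_divide_distrib add_divide_distrib)
    moreover have "0 < 1 / (theta_exp (real DIM('a)) \<gamma> \<beta> m * (1 - m))"
      using tail_exponent(1)[OF d m] m by simp
    ultimately show ?thesis
      using \<sigma> unfolding tail_exponent(2)[OF d m] by (simp add: divide_neg_pos)
  qed
  have I: "?I C = ennreal (C powr ?p * I1)" if "0 < C" for C
    using profile_mass_scale[OF that \<sigma>, where ?'a = 'a] I1 by (simp add: ennreal_mult)
  have iff: "?I C = ennreal M \<longleftrightarrow> C = (M / I1) powr (1 / ?p)" if C: "0 < C" for C
  proof -
    have "?I C = ennreal M \<longleftrightarrow> C powr ?p = M / I1"
      using I[OF C] I1 M by (simp add: field_simps)
    also have "\<dots> \<longleftrightarrow> C = (M / I1) powr (1 / ?p)"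
    proof
      assume "C powr ?p = M / I1"
      then have "(C powr ?p) powr (1 / ?p) = (M / I1) powr (1 / ?p)" by simp
      then show "C = (M / I1) powr (1 / ?p)" using p C by (simp only: powr_powr) simp
    next
      assume "C = (M / I1) powr (1 / ?p)"
      then have "C powr ?p = ((M / I1) powr (1 / ?p)) powr ?p" by simp
      then show "C powr ?p = M / I1" using p M I1 by (simp only: powr_powr) simp
    qed
    finally show ?thesis .
  qed
  have "\<exists>!C. 0 < C \<and> ?I C = ennreal M"
  proof (rule ex1I)
    show "0 < (M / I1) powr (1 / ?p) \<and> ?I ((M / I1) powr (1 / ?p)) = ennreal M"
      using iff[of "(M / I1) powr (1 / ?p)"] M I1 by simp
  qed (use iff in blast)
  from theI'[OF this] show "0 < C" "?I C = ennreal M"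
    unfolding C_def barenblatt_const_def by auto
qed

text \<open>The constant \<open>K\<close> does not depend on \<open>t\<close>, because \<open>B(t)\<close> is a dilation of one profile and only the
  ratio of \<open>\<rho>\<close> to the diffusive scale \<open>t\<^sup>\<theta>\<close> matters.\<close>

lemma barenblatt_mass_and_tail:
  fixes M :: real
  assumes d: "\<gamma> < real DIM('a::euclidean_space)" and \<sigma>: "0 < sigma_exp \<gamma> \<beta>"
    and m: "m_crit (real DIM('a)) \<gamma> \<beta> < m" "m < 1" "0 < m" and M: "0 < M"
  defines "\<theta> \<equiv> theta_exp (real DIM('a)) \<gamma> \<beta> m"
    and "B \<equiv> barenblatt \<gamma> \<beta> m M :: real \<Rightarrow> 'a \<Rightarrow> real"
  obtains K where "0 \<le> K"
    and "\<And>t. B t \<in> borel_measurable borel" and "\<And>t x. 0 \<le> B t x"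
    and "\<And>t. 0 < t \<Longrightarrow> L1w_norm \<gamma> (B t) = ennreal M"
    and "\<And>t \<rho>. 0 < t \<Longrightarrow> 0 < \<rho> \<Longrightarrow> L1w_norm \<gamma> (\<lambda>x. indicator {x. \<rho> \<le> norm x} x * B t x)
      \<le> ennreal (K * (\<rho> / t powr \<theta>) powr (- (1 / (\<theta> * (1 - m)))))"
proof -
  let ?d = "real DIM('a)"
  define C where "C = barenblatt_const TYPE('a) \<gamma> \<beta> m M"
  note C = barenblatt_const_spec[OF d \<sigma> m(1,2) M, folded C_def]
  define \<zeta> where "\<zeta> = ((1 - m) / (sigma_exp \<gamma> \<beta> * m)) powr \<theta>"
  have \<theta>: "0 < \<theta>" unfolding \<theta>_def by (rule tail_exponent(1)[OF d m(1,2)])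
  have \<zeta>: "0 < \<zeta>" using \<sigma> m by (simp add: \<zeta>_def)
  define l where "l t = \<zeta> / (t / \<theta>) powr \<theta>" for t
  have l: "0 < l t" if "0 < t" for t using that \<zeta> \<theta> by (simp add: l_def)
  have B: "B t x = l t powr (?d - \<gamma>) * profile \<gamma> \<beta> m C (l t *\<^sub>R x)" for t x
  proof -
    have "B t x = \<zeta> powr (?d - \<gamma>) / ((t / \<theta>) powr \<theta>) powr (?d - \<gamma>)
        * profile \<gamma> \<beta> m C ((\<zeta> / (t / \<theta>) powr \<theta>) *\<^sub>R x)"
      by (simp only: B_def barenblatt_def Let_def barenblatt_profile_def C_def \<zeta>_def \<theta>_def)
    then show ?thesis unfolding l_def using \<zeta> by (simp only: powr_divide less_imp_le powr_ge_zero)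
  qed
  have B_nonneg: "0 \<le> B t x" for t x unfolding B by (simp add: less_imp_le profile_pos[OF C(1)])
  have B_meas: "B t \<in> borel_measurable borel" for t unfolding B[abs_def] by measurable
  let ?p = "\<lambda>x::'a. ennreal (profile \<gamma> \<beta> m C x)"
  have scale: "(\<integral>\<^sup>+ x. ennreal (\<bar>indicator {x. \<rho> \<le> norm x} x * B t x\<bar> * norm x powr (- \<gamma>)) \<partial>lborel)
      = (\<integral>\<^sup>+ x. (indicator {x. l t * \<rho> \<le> norm x} x * ?p x) * ennreal (norm x powr (- \<gamma>)) \<partial>lborel)"
    if t: "0 < t" for t \<rho>
  proof -
    let ?J = "\<integral>\<^sup>+ x. (indicator {x. l t * \<rho> \<le> norm x} x * ?p x) * ennreal (norm x powr (- \<gamma>)) \<partial>lborel"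
    have i: "indicator {x. l t * \<rho> \<le> norm x} (l t *\<^sub>R x) = (indicator {x. \<rho> \<le> norm x} x :: ennreal)" for x :: 'a
      using l[OF t] by (simp add: indicator_def)
    have "(\<integral>\<^sup>+ x. ennreal (\<bar>indicator {x. \<rho> \<le> norm x} x * B t x\<bar> * norm x powr (- \<gamma>)) \<partial>lborel)
        = (\<integral>\<^sup>+ x. ennreal (l t powr (?d - \<gamma>)) * ((indicator {x. l t * \<rho> \<le> norm x} (l t *\<^sub>R x)
            * ?p (l t *\<^sub>R x)) * ennreal (norm x powr (- \<gamma>))) \<partial>lborel)"
      unfolding i using B_nonneg profile_pos[OF C(1), THEN less_imp_le]
      by (intro nn_integral_cong) (auto simp: B indicator_def ennreal_mult' ennreal_mult'' mult.assoc)
    also have "\<dots> = ennreal (l t powr (?d - \<gamma>)) * (\<integral>\<^sup>+ x. (indicator {x. l t * \<rho> \<le> norm x} (l t *\<^sub>R x)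
            * ?p (l t *\<^sub>R x)) * ennreal (norm x powr (- \<gamma>)) \<partial>lborel)"
      by (rule nn_integral_cmult) measurable
    also have "\<dots> = ennreal (l t powr (?d - \<gamma>)) * (ennreal (l t powr (\<gamma> - ?d)) * ?J)"
      using l[OF t] by (subst nn_integral_power_weight_scale) auto
    also have "\<dots> = ?J"
      using l[OF t] by (simp add: mult.assoc[symmetric] ennreal_mult[symmetric] powr_add[symmetric])
    finally show ?thesis .
  qed
  let ?\<alpha> = "sigma_exp \<gamma> \<beta> / (1 - m)"
  let ?e = "- (1 / (\<theta> * (1 - m)))"
  let ?T = "\<integral>\<^sup>+ (x::'a). indicator {x. 1 \<le> norm x} x * ennreal (norm x powr (- (?\<alpha> + \<gamma>))) \<partial>lborel"
  note ex = tail_exponent(2)[OF d m(1,2), folded \<theta>_def]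
  have q: "?d < ?\<alpha> + \<gamma>"
  proof -
    have "0 < 1 / (\<theta> * (1 - m))" using \<theta> m by simp
    then show ?thesis using ex by linarith
  qed
  obtain T where T: "?T = ennreal T" "0 \<le> T"
    using power_weight_integrable_at_infinity[OF q] by (cases ?T) auto
  have tail: "(\<integral>\<^sup>+ x. (indicator {x. \<rho> \<le> norm x} x * ?p x) * ennreal (norm x powr (- \<gamma>)) \<partial>lborel)
      \<le> ennreal (\<rho> powr ?e * T)" if \<rho>: "0 < \<rho>" for \<rho>
  proof -
    have "(\<integral>\<^sup>+ x. (indicator {x. \<rho> \<le> norm x} x * ?p x) * ennreal (norm x powr (- \<gamma>)) \<partial>lborel)
        \<le> (\<integral>\<^sup>+ (x::'a). indicator {x. \<rho> \<le> norm x} x * ennreal (norm x powr (- (?\<alpha> + \<gamma>))) \<partial>lborel)"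
    proof (intro nn_integral_mono)
      fix x :: 'a
      show "(indicator {x. \<rho> \<le> norm x} x * ?p x) * ennreal (norm x powr (- \<gamma>))
          \<le> indicator {x. \<rho> \<le> norm x} x * ennreal (norm x powr (- (?\<alpha> + \<gamma>)))"
      proof (cases "\<rho> \<le> norm x")
        case True
        then have "x \<noteq> 0" using \<rho> by auto
        then have "profile \<gamma> \<beta> m C x * norm x powr (- \<gamma>) \<le> norm x powr (- ?\<alpha>) * norm x powr (- \<gamma>)"
          using C m by (intro mult_right_mono profile_le(2)) auto
        also have "\<dots> = norm x powr (- (?\<alpha> + \<gamma>))" by (simp add: powr_add[symmetric])
        finally show ?thesis
          using True profile_pos[OF C(1), of \<gamma> \<beta> m x] by (simp add: ennreal_mult[symmetric] ennreal_leI)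
      qed simp
    qed
    also have "\<dots> = ennreal (\<rho> powr ?e) * ?T"
      unfolding power_weight_mass_outside[OF q \<rho>] ex ..
    finally show ?thesis using T by (simp add: ennreal_mult)
  qed
  show thesis
  proof (rule that[of "(\<zeta> * \<theta> powr \<theta>) powr ?e * T"])
    show "0 \<le> (\<zeta> * \<theta> powr \<theta>) powr ?e * T" using T by simp
    show "L1w_norm \<gamma> (B t) = ennreal M" if t: "0 < t" for t
    proof -
      have "L1w_norm \<gamma> (B t) = (\<integral>\<^sup>+ x. ?p x * ennreal (norm x powr (- \<gamma>)) \<partial>lborel)"
        using scale[OF t, of 0] by (simp add: L1w_norm_def)
      also have "\<dots> = ennreal M"
        unfolding C(2)[symmetric] by (simp add: ennreal_mult'')
      finally show ?thesis .
    qed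
    show "L1w_norm \<gamma> (\<lambda>x. indicator {x. \<rho> \<le> norm x} x * B t x)
      \<le> ennreal ((\<zeta> * \<theta> powr \<theta>) powr ?e * T * (\<rho> / t powr \<theta>) powr ?e)"
      if t: "0 < t" and \<rho>: "0 < \<rho>" for t \<rho>
    proof -
      have "l t * \<rho> = (\<zeta> * \<theta> powr \<theta>) * (\<rho> / t powr \<theta>)"
        using t \<theta> by (simp add: l_def powr_divide)
      then have eq: "(\<zeta> * \<theta> powr \<theta>) powr ?e * T * (\<rho> / t powr \<theta>) powr ?e = (l t * \<rho>) powr ?e * T"
        by (simp only: powr_mult mult_ac)
      show ?thesis
        unfolding L1w_norm_def scale[OF t] eq by (rule tail) (use l[OF t] \<rho> in simp)
    qed
  qed (fact B_meas, fact B_nonneg)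
qed

section \<open>Bounds on weak derivatives in time\<close>

lemma DERIV_rescale:
  fixes H :: "real \<Rightarrow> real"
  assumes "\<And>s. (H has_real_derivative \<eta> s) (at s)"
  shows "((\<lambda>t. H ((t - a) / \<epsilon>)) has_real_derivative \<eta> ((t - a) / \<epsilon>) / \<epsilon>) (at t)"
proof -
  have "((\<lambda>t. (t - a) / \<epsilon>) has_real_derivative 1 / \<epsilon>) (at t)"
    by (rule DERIV_cdivide) (auto intro!: derivative_eq_intros)
  from DERIV_chain2[OF assms this] show ?thesis by simp
qed

lemma average_against_bump:
  fixes F H \<eta> :: "real \<Rightarrow> real"
  assumes F: "continuous_on {a..a + \<epsilon>} F" and \<epsilon>: "0 < \<epsilon>"
    and close: "\<And>t. t \<in> {a..a + \<epsilon>} \<Longrightarrow> \<bar>F t - F a\<bar> \<le> e"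
    and H: "\<And>s. (H has_real_derivative \<eta> s) (at s)" "H 0 = 0" "H 1 = 1"
    and \<eta>: "continuous_on UNIV \<eta>" "\<And>s. 0 \<le> \<eta> s" "\<And>s. s \<notin> {0<..<1} \<Longrightarrow> \<eta> s = 0"
  defines "g \<equiv> \<lambda>t. \<eta> ((t - a) / \<epsilon>) / \<epsilon>"
  shows "integrable lborel (\<lambda>t. F t * g t)" and "\<bar>(LINT t|lborel. F t * g t) - F a\<bar> \<le> e"
proof -
  have g_cont: "continuous_on S g" for S
    unfolding g_def by (intro continuous_intros continuous_on_compose2[OF \<eta>(1)]) (use \<epsilon> in auto)
  have g_nonneg: "0 \<le> g t" for t using \<eta>(2) \<epsilon> by (simp add: g_def)
  have g_0: "g t = 0" if "t \<notin> {a..a + \<epsilon>}" for t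
  proof -
    have "(t - a) / \<epsilon> \<notin> {0<..<1}" using that \<epsilon> by (auto simp: field_simps)
    then show ?thesis using \<eta>(3) by (simp add: g_def)
  qed
  have g_ind: "f t * g t = indicator {a..a + \<epsilon>} t *\<^sub>R (f t * g t)" for f t
    using g_0[of t] by (cases "t \<in> {a..a + \<epsilon>}") auto
  have "((\<lambda>t. H ((t - a) / \<epsilon>)) has_real_derivative g t) (at t)" for t
    unfolding g_def by (rule DERIV_rescale[OF H(1)])
  then have "has_bochner_integral lborel (\<lambda>t. g t * indicator {a..a + \<epsilon>} t)
      (H ((a + \<epsilon> - a) / \<epsilon>) - H ((a - a) / \<epsilon>))"
    using \<epsilon> g_cont[of UNIV] by (intro has_bochner_integral_FTC_Icc_real) (auto simp: continuous_on_eq_continuous_at)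
  moreover have "(\<lambda>t. g t * indicator {a..a + \<epsilon>} t) = g"
    using g_0 by (auto simp: fun_eq_iff indicator_def)
  ultimately have g_int: "integrable lborel g" "(LINT t|lborel. g t) = 1"
    using \<epsilon> H(2,3) by (auto simp: has_bochner_integral_iff)
  show Fg: "integrable lborel (\<lambda>t. F t * g t)"
    by (subst g_ind) (intro borel_integrable_compact compact_Icc continuous_intros F g_cont)
  have *: "(LINT t|lborel. F t * g t) - F a = (LINT t|lborel. (F t - F a) * g t)"
    using Fg g_int by (simp add: left_diff_distrib)
  have bd: "\<bar>(F t - F a) * g t\<bar> \<le> e * g t" for t
    using close[of t] g_nonneg[of t] g_0[of t]
    by (cases "t \<in> {a..a + \<epsilon>}") (auto simp: abs_mult intro: mult_right_mono)
  have int: "integrable lborel (\<lambda>t. (F t - F a) * g t)"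
    using Fg g_int by (simp add: left_diff_distrib)
  have "\<bar>LINT t|lborel. (F t - F a) * g t\<bar> \<le> (LINT t|lborel. e * g t)"
    using int g_int bd by (intro order_trans[OF integral_abs_bound] integral_mono) auto
  then show "\<bar>(LINT t|lborel. F t * g t) - F a\<bar> \<le> e"
    unfolding * using g_int by simp
qed

text \<open>Test functions \<open>\<xi>\<close> that approximate the indicator of \<open>[a, b]\<close> turn \<open>\<integral> F \<xi>'\<close> into the difference of an
  average of \<open>F\<close> near \<open>a\<close> and one near \<open>b\<close>; by continuity these averages converge to \<open>F a\<close> and \<open>F b\<close>.\<close>

lemma lipschitz_if_weak_derivative_bounded:
  fixes F :: "real \<Rightarrow> real"
  assumes F: "continuous_on {0<..} F" and ab: "0 < a" "a < b" "b < T"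
    and weak: "\<And>\<xi> \<xi>' p q. smooth \<xi> \<Longrightarrow> (\<And>t. (\<xi> has_real_derivative \<xi>' t) (at t)) \<Longrightarrow>
      (\<And>t. 0 \<le> \<xi> t \<and> \<xi> t \<le> 1) \<Longrightarrow> (\<And>t. t \<notin> {p..q} \<Longrightarrow> \<xi> t = 0) \<Longrightarrow> 0 < p \<Longrightarrow> p < q \<Longrightarrow> q \<le> T \<Longrightarrow>
      \<bar>LINT t|lborel. F t * \<xi>' t\<bar> \<le> K * (q - p)"
  shows "\<bar>F b - F a\<bar> \<le> K * (b - a)"
proof -
  obtain H \<eta> :: "real \<Rightarrow> real" where H: "smooth H" "smooth \<eta>"
    "\<And>s. (H has_real_derivative \<eta> s) (at s)" "\<And>s. 0 \<le> \<eta> s"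
    "\<And>s. s \<le> 0 \<Longrightarrow> H s = 0" "\<And>s. 1 \<le> s \<Longrightarrow> H s = 1" "\<And>s. s \<notin> {0<..<1} \<Longrightarrow> \<eta> s = 0"
    "\<And>s. 0 \<le> H s" "\<And>s. H s \<le> 1"
    using smooth_step_exists by blast
  have approx: "\<bar>F b - F a\<bar> \<le> K * (b + \<epsilon> - a) + 2 * e"
    if \<epsilon>: "0 < \<epsilon>" "b + \<epsilon> \<le> T" "a + \<epsilon> \<le> b"
      and e: "\<And>t. t \<in> {a..a + \<epsilon>} \<Longrightarrow> \<bar>F t - F a\<bar> \<le> e" "\<And>t. t \<in> {b..b + \<epsilon>} \<Longrightarrow> \<bar>F t - F b\<bar> \<le> e"
    for \<epsilon> e
  proof -
    \<comment> \<open>rises from \<open>0\<close> to \<open>1\<close> on \<open>[a, a + \<epsilon>]\<close> and falls back on \<open>[b, b + \<epsilon>]\<close>\<close>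
    define \<xi> where "\<xi> t = H ((t - a) / \<epsilon>) + - 1 * H ((t - b) / \<epsilon>)" for t
    define g where "g c t = \<eta> ((t - c) / \<epsilon>) / \<epsilon>" for c t
    have "smooth (\<lambda>t. 1 / \<epsilon> * t + - (c / \<epsilon>))" for c :: real
      by (intro allI cd_add cd_const cd_bounded_linear bounded_linear_mult_right)
    then have aff: "smooth (\<lambda>t. (t - c) / \<epsilon>)" for c :: real
      by (simp add: diff_divide_distrib)
    have "smooth \<xi>"
      unfolding \<xi>_def using aff H(1)
      by (intro allI cd_add cd_mult[OF cd_const] cd_compose[of _ H "\<lambda>t. (t - a) / \<epsilon>"]
          cd_compose[of _ H "\<lambda>t. (t - b) / \<epsilon>"]) blast+
    moreover have "(\<xi> has_real_derivative g a t - g b t) (at t)" for t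
      unfolding \<xi>_def g_def
      using DERIV_diff[OF DERIV_rescale[OF H(3)] DERIV_rescale[OF H(3)]] by simp
    moreover have "0 \<le> \<xi> t \<and> \<xi> t \<le> 1" for t
    proof (cases "t \<le> b")
      case True
      then have "H ((t - b) / \<epsilon>) = 0" using \<epsilon> by (intro H(5)) (auto simp: field_simps)
      then show ?thesis using H(8,9) by (simp add: \<xi>_def)
    next
      case False
      then have "H ((t - a) / \<epsilon>) = 1" using \<epsilon> by (intro H(6)) (auto simp: field_simps)
      then show ?thesis using H(8,9) by (simp add: \<xi>_def)
    qed
    moreover have "\<xi> t = 0" if t: "t \<notin> {a..b + \<epsilon>}" for t
    proof (cases "t < a")
      case True
      then have "H ((t - a) / \<epsilon>) = 0" "H ((t - b) / \<epsilon>) = 0"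
        using \<epsilon> ab by (auto intro!: H(5) simp: field_simps)
      then show ?thesis by (simp add: \<xi>_def)
    next
      case False
      then have "H ((t - a) / \<epsilon>) = 1" "H ((t - b) / \<epsilon>) = 1"
        using \<epsilon> ab t by (auto intro!: H(6) simp: field_simps)
      then show ?thesis by (simp add: \<xi>_def)
    qed
    ultimately have K: "\<bar>LINT t|lborel. F t * (g a t - g b t)\<bar> \<le> K * (b + \<epsilon> - a)"
      using ab \<epsilon> by (intro weak[of \<xi>]) auto
    have cont: "continuous_on {c..c + \<epsilon>} F" if "c \<in> {a, b}" for c
      using that ab by (intro continuous_on_subset[OF F]) auto
    note av = average_against_bump[OF cont \<epsilon>(1) _ H(3) _ _ smooth_continuous[OF H(2)] H(4) H(7), folded g_def]
    have A: "integrable lborel (\<lambda>t. F t * g a t)" "\<bar>(LINT t|lborel. F t * g a t) - F a\<bar> \<le> e"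
      using av[of a e] e(1) H(5)[of 0] H(6)[of 1] by simp_all
    have B: "integrable lborel (\<lambda>t. F t * g b t)" "\<bar>(LINT t|lborel. F t * g b t) - F b\<bar> \<le> e"
      using av[of b e] e(2) H(5)[of 0] H(6)[of 1] by simp_all
    have "(LINT t|lborel. F t * (g a t - g b t))
        = (LINT t|lborel. F t * g a t) - (LINT t|lborel. F t * g b t)"
      using A(1) B(1) by (simp add: right_diff_distrib)
    with K A(2) B(2) show ?thesis by linarith
  qed
  show ?thesis
  proof (rule field_le_epsilon)
    fix e :: real assume "0 < e"
    define e' where "e' = e / 4"
    have e': "0 < e'" using \<open>0 < e\<close> by (simp add: e'_def)
    have "isCont F a" "isCont F b"
      using F ab by (auto simp: continuous_on_eq_continuous_at)
    then have "\<exists>r>0. \<forall>t. dist t a < r \<longrightarrow> dist (F t) (F a) < e'"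
      "\<exists>s>0. \<forall>t. dist t b < s \<longrightarrow> dist (F t) (F b) < e'"
      using e' unfolding continuous_at_eps_delta by blast+
    then obtain r s where rs: "0 < r" "\<And>t. \<bar>t - a\<bar> < r \<Longrightarrow> \<bar>F t - F a\<bar> < e'"
      "0 < s" "\<And>t. \<bar>t - b\<bar> < s \<Longrightarrow> \<bar>F t - F b\<bar> < e'"
      unfolding dist_real_def by blast
    define Y where "Y = {r / 2, s / 2, T - b, b - a, e / (2 * (\<bar>K\<bar> + 1))}"
    define \<epsilon> where "\<epsilon> = Min Y"
    have le: "\<epsilon> \<le> y" if "y \<in> Y" for y
      unfolding \<epsilon>_def by (rule Min_le) (use that in \<open>simp_all add: Y_def\<close>)
    have "0 < e / (2 * (\<bar>K\<bar> + 1))" using \<open>0 < e\<close> by (simp add: add_nonneg_pos)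
    then have "\<forall>y\<in>Y. 0 < y" using rs(1,3) ab by (auto simp: Y_def)
    then have "0 < \<epsilon>" unfolding \<epsilon>_def by (subst Min_gr_iff) (auto simp: Y_def)
    then have \<epsilon>: "0 < \<epsilon>" "\<epsilon> \<le> r / 2" "\<epsilon> \<le> s / 2" "\<epsilon> \<le> T - b" "\<epsilon> \<le> b - a" "\<epsilon> \<le> e / (2 * (\<bar>K\<bar> + 1))"
      using le[unfolded Y_def] by blast+
    have "\<bar>F b - F a\<bar> \<le> K * (b + \<epsilon> - a) + 2 * e'"
    proof (rule approx)
      show "\<bar>F t - F a\<bar> \<le> e'" if "t \<in> {a..a + \<epsilon>}" for t
        using rs(2)[of t] that \<epsilon> rs(1) by auto
      show "\<bar>F t - F b\<bar> \<le> e'" if "t \<in> {b..b + \<epsilon>}" for t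
        using rs(4)[of t] that \<epsilon> rs(3) by auto
    qed (use \<epsilon> in auto)
    also have "K * (b + \<epsilon> - a) \<le> K * (b - a) + (\<bar>K\<bar> + 1) * \<epsilon>"
    proof -
      have "K * \<epsilon> \<le> (\<bar>K\<bar> + 1) * \<epsilon>" using \<epsilon>(1) by (intro mult_right_mono) auto
      then show ?thesis by (simp add: algebra_simps)
    qed
    also have "(\<bar>K\<bar> + 1) * \<epsilon> \<le> e / 2"
      using \<epsilon>(6) by (simp add: field_simps)
    finally show "\<bar>F b - F a\<bar> \<le> K * (b - a) + e" by (simp add: e'_def)
  qed
qed

section \<open>Separated test functions in the weak formulation\<close>

lemma integrable_continuous_scaleR:
  fixes f :: "'b::euclidean_space \<Rightarrow> 'c::euclidean_space"
  assumes f: "locally_integrable \<Omega> f" and K: "compact K" "K \<subseteq> \<Omega>"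
    and g: "continuous_on UNIV g" "\<And>z. z \<notin> K \<Longrightarrow> g z = (0::real)"
  shows "integrable lborel (\<lambda>z. g z *\<^sub>R f z)"
proof -
  have fK: "integrable lborel (\<lambda>z. indicator K z *\<^sub>R f z)"
    using f K by (auto simp: locally_integrable_def set_integrable_def)
  have "bounded (g ` K)"
    using K(1) continuous_on_subset[OF g(1)] by (intro compact_imp_bounded compact_continuous_image) auto
  then obtain c where c: "\<And>z. z \<in> K \<Longrightarrow> \<bar>g z\<bar> \<le> c" by (auto simp: bounded_iff)
  have eq: "g z *\<^sub>R f z = g z *\<^sub>R (indicator K z *\<^sub>R f z)" for z
    using g(2) by (auto simp: indicator_def)
  have [measurable]: "g \<in> borel_measurable borel" by (rule borel_measurable_continuous_onI[OF g(1)])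
  show ?thesis
    unfolding eq
  proof (rule Bochner_Integration.integrable_bound)
    show "integrable lborel (\<lambda>z. c *\<^sub>R (indicator K z *\<^sub>R f z))"
      using fK by (rule integrable_scaleR_right)
    show "(\<lambda>z. g z *\<^sub>R (indicator K z *\<^sub>R f z)) \<in> borel_measurable lborel"
      using borel_measurable_integrable[OF fK] by measurable
    show "AE z in lborel. norm (g z *\<^sub>R (indicator K z *\<^sub>R f z)) \<le> norm (c *\<^sub>R (indicator K z *\<^sub>R f z))"
      using order_trans[OF c abs_ge_self]
      by (auto simp: indicator_def intro!: AE_I2 mult_right_mono)
  qed
qed

lemma integrable_scaleR_continuous:
  fixes f :: "'b::euclidean_space \<Rightarrow> real" and g :: "'b \<Rightarrow> 'c::euclidean_space"
  assumes f: "locally_integrable \<Omega> f" and K: "compact K" "K \<subseteq> \<Omega>"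
    and g: "continuous_on UNIV g" "\<And>z. z \<notin> K \<Longrightarrow> g z = 0"
  shows "integrable lborel (\<lambda>z. f z *\<^sub>R g z)"
proof -
  have "integrable lborel (\<lambda>z. (g z \<bullet> b) *\<^sub>R f z)" for b
    using f K g by (intro integrable_continuous_scaleR[of \<Omega> f K] continuous_intros) auto
  then have "integrable lborel (\<lambda>z. \<Sum>b\<in>Basis. ((g z \<bullet> b) *\<^sub>R f z) *\<^sub>R b)"
    by (intro Bochner_Integration.integrable_sum integrable_scaleR_left) auto
  moreover have "(\<Sum>b\<in>Basis. ((g z \<bullet> b) *\<^sub>R f z) *\<^sub>R b) = f z *\<^sub>R g z" for z
    by (subst (2) euclidean_representation[of "g z", symmetric])
      (simp add: scaleR_sum_right mult.commute)
  ultimately show ?thesis by simp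
qed

lemma DERIV_zero_outside:
  fixes f :: "real \<Rightarrow> real"
  assumes "\<And>s. s \<notin> {a..b} \<Longrightarrow> f s = 0" "(f has_real_derivative D) (at s)" "s \<notin> {a..b}"
  shows "D = 0"
proof (rule DERIV_unique[OF assms(2)])
  have "((\<lambda>_. 0) has_real_derivative 0) (at s)" by simp
  then show "(f has_real_derivative 0) (at s)"
    by (rule has_field_derivative_transform_within_open[of _ _ _ "- {a..b}"]) (use assms in auto)
qed

lemma normsq_has_derivative:
  "((\<lambda>z::real \<times> 'a::euclidean_space. (norm (snd z))\<^sup>2 / R\<^sup>2) has_derivative
     (\<lambda>v. 2 * (snd z \<bullet> snd v) / R\<^sup>2)) (at z)"
  unfolding power2_norm_eq_inner divide_inverse
  by (auto intro!: derivative_eq_intros simp: inner_commute algebra_simps)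

lemma smooth_normsq: "smooth (\<lambda>z::real \<times> 'a::euclidean_space. (norm (snd z))\<^sup>2 / R\<^sup>2)"
proof
  fix k
  have "bounded_linear (\<lambda>z::real \<times> 'a. 2 * (snd z \<bullet> w) / R\<^sup>2)" for w
    unfolding divide_inverse
    by (intro bounded_linear_mult_const bounded_linear_const_mult bounded_linear_inner_left_comp bounded_linear_snd)
  then show "continuously_differentiable k (\<lambda>z::real \<times> 'a. (norm (snd z))\<^sup>2 / R\<^sup>2)"
    by (rule cd_Suc_imp[OF cd_SucI[OF normsq_has_derivative cd_bounded_linear]])
qed

lemma separated_smooth:
  assumes "smooth \<xi>" "smooth h"
  shows "smooth (\<lambda>z::real \<times> 'a::euclidean_space. \<xi> (fst z) * h ((norm (snd z))\<^sup>2 / R\<^sup>2))"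
proof (intro allI cd_mult)
  fix k
  show "continuously_differentiable k (\<lambda>z::real \<times> 'a. \<xi> (fst z))"
    by (rule cd_compose[OF assms(1)[rule_format] cd_bounded_linear[OF bounded_linear_fst]])
  show "continuously_differentiable k (\<lambda>z::real \<times> 'a. h ((norm (snd z))\<^sup>2 / R\<^sup>2))"
    by (rule cd_compose[OF assms(2)[rule_format] smooth_normsq[rule_format]])
qed

lemma separated_has_derivative:
  fixes z :: "real \<times> 'a::euclidean_space"
  assumes "\<And>t. (\<xi> has_real_derivative \<xi>' t) (at t)" "\<And>s. (h has_real_derivative h' s) (at s)"
  shows "((\<lambda>z. \<xi> (fst z) * h ((norm (snd z))\<^sup>2 / R\<^sup>2)) has_derivative
    (\<lambda>v. \<xi>' (fst z) * fst v * h ((norm (snd z))\<^sup>2 / R\<^sup>2)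
      + \<xi> (fst z) * (h' ((norm (snd z))\<^sup>2 / R\<^sup>2) * (2 * (snd z \<bullet> snd v) / R\<^sup>2)))) (at z)"
proof -
  have 1: "((\<lambda>z. \<xi> (fst z)) has_derivative (\<lambda>v. \<xi>' (fst z) * fst v)) (at z)"
    using has_derivative_compose[OF bounded_linear_imp_has_derivative[OF bounded_linear_fst]
        assms(1)[unfolded has_field_derivative_def], of z] .
  have 2: "((\<lambda>z. h ((norm (snd z))\<^sup>2 / R\<^sup>2)) has_derivative
      (\<lambda>v. h' ((norm (snd z))\<^sup>2 / R\<^sup>2) * (2 * (snd z \<bullet> snd v) / R\<^sup>2))) (at z)"
    by (rule has_derivative_compose[OF normsq_has_derivative assms(2)[unfolded has_field_derivative_def]])
  show ?thesis
    using has_derivative_mult[OF 1 2] by (simp add: add.commute)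
qed

lemma space_grad_inner_Basis:
  "b \<in> Basis \<Longrightarrow> space_grad \<phi> z \<bullet> b = frechet_derivative \<phi> (at z) (0, b)"
  by (simp add: space_grad_def inner_sum_left_Basis)

lemma set_lebesgue_integral_eq_integral:
  fixes f :: "'b \<Rightarrow> 'c::euclidean_space"
  assumes "\<And>z. z \<notin> \<Omega> \<Longrightarrow> f z = 0"
  shows "(LINT z:\<Omega>|M. f z) = (LINT z|M. f z)"
  unfolding set_lebesgue_integral_def
  by (intro Bochner_Integration.integral_cong) (use assms in \<open>auto simp: indicator_def\<close>)

lemma weighted_powr_rescale:
  fixes x :: "'a::real_normed_vector"
  assumes "0 < R"
  shows "R powr (- \<beta> - 2) * (2 * (((norm x)\<^sup>2 / R\<^sup>2) powr (- \<beta> / 2) * c)) = norm x powr (- \<beta>) * (c * 2 / R\<^sup>2)"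
proof (cases "x = 0")
  case False
  have "((norm x)\<^sup>2 / R\<^sup>2) powr (- \<beta> / 2) = ((norm x / R) powr 2) powr (- \<beta> / 2)"
    using False assms by (simp add: powr_numeral power_divide)
  also have "\<dots> = (norm x / R) powr (- \<beta>)"
    by (simp only: powr_powr) simp
  also have "\<dots> = norm x powr (- \<beta>) / R powr (- \<beta>)"
    using assms by (simp add: powr_divide)
  finally have *: "((norm x)\<^sup>2 / R\<^sup>2) powr (- \<beta> / 2) = norm x powr (- \<beta>) / R powr (- \<beta>)" .
  have "R powr (- \<beta> - 2) = R powr (- \<beta>) / R\<^sup>2"
    using assms by (simp add: powr_diff powr_numeral)
  then show ?thesis unfolding * using assms by simp
qed simp

text \<open>Both integrations by parts at once. With \<open>k(s) = 2 s\<^bsup>-\<beta>/2\<^esup> h'(s)\<close> the flux \<open>|x|\<^sup>-\<^sup>\<beta> \<nabla>h(|x|\<^sup>2/R\<^sup>2)\<close> is the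
  field \<open>R\<^bsup>-\<beta>-2\<^esup> k(|x|\<^sup>2/R\<^sup>2) x\<close>, and \<open>R\<^bsup>-\<beta>-2\<^esup> P(|x|\<^sup>2/R\<^sup>2)\<close> is its divergence. The bound \<open>S\<close> on the masses serves to
  apply Fubini's theorem to the term with the time derivative.\<close>

lemma weak_solution_separated_test:
  fixes u :: "real \<Rightarrow> 'a::euclidean_space \<Rightarrow> real"
  assumes u: "weak_solution \<gamma> \<beta> m u0 u"
    and \<xi>: "smooth \<xi>" "\<And>t. (\<xi> has_real_derivative \<xi>' t) (at t)" "\<And>t. t \<notin> {p..q} \<Longrightarrow> \<xi> t = 0" "0 < p"
    and h: "smooth h" "\<And>s. (h has_real_derivative h' s) (at s)" "\<And>s. 4 < s \<Longrightarrow> h s = 0"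
      "\<And>s. 0 \<le> h s" "\<And>s. h s \<le> 1"
    and k: "smooth k" "\<And>s. (k has_real_derivative k' s) (at s)" "\<And>s. k s = 2 * (s powr (- \<beta> / 2) * h' s)"
      "\<And>s. s \<notin> {1..4} \<Longrightarrow> k s = 0"
    and R: "0 < R"
    and S: "\<And>t. t \<in> {p..q} \<Longrightarrow> L1w_norm \<gamma> (u t) \<le> ennreal S" "0 \<le> S"
  defines "P \<equiv> \<lambda>s. real DIM('a) * k s + 2 * s * k' s"
  defines "\<rho> \<equiv> \<lambda>x::'a. (norm x)\<^sup>2 / R\<^sup>2"
  shows "integrable lborel (\<lambda>z. u (fst z) (snd z) powr m * (\<xi> (fst z) * P (\<rho> (snd z))))"
    and "(LINT t|lborel. (LINT x|lborel. u t x * h (\<rho> x) * norm x powr (- \<gamma>)) * \<xi>' t)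
      = - (R powr (- \<beta> - 2)) * (LINT z|lborel. u (fst z) (snd z) powr m * (\<xi> (fst z) * P (\<rho> (snd z))))"
proof -
  let ?\<Omega> = "{0<..} \<times> UNIV :: (real \<times> 'a) set" and ?\<Omega>' = "{0<..} \<times> (- {0}) :: (real \<times> 'a) set"
  let ?w = "\<lambda>z. u (fst z) (snd z) powr m"
  obtain G where G: "weak_space_grad ?\<Omega>' (\<lambda>(t, x). u t x powr m) G"
    and eqn: "\<And>\<phi>. test_function ?\<Omega> \<phi> \<Longrightarrow>
           (LINT (t, x):?\<Omega>|lborel.
              u t x * time_deriv \<phi> (t, x) * norm x powr (- \<gamma>)
              - norm x powr (- \<beta>) * (G (t, x) \<bullet> space_grad \<phi> (t, x))) = 0"
    using u unfolding weak_solution_def by blast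
  have w_eq: "(\<lambda>(t, x). u t x powr m) = ?w" by (auto simp: fun_eq_iff)
  have w_int: "locally_integrable ?\<Omega>' ?w" and G_int: "locally_integrable ?\<Omega>' G"
    and grad: "\<And>\<phi>. test_function ?\<Omega>' \<phi> \<Longrightarrow>
        (LINT z:?\<Omega>'|lborel. ?w z *\<^sub>R space_grad \<phi> z) = - (LINT z:?\<Omega>'|lborel. \<phi> z *\<^sub>R G z)"
    using G[unfolded w_eq] by (simp_all add: weak_space_grad_def)
  have \<xi>'0: "\<xi>' t = 0" if "t \<notin> {p..q}" for t
    by (rule DERIV_zero_outside[OF \<xi>(3) \<xi>(2) that])
  have k'0: "k' s = 0" if "s \<notin> {1..4}" for s
    by (rule DERIV_zero_outside[OF k(4) k(2) that])

  \<comment> \<open>The components \<open>\<phi> b\<close> of the flux vanish near \<open>x = 0\<close>, so they are admissible in the definition of the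
    weak gradient, which only holds away from the origin.\<close>
  define K where "K = {p..q} \<times> {x::'a. R \<le> norm x \<and> norm x \<le> 2 * R}"
  have "compact {x::'a. R \<le> norm x \<and> norm x \<le> 2 * R}"
  proof -
    have "{x::'a. R \<le> norm x \<and> norm x \<le> 2 * R} = cball 0 (2 * R) - ball 0 R" by auto
    then show ?thesis by (simp add: compact_diff)
  qed
  then have K: "compact K" "K \<subseteq> ?\<Omega>'"
    unfolding K_def using \<xi>(4) R by (auto intro: compact_Times)
  have in_K: "z \<in> K" if "fst z \<in> {p..q}" "\<rho> (snd z) \<in> {1..4}" for z
  proof -
    have "R\<^sup>2 \<le> (norm (snd z))\<^sup>2" "(norm (snd z))\<^sup>2 \<le> (2 * R)\<^sup>2"
      using that(2) R by (auto simp: \<rho>_def field_simps)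
    then have "R \<le> norm (snd z)" "norm (snd z) \<le> 2 * R"
      using R by (auto intro: power2_le_imp_le)
    then show ?thesis using that(1) by (cases z) (auto simp: K_def)
  qed
  define \<phi> where "\<phi> b z = \<xi> (fst z) * k (\<rho> (snd z)) * (snd z \<bullet> b)" for b z
  define D where "D b z = \<xi> (fst z) * (k' (\<rho> (snd z)) * (2 * (snd z \<bullet> b) / R\<^sup>2) * (snd z \<bullet> b) + k (\<rho> (snd z)))" for b z
  have \<phi>_smooth: "smooth (\<phi> b)" for b
    unfolding \<phi>_def \<rho>_def
    by (intro allI cd_mult[OF separated_smooth[OF \<xi>(1) k(1), rule_format]] cd_bounded_linear
        bounded_linear_inner_left_comp bounded_linear_snd)
  have \<phi>_0: "\<phi> b z = 0" if "z \<notin> K" for b z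
    using in_K[of z] that \<xi>(3)[of "fst z"] k(4)[of "\<rho> (snd z)"] by (auto simp: \<phi>_def)
  have \<phi>_test: "test_function ?\<Omega>' (\<phi> b)" for b
    unfolding test_function_def using \<phi>_smooth \<phi>_0 K by blast
  have \<phi>_deriv: "(\<phi> b has_derivative (\<lambda>v. \<xi> (fst z) * k (\<rho> (snd z)) * (snd v \<bullet> b) +
      (\<xi>' (fst z) * fst v * k (\<rho> (snd z)) + \<xi> (fst z) * (k' (\<rho> (snd z)) * (2 * (snd z \<bullet> snd v) / R\<^sup>2)))
        * (snd z \<bullet> b))) (at z)" for b z
    unfolding \<phi>_def \<rho>_def
    by (intro has_derivative_mult separated_has_derivative \<xi>(2) k(2) bounded_linear_imp_has_derivative
        bounded_linear_inner_left_comp bounded_linear_snd)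
  have grad_b: "space_grad (\<phi> b) z \<bullet> b = D b z" if "b \<in> Basis" for b z
    using that unfolding space_grad_inner_Basis[OF that] frechet_derivative_at[OF \<phi>_deriv, symmetric]
    by (simp add: D_def algebra_simps)
  have grad_cont: "continuous_on UNIV (space_grad (\<phi> b))" for b
  proof -
    have "continuous_on UNIV (\<lambda>z. frechet_derivative (\<phi> b) (at z) (0, c))" if "c \<in> Basis" for c
      using cd_SucD(2)[of 0 "\<phi> b" "(0, c)"] \<phi>_smooth[of b] that by (simp add: Basis_prod_def)
    then show ?thesis unfolding space_grad_def by (intro continuous_intros) auto
  qed
  have grad_0: "space_grad (\<phi> b) z = 0" if "z \<notin> K" for b z
  proof -
    have "((\<lambda>_. 0) has_derivative (\<lambda>_. 0)) (at z)" by simp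
    then have "(\<phi> b has_derivative (\<lambda>_. 0)) (at z)"
      by (rule has_derivative_transform_within_open[of _ _ _ _ "- K"])
        (use that \<phi>_0 K(1) in \<open>auto simp: open_Compl compact_imp_closed\<close>)
    then show ?thesis by (simp add: space_grad_def frechet_derivative_at[symmetric])
  qed
  have int1: "integrable lborel (\<lambda>z. ?w z *\<^sub>R space_grad (\<phi> b) z)" for b
    by (rule integrable_scaleR_continuous[OF w_int K grad_cont grad_0])
  have int2: "integrable lborel (\<lambda>z. \<phi> b z *\<^sub>R G z)" for b
    by (rule integrable_continuous_scaleR[OF G_int K smooth_continuous[OF \<phi>_smooth] \<phi>_0])
  have int1b: "integrable lborel (\<lambda>z. ?w z * D b z)" if "b \<in> Basis" for b
    using integrable_inner_left[of b lborel, OF int1[of b]] that by (simp add: grad_b)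
  have int2b: "integrable lborel (\<lambda>z. \<phi> b z * (G z \<bullet> b))" for b
    using integrable_inner_left[of b lborel, OF int2[of b]] by simp
  have parts: "(LINT z|lborel. \<phi> b z * (G z \<bullet> b)) = - (LINT z|lborel. ?w z * D b z)"
    if b: "b \<in> Basis" for b
  proof -
    have "(LINT z|lborel. ?w z *\<^sub>R space_grad (\<phi> b) z) = - (LINT z|lborel. \<phi> b z *\<^sub>R G z)"
    proof -
      have out: "\<phi> b z = 0" "space_grad (\<phi> b) z = 0" if "z \<notin> ?\<Omega>'" for z
        using that K(2) \<phi>_0 grad_0 by blast+
      have "(LINT z:?\<Omega>'|lborel. ?w z *\<^sub>R space_grad (\<phi> b) z) = (LINT z|lborel. ?w z *\<^sub>R space_grad (\<phi> b) z)"
        by (rule set_lebesgue_integral_eq_integral) (metis out(2) scaleR_zero_right)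
      moreover have "(LINT z:?\<Omega>'|lborel. \<phi> b z *\<^sub>R G z) = (LINT z|lborel. \<phi> b z *\<^sub>R G z)"
        by (rule set_lebesgue_integral_eq_integral) (metis out(1) scaleR_zero_left)
      ultimately show ?thesis using grad[OF \<phi>_test[of b]] by simp
    qed
    then have "(LINT z|lborel. ?w z *\<^sub>R space_grad (\<phi> b) z) \<bullet> b = - ((LINT z|lborel. \<phi> b z *\<^sub>R G z) \<bullet> b)"
      by simp
    then show ?thesis
      using int1[of b] int2[of b] b
      by (subst (asm) (1 2) integral_inner_left[symmetric]) (auto simp: grad_b)
  qed
  have sum_D: "(\<Sum>b\<in>Basis. D b z) = \<xi> (fst z) * P (\<rho> (snd z))" for z
  proof -
    have "(\<Sum>b\<in>Basis. (snd z \<bullet> b) * (snd z \<bullet> b)) = (norm (snd z))\<^sup>2"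
      by (simp add: power2_norm_eq_inner euclidean_inner[of "snd z" "snd z"])
    then have "(\<Sum>b\<in>Basis. k' (\<rho> (snd z)) * (2 * (snd z \<bullet> b) / R\<^sup>2) * (snd z \<bullet> b)) = 2 * \<rho> (snd z) * k' (\<rho> (snd z))"
      unfolding \<rho>_def by (simp add: sum_distrib_left[symmetric] sum_divide_distrib[symmetric] mult.assoc)
    then show ?thesis
      by (simp add: D_def P_def sum_distrib_left[symmetric] sum.distrib)
  qed
  have int_w: "integrable lborel (\<lambda>z. \<Sum>b\<in>Basis. ?w z * D b z)"
    by (intro Bochner_Integration.integrable_sum int1b)
  then show "integrable lborel (\<lambda>z. ?w z * (\<xi> (fst z) * P (\<rho> (snd z))))"
    by (simp add: sum_distrib_left[symmetric] sum_D)

  \<comment> \<open>In contrast, \<open>\<psi>\<close> is constant in \<open>x\<close> near the origin; its gradient brings back the \<open>\<phi> b\<close>.\<close>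
  define \<psi> where "\<psi> z = \<xi> (fst z) * h (\<rho> (snd z))" for z
  have \<psi>_0: "\<psi> z = 0" if "z \<notin> {p..q} \<times> cball 0 (2 * R)" for z
  proof (cases "fst z \<in> {p..q}")
    case True
    then have "2 * R < norm (snd z)" using that by (cases z) auto
    then have "(2 * R)\<^sup>2 < (norm (snd z))\<^sup>2"
      using R by (intro power_strict_mono) auto
    then have "4 < \<rho> (snd z)" using R by (simp add: \<rho>_def field_simps)
    then show ?thesis by (simp add: \<psi>_def h(3))
  qed (simp add: \<psi>_def \<xi>(3))
  have \<psi>_test: "test_function ?\<Omega> \<psi>"
    unfolding test_function_def
  proof
    show "smooth \<psi>" unfolding \<psi>_def \<rho>_def by (rule separated_smooth[OF \<xi>(1) h(1)])
    show "\<exists>K. compact K \<and> K \<subseteq> ?\<Omega> \<and> (\<forall>z. z \<notin> K \<longrightarrow> \<psi> z = 0)"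
      using \<xi>(4) \<psi>_0 by (intro exI[of _ "{p..q} \<times> cball 0 (2 * R)"]) (auto intro: compact_Times)
  qed
  have \<psi>_deriv: "(\<psi> has_derivative (\<lambda>v. \<xi>' (fst z) * fst v * h (\<rho> (snd z))
      + \<xi> (fst z) * (h' (\<rho> (snd z)) * (2 * (snd z \<bullet> snd v) / R\<^sup>2)))) (at z)" for z
    unfolding \<psi>_def \<rho>_def by (rule separated_has_derivative[OF \<xi>(2) h(2)])
  have time: "time_deriv \<psi> z = \<xi>' (fst z) * h (\<rho> (snd z))" for z
    unfolding time_deriv_def frechet_derivative_at[OF \<psi>_deriv, symmetric] by simp
  have flux: "norm (snd z) powr (- \<beta>) * (G z \<bullet> space_grad \<psi> z)
      = (\<Sum>b\<in>Basis. R powr (- \<beta> - 2) * (\<phi> b z * (G z \<bullet> b)))" for z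
  proof -
    have "space_grad \<psi> z = (\<Sum>b\<in>Basis. (\<xi> (fst z) * (h' (\<rho> (snd z)) * 2 / R\<^sup>2)) *\<^sub>R ((snd z \<bullet> b) *\<^sub>R b))"
      unfolding space_grad_def frechet_derivative_at[OF \<psi>_deriv, symmetric] by (simp add: mult.assoc)
    also have "\<dots> = (\<xi> (fst z) * (h' (\<rho> (snd z)) * 2 / R\<^sup>2)) *\<^sub>R snd z"
      by (simp only: scaleR_sum_right[symmetric] euclidean_representation)
    finally have "norm (snd z) powr (- \<beta>) * (G z \<bullet> space_grad \<psi> z)
        = (norm (snd z) powr (- \<beta>) * (h' (\<rho> (snd z)) * 2 / R\<^sup>2)) * (\<xi> (fst z) * (G z \<bullet> snd z))"
      by simp
    also have "\<dots> = (R powr (- \<beta> - 2) * k (\<rho> (snd z))) * (\<xi> (fst z) * (G z \<bullet> snd z))"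
      unfolding k(3) \<rho>_def weighted_powr_rescale[OF R] ..
    also have "G z \<bullet> snd z = (\<Sum>b\<in>Basis. (snd z \<bullet> b) * (G z \<bullet> b))"
      by (subst euclidean_inner) (simp add: mult.commute)
    finally show ?thesis by (simp add: \<phi>_def sum_distrib_left mult_ac)
  qed
  define U where "U z = u (fst z) (snd z) * (\<xi>' (fst z) * h (\<rho> (snd z))) * norm (snd z) powr (- \<gamma>)" for z
  \<comment> \<open>Measurability of \<open>u\<close> is only known for positive times, where \<open>\<xi>'\<close> is supported.\<close>
  have U_ind: "U z = (indicator ?\<Omega> z *\<^sub>R u (fst z) (snd z)) * (\<xi>' (fst z) * h (\<rho> (snd z))) * norm (snd z) powr (- \<gamma>)" for z
  proof (cases "0 < fst z")
    case True
    then show ?thesis by (cases z) (simp add: U_def)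
  next
    case False
    then have "fst z \<notin> {p..q}" using \<xi>(4) by auto
    then show ?thesis using \<xi>'0 by (simp add: U_def)
  qed
  have \<xi>'_cont: "continuous_on UNIV \<xi>'"
  proof -
    obtain f where f: "smooth f" "\<And>t. (\<xi> has_real_derivative f t) (at t)"
      using smooth_real_derivative[OF \<xi>(1)] by blast
    then have "f = \<xi>'" using DERIV_unique \<xi>(2) by blast
    then show ?thesis using smooth_continuous[OF f(1)] by simp
  qed
  have [measurable]: "\<xi>' \<in> borel_measurable borel" "h \<in> borel_measurable borel" "\<rho> \<in> borel_measurable borel"
    using \<xi>'_cont smooth_continuous[OF h(1), of UNIV]
    by (auto intro: borel_measurable_continuous_onI simp: \<rho>_def[abs_def])
  have m1: "(\<lambda>z. indicator ?\<Omega> z *\<^sub>R u (fst z) (snd z)) \<in> borel_measurable borel"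
    using u by (simp add: weak_solution_def set_borel_measurable_def case_prod_beta)
  have m2: "(\<lambda>z::real \<times> 'a. \<xi>' (fst z) * h (\<rho> (snd z))) \<in> borel_measurable borel"
    unfolding \<rho>_def
    by (intro borel_measurable_continuous_onI continuous_intros continuous_on_compose2[OF \<xi>'_cont]
        continuous_on_compose2[OF smooth_continuous[OF h(1), of UNIV]]) (use R in auto)
  have m3: "(\<lambda>z::real \<times> 'a. norm (snd z)) \<in> borel_measurable borel"
    by (intro borel_measurable_continuous_onI continuous_intros)
  have "U \<in> borel_measurable borel"
    unfolding U_ind[abs_def]
    by (rule borel_measurable_times[OF borel_measurable_times[OF m1 m2]
          powr_real_measurable[OF m3 borel_measurable_const]])
  then have U_meas: "U \<in> borel_measurable (lborel \<Otimes>\<^sub>M lborel)" by (simp add: lborel_prod)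
  obtain c where c: "\<And>t. \<bar>\<xi>' t\<bar> \<le> c" "0 \<le> c"
  proof -
    have "bounded (\<xi>' ` {p..q})"
      using continuous_on_subset[OF \<xi>'_cont] by (intro compact_imp_bounded compact_continuous_image) auto
    then obtain c where "\<forall>t\<in>{p..q}. \<bar>\<xi>' t\<bar> \<le> c" by (auto simp: bounded_iff)
    then have "\<bar>\<xi>' t\<bar> \<le> \<bar>c\<bar>" for t
      using \<xi>'0[of t] order_trans[OF _ abs_ge_self, of _ c] by (cases "t \<in> {p..q}") auto
    then show thesis by (rule that) simp
  qed
  have U_int: "integrable (lborel \<Otimes>\<^sub>M lborel) U"
  proof (rule integrableI_bounded[OF U_meas])
    have "(\<integral>\<^sup>+ z. ennreal (norm (U z)) \<partial>(lborel \<Otimes>\<^sub>M lborel))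
        = (\<integral>\<^sup>+ t. \<integral>\<^sup>+ x. ennreal (norm (U (t, x))) \<partial>lborel \<partial>lborel)"
    proof (rule lborel.nn_integral_fst[symmetric])
      show "(\<lambda>z. ennreal (norm (U z))) \<in> borel_measurable (lborel \<Otimes>\<^sub>M lborel)"
        by (rule measurable_compose[OF U_meas]) measurable
    qed
    also have "\<dots> \<le> (\<integral>\<^sup>+ t. ennreal (c * S) * indicator {p..q} t \<partial>lborel)"
    proof (intro nn_integral_mono)
      fix t :: real
      show "(\<integral>\<^sup>+ x. ennreal (norm (U (t, x))) \<partial>lborel) \<le> ennreal (c * S) * indicator {p..q} t"
      proof (cases "t \<in> {p..q}")
        case True
        have [measurable]: "u t \<in> borel_measurable borel"
          using u True \<xi>(4) by (auto simp: weak_solution_def L1w_def)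
        have "(\<integral>\<^sup>+ x. ennreal (norm (U (t, x))) \<partial>lborel)
            \<le> (\<integral>\<^sup>+ x. ennreal c * ennreal (\<bar>u t x\<bar> * norm x powr (- \<gamma>)) \<partial>lborel)"
        proof (intro nn_integral_mono)
          fix x :: 'a
          have "\<bar>\<xi>' t\<bar> * \<bar>h (\<rho> x)\<bar> \<le> c * 1"
            using c h(4,5) by (intro mult_mono) auto
          then have "norm (U (t, x)) \<le> c * (\<bar>u t x\<bar> * norm x powr (- \<gamma>))"
            using mult_right_mono[of "\<bar>\<xi>' t\<bar> * \<bar>h (\<rho> x)\<bar>" c "\<bar>u t x\<bar> * norm x powr (- \<gamma>)"]
            by (simp add: U_def abs_mult mult_ac)
          then show "ennreal (norm (U (t, x))) \<le> ennreal c * ennreal (\<bar>u t x\<bar> * norm x powr (- \<gamma>))"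
            using c(2) by (simp add: ennreal_mult'[symmetric] ennreal_leI)
        qed
        also have "\<dots> = ennreal c * L1w_norm \<gamma> (u t)"
          unfolding L1w_norm_def by (rule nn_integral_cmult) measurable
        also have "\<dots> \<le> ennreal c * ennreal S" using S(1)[OF True] by (intro mult_left_mono) auto
        finally show ?thesis using True c(2) by (simp add: ennreal_mult')
      qed (simp add: U_def \<xi>'0)
    qed
    also have "\<dots> < \<infinity>" by (simp add: nn_integral_cmult_indicator ennreal_mult_less_top emeasure_lborel_Icc_eq)
    finally show "(\<integral>\<^sup>+ z. ennreal (norm (U z)) \<partial>(lborel \<Otimes>\<^sub>M lborel)) < \<infinity>" .
  qed
  have "(LINT t|lborel. (LINT x|lborel. u t x * h (\<rho> x) * norm x powr (- \<gamma>)) * \<xi>' t)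
      = (LINT t|lborel. LINT x|lborel. U (t, x))"
    by (subst integral_mult_left_zero[symmetric]) (simp add: U_def mult_ac)
  also have "\<dots> = (LINT z|lborel. U z)"
    using lborel_pair.integral_fst'[OF U_int] by (simp add: lborel_prod)
  also have "\<dots> = (LINT z|lborel. (\<Sum>b\<in>Basis. R powr (- \<beta> - 2) * (\<phi> b z * (G z \<bullet> b))))"
  proof -
    have "(LINT z:?\<Omega>|lborel. U z - (\<Sum>b\<in>Basis. R powr (- \<beta> - 2) * (\<phi> b z * (G z \<bullet> b)))) = 0"
    proof -
      have "(\<lambda>z. U z - (\<Sum>b\<in>Basis. R powr (- \<beta> - 2) * (\<phi> b z * (G z \<bullet> b))))
          = (\<lambda>(t, x). u t x * time_deriv \<psi> (t, x) * norm x powr (- \<gamma>)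
              - norm x powr (- \<beta>) * (G (t, x) \<bullet> space_grad \<psi> (t, x)))"
        unfolding flux[symmetric] by (auto simp: fun_eq_iff U_def time)
      then show ?thesis using eqn[OF \<psi>_test] by simp
    qed
    moreover have "U z - (\<Sum>b\<in>Basis. R powr (- \<beta> - 2) * (\<phi> b z * (G z \<bullet> b))) = 0" if "z \<notin> ?\<Omega>" for z
    proof -
      have "z \<notin> K" using K(2) that by auto
      then show ?thesis using that U_ind[of z] by (simp add: \<phi>_0)
    qed
    ultimately have "(LINT z|lborel. U z - (\<Sum>b\<in>Basis. R powr (- \<beta> - 2) * (\<phi> b z * (G z \<bullet> b)))) = 0"
      by (subst (asm) set_lebesgue_integral_eq_integral) auto
    then show ?thesis
      using U_int int2b
      by (subst (asm) Bochner_Integration.integral_diff) (auto simp: lborel_prod)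
  qed
  also have "\<dots> = (\<Sum>b\<in>Basis. R powr (- \<beta> - 2) * (LINT z|lborel. \<phi> b z * (G z \<bullet> b)))"
    using int2b by (subst Bochner_Integration.integral_sum) auto
  also have "\<dots> = (\<Sum>b\<in>Basis. - (R powr (- \<beta> - 2)) * (LINT z|lborel. ?w z * D b z))"
    by (intro sum.cong) (simp_all add: parts)
  also have "\<dots> = - (R powr (- \<beta> - 2)) * (LINT z|lborel. (\<Sum>b\<in>Basis. ?w z * D b z))"
    using int1b by (subst Bochner_Integration.integral_sum) (auto simp: sum_distrib_left)
  finally show "(LINT t|lborel. (LINT x|lborel. u t x * h (\<rho> x) * norm x powr (- \<gamma>)) * \<xi>' t)
      = - (R powr (- \<beta> - 2)) * (LINT z|lborel. ?w z * (\<xi> (fst z) * P (\<rho> (snd z))))"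
    by (simp add: sum_distrib_left[symmetric] sum_D)
qed

section \<open>Propagation of mass\<close>

definition weighted_integral :: "real \<Rightarrow> ('a::euclidean_space \<Rightarrow> real) \<Rightarrow> ('a \<Rightarrow> real) \<Rightarrow> real" where
  "weighted_integral \<gamma> w f = (LINT x|lborel. f x * w x * norm x powr (- \<gamma>))"

lemma weighted_integrable:
  fixes f w :: "'a::euclidean_space \<Rightarrow> real"
  assumes f: "f \<in> L1w \<gamma>" and [measurable]: "w \<in> borel_measurable borel" and w: "\<And>x. \<bar>w x\<bar> \<le> 1"
  shows "integrable lborel (\<lambda>x. f x * w x * norm x powr (- \<gamma>))"
proof (rule integrableI_bounded)
  have [measurable]: "f \<in> borel_measurable borel" using f by (simp add: L1w_def)
  show "(\<lambda>x. f x * w x * norm x powr (- \<gamma>)) \<in> borel_measurable lborel" by measurable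
  have "norm (f x * w x * norm x powr (- \<gamma>)) \<le> \<bar>f x\<bar> * norm x powr (- \<gamma>)" for x
    using mult_left_mono[OF w[of x], of "\<bar>f x\<bar> * norm x powr (- \<gamma>)"] by (simp add: abs_mult mult_ac)
  then have "(\<integral>\<^sup>+ x. ennreal (norm (f x * w x * norm x powr (- \<gamma>))) \<partial>lborel) \<le> L1w_norm \<gamma> f"
    unfolding L1w_norm_def by (intro nn_integral_mono ennreal_leI)
  also have "\<dots> < \<infinity>" using f by (simp add: L1w_def)
  finally show "(\<integral>\<^sup>+ x. ennreal (norm (f x * w x * norm x powr (- \<gamma>))) \<partial>lborel) < \<infinity>" .
qed

lemma weighted_integral_diff_le_nn_integral:
  fixes f g w :: "'a::euclidean_space \<Rightarrow> real"
  assumes fg: "f \<in> L1w \<gamma>" "g \<in> L1w \<gamma>" and w: "w \<in> borel_measurable borel" "\<And>x. \<bar>w x\<bar> \<le> 1"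
  shows "ennreal \<bar>weighted_integral \<gamma> w f - weighted_integral \<gamma> w g\<bar>
    \<le> (\<integral>\<^sup>+ x. ennreal (\<bar>f x - g x\<bar> * \<bar>w x\<bar> * norm x powr (- \<gamma>)) \<partial>lborel)"
proof -
  note i = weighted_integrable[OF fg(1) w] weighted_integrable[OF fg(2) w]
  have eq: "f x * w x * norm x powr (- \<gamma>) - g x * w x * norm x powr (- \<gamma>)
      = (f x - g x) * w x * norm x powr (- \<gamma>)" for x
    by (simp add: algebra_simps)
  have "weighted_integral \<gamma> w f - weighted_integral \<gamma> w g = (LINT x|lborel. (f x - g x) * w x * norm x powr (- \<gamma>))"
    unfolding weighted_integral_def eq[symmetric] using i by simp
  moreover have "integrable lborel (\<lambda>x. (f x - g x) * w x * norm x powr (- \<gamma>))"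
    unfolding eq[symmetric] using i by simp
  ultimately have "ennreal \<bar>weighted_integral \<gamma> w f - weighted_integral \<gamma> w g\<bar>
      \<le> (\<integral>\<^sup>+ x. ennreal (norm ((f x - g x) * w x * norm x powr (- \<gamma>))) \<partial>lborel)"
    using integral_norm_bound_ennreal by (metis real_norm_def)
  then show ?thesis by (simp add: abs_mult)
qed

lemma weighted_integral_diff_le_L1w:
  fixes f g w :: "'a::euclidean_space \<Rightarrow> real"
  assumes fg: "f \<in> L1w \<gamma>" "g \<in> L1w \<gamma>" and w: "w \<in> borel_measurable borel" "\<And>x. \<bar>w x\<bar> \<le> 1"
  shows "ennreal \<bar>weighted_integral \<gamma> w f - weighted_integral \<gamma> w g\<bar> \<le> L1w_norm \<gamma> (\<lambda>x. f x - g x)"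
  unfolding L1w_norm_def
proof (rule order_trans[OF weighted_integral_diff_le_nn_integral[OF fg w]], intro nn_integral_mono ennreal_leI)
  fix x
  show "\<bar>f x - g x\<bar> * \<bar>w x\<bar> * norm x powr (- \<gamma>) \<le> \<bar>f x - g x\<bar> * norm x powr (- \<gamma>)"
    by (intro mult_right_mono mult_left_le w(2)) auto
qed

lemma weighted_integral_mono:
  fixes f v w :: "'a::euclidean_space \<Rightarrow> real"
  assumes f: "f \<in> L1w \<gamma>" "AE x in lborel. 0 \<le> f x" and v: "v \<in> borel_measurable borel" "\<And>x. \<bar>v x\<bar> \<le> 1"
    and w: "w \<in> borel_measurable borel" "\<And>x. \<bar>w x\<bar> \<le> 1" and vw: "\<And>x. v x \<le> w x"
  shows "weighted_integral \<gamma> v f \<le> weighted_integral \<gamma> w f"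
  unfolding weighted_integral_def
proof (rule integral_mono_AE[OF weighted_integrable[OF f(1) v] weighted_integrable[OF f(1) w]])
  show "AE x in lborel. f x * v x * norm x powr (- \<gamma>) \<le> f x * w x * norm x powr (- \<gamma>)"
    using f(2) by eventually_elim (intro mult_right_mono mult_left_mono vw, auto)
qed

lemma L1w_norm_mult_eq_weighted_integral:
  fixes f w :: "'a::euclidean_space \<Rightarrow> real"
  assumes f: "f \<in> L1w \<gamma>" "AE x in lborel. 0 \<le> f x"
    and w: "w \<in> borel_measurable borel" "\<And>x. 0 \<le> w x" "\<And>x. w x \<le> 1"
  shows "L1w_norm \<gamma> (\<lambda>x. w x * f x) = ennreal (weighted_integral \<gamma> w f)"
proof -
  have "L1w_norm \<gamma> (\<lambda>x. w x * f x) = (\<integral>\<^sup>+ x. ennreal (f x * w x * norm x powr (- \<gamma>)) \<partial>lborel)"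
    unfolding L1w_norm_def
    by (rule nn_integral_cong_AE) (use f(2) in eventually_elim, simp add: w(2) mult.commute)
  also have "\<dots> = ennreal (weighted_integral \<gamma> w f)"
    unfolding weighted_integral_def
  proof (rule nn_integral_eq_integral)
    show "integrable lborel (\<lambda>x. f x * w x * norm x powr (- \<gamma>))"
      by (rule weighted_integrable[OF f(1) w(1)]) (simp add: abs_of_nonneg w(2,3))
    show "AE x in lborel. 0 \<le> f x * w x * norm x powr (- \<gamma>)"
      using f(2) by eventually_elim (simp add: w(2))
  qed
  finally show ?thesis .
qed

lemma L1w_norm_eq_weighted_integral:
  fixes f :: "'a::euclidean_space \<Rightarrow> real"
  assumes "f \<in> L1w \<gamma>" "AE x in lborel. 0 \<le> f x"
  shows "L1w_norm \<gamma> f = ennreal (weighted_integral \<gamma> (\<lambda>_. 1) f)"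
  using L1w_norm_mult_eq_weighted_integral[OF assms, of "\<lambda>_. 1"] by simp

lemma weighted_integral_compl:
  fixes f w :: "'a::euclidean_space \<Rightarrow> real"
  assumes f: "f \<in> L1w \<gamma>" and w: "w \<in> borel_measurable borel" "\<And>x. \<bar>w x\<bar> \<le> 1"
  shows "weighted_integral \<gamma> (\<lambda>x. 1 - w x) f = weighted_integral \<gamma> (\<lambda>_. 1) f - weighted_integral \<gamma> w f"
proof -
  have "integrable lborel (\<lambda>x. f x * 1 * norm x powr (- \<gamma>))"
    by (rule weighted_integrable[OF f]) auto
  then show ?thesis
    using weighted_integrable[OF f w] unfolding weighted_integral_def
    by (subst Bochner_Integration.integral_diff[symmetric]) (auto simp: algebra_simps)
qed

lemma weighted_integral_diff_le_Linf:
  fixes f g w :: "'a::euclidean_space \<Rightarrow> real"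
  assumes fg: "f \<in> L1w \<gamma>" "g \<in> L1w \<gamma>" and w: "w \<in> borel_measurable borel" "\<And>x. \<bar>w x\<bar> \<le> indicator A x"
    and [measurable]: "A \<in> sets borel"
  shows "ennreal \<bar>weighted_integral \<gamma> w f - weighted_integral \<gamma> w g\<bar>
    \<le> Linf_norm (\<lambda>x. f x - g x) * (\<integral>\<^sup>+ x. indicator A x * ennreal (norm x powr (- \<gamma>)) \<partial>lborel)"
proof -
  have w1: "\<bar>w x\<bar> \<le> 1" for x using w(2)[of x] by (cases "x \<in> A") simp_all
  have "ennreal \<bar>weighted_integral \<gamma> w f - weighted_integral \<gamma> w g\<bar>
      \<le> (\<integral>\<^sup>+ x. ennreal (\<bar>f x - g x\<bar> * \<bar>w x\<bar> * norm x powr (- \<gamma>)) \<partial>lborel)"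
    by (rule weighted_integral_diff_le_nn_integral[OF fg w(1) w1])
  also have "\<dots> \<le> (\<integral>\<^sup>+ x. Linf_norm (\<lambda>x. f x - g x) * (indicator A x * ennreal (norm x powr (- \<gamma>))) \<partial>lborel)"
  proof (rule nn_integral_mono_AE)
    have "AE x in lborel. ennreal \<bar>f x - g x\<bar> \<le> Linf_norm (\<lambda>x. f x - g x)"
      unfolding Linf_norm_def by (rule esssup_AE)
    then show "AE x in lborel. ennreal (\<bar>f x - g x\<bar> * \<bar>w x\<bar> * norm x powr (- \<gamma>))
        \<le> Linf_norm (\<lambda>x. f x - g x) * (indicator A x * ennreal (norm x powr (- \<gamma>)))"
    proof eventually_elim
      case (elim x)
      have "\<bar>f x - g x\<bar> * \<bar>w x\<bar> * norm x powr (- \<gamma>) \<le> \<bar>f x - g x\<bar> * (indicator A x * norm x powr (- \<gamma>))"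
        unfolding mult.assoc by (intro mult_left_mono mult_right_mono w(2)) auto
      then have "ennreal (\<bar>f x - g x\<bar> * \<bar>w x\<bar> * norm x powr (- \<gamma>))
          \<le> ennreal (\<bar>f x - g x\<bar> * (indicator A x * norm x powr (- \<gamma>)))" by (rule ennreal_leI)
      also have "\<dots> = ennreal \<bar>f x - g x\<bar> * (indicator A x * ennreal (norm x powr (- \<gamma>)))"
        by (cases "x \<in> A") (simp_all add: ennreal_mult')
      also have "\<dots> \<le> Linf_norm (\<lambda>x. f x - g x) * (indicator A x * ennreal (norm x powr (- \<gamma>)))"
        by (rule mult_right_mono[OF elim]) simp
      finally show ?case .
    qed
  qed
  also have "\<dots> = Linf_norm (\<lambda>x. f x - g x) * (\<integral>\<^sup>+ x. indicator A x * ennreal (norm x powr (- \<gamma>)) \<partial>lborel)"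
    by (rule nn_integral_cmult) measurable
  finally show ?thesis .
qed

lemma weak_solutionD:
  assumes "weak_solution \<gamma> \<beta> m u0 u" "0 \<le> t"
  shows "u t \<in> L1w \<gamma>" "AE x in lborel. 0 \<le> u t x"
  using assms by (auto simp: weak_solution_def)

lemma weighted_integral_continuous:
  fixes u :: "real \<Rightarrow> 'a::euclidean_space \<Rightarrow> real"
  assumes u: "weak_solution \<gamma> \<beta> m u0 u" and w: "w \<in> borel_measurable borel" "\<And>x. \<bar>w x\<bar> \<le> 1"
  shows "continuous_on {0..} (\<lambda>t. weighted_integral \<gamma> w (u t))"
  unfolding continuous_on_def
proof
  fix t :: real assume t: "t \<in> {0..}"
  let ?D = "\<lambda>s. weighted_integral \<gamma> w (u s) - weighted_integral \<gamma> w (u t)"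
  have "((\<lambda>s. ennreal \<bar>?D s\<bar>) \<longlongrightarrow> 0) (at t within {0..})"
  proof (rule tendsto_sandwich[OF _ _ tendsto_const])
    show "((\<lambda>s. L1w_norm \<gamma> (\<lambda>x. u s x - u t x)) \<longlongrightarrow> 0) (at t within {0..})"
      using u t by (auto simp: weak_solution_def)
    have "ennreal \<bar>?D s\<bar> \<le> L1w_norm \<gamma> (\<lambda>x. u s x - u t x)" if "0 \<le> s" for s
      using weak_solutionD(1)[OF u] that t w by (intro weighted_integral_diff_le_L1w) auto
    then show "\<forall>\<^sub>F s in at t within {0..}. ennreal \<bar>?D s\<bar> \<le> L1w_norm \<gamma> (\<lambda>x. u s x - u t x)"
      by (auto simp: eventually_at_filter)
  qed auto
  then have "((\<lambda>s. enn2real (ennreal \<bar>?D s\<bar>)) \<longlongrightarrow> enn2real 0) (at t within {0..})"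
    by (intro tendsto_enn2real) auto
  then have "(?D \<longlongrightarrow> 0) (at t within {0..})"
    by (simp add: tendsto_rabs_zero_iff)
  then show "((\<lambda>s. weighted_integral \<gamma> w (u s)) \<longlongrightarrow> weighted_integral \<gamma> w (u t)) (at t within {0..})"
    by (rule Lim_null[THEN iffD2])
qed

text \<open>Concavity gives \<open>v\<^sup>m \<le> a\<^sup>m + a\<^bsup>m-1\<^esup> v\<close> for every \<open>a > 0\<close>. The choice \<open>a = R\<^bsup>\<gamma>-d\<^esup>\<close>, the size of
  a function of unit mass spread over a ball of radius \<open>R\<close>, makes both terms scale alike.\<close>

lemma annulus_power_bound:
  fixes v :: "'a::euclidean_space \<Rightarrow> real"
  assumes [measurable]: "v \<in> borel_measurable borel" and v: "AE x in lborel. 0 \<le> v x"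
    and S: "L1w_norm \<gamma> v \<le> ennreal S" "0 \<le> S" and m: "0 < m" "m < 1" and R: "0 < R"
    and P: "\<And>s. \<bar>P s\<bar> \<le> c" "\<And>s. s \<notin> {1..4} \<Longrightarrow> P s = 0"
  shows "(\<integral>\<^sup>+ x. ennreal (\<bar>v x powr m\<bar> * \<bar>P ((norm x)\<^sup>2 / R\<^sup>2)\<bar>) \<partial>lborel)
    \<le> ennreal (c * (unit_ball_vol (real DIM('a)) * 2 ^ DIM('a) + 2 powr \<bar>\<gamma>\<bar>)
        * R powr (real DIM('a) - (real DIM('a) - \<gamma>) * m) * (1 + S))"
proof -
  let ?d = "real DIM('a)"
  let ?E = "R powr (?d - (?d - \<gamma>) * m)"
  define a where "a = R powr (\<gamma> - ?d)"
  have a: "0 < a" using R by (simp add: a_def)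
  have c: "0 \<le> c" using P(1)[of 0] by simp
  have am: "a powr m * R ^ DIM('a) = ?E"
    using R by (simp add: a_def powr_powr powr_realpow[symmetric] powr_add[symmetric] algebra_simps)
  have am1: "a powr m / a * R powr \<gamma> = ?E"
    using R by (simp add: a_def powr_powr powr_diff[symmetric] powr_add[symmetric] algebra_simps)
  have concave: "y powr m \<le> a powr m + a powr m / a * y" if "0 \<le> y" for y
  proof -
    have "(y / a) powr m \<le> 1 + y / a"
    proof (cases "y / a \<le> 1")
      case True
      then have "(y / a) powr m \<le> 1" using that a m by (intro powr_le1) auto
      then show ?thesis using that a by (simp add: add_increasing2)
    next
      case False
      then have "(y / a) powr m \<le> (y / a) powr 1" using m by (intro powr_mono) auto
      then show ?thesis using False that a by simp
    qed
    then have "a powr m * (y / a) powr m \<le> a powr m * (1 + y / a)" by (intro mult_left_mono) auto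
    then show ?thesis using that a by (simp add: powr_divide algebra_simps)
  qed
  have pt: "\<bar>v x powr m\<bar> * \<bar>P ((norm x)\<^sup>2 / R\<^sup>2)\<bar> \<le> c * (a powr m) * indicator (cball 0 (2 * R)) x
      + c * (a powr m / a * (2 powr \<bar>\<gamma>\<bar> * R powr \<gamma>)) * (\<bar>v x\<bar> * norm x powr (- \<gamma>))" if "0 \<le> v x" for x
  proof (cases "(norm x)\<^sup>2 / R\<^sup>2 \<in> {1..4}")
    case False
    then show ?thesis using c P(2)[OF False] a by simp
  next
    case True
    have "R\<^sup>2 \<le> (norm x)\<^sup>2" "(norm x)\<^sup>2 \<le> (2 * R)\<^sup>2"
      using True R by (auto simp: field_simps)
    then have x: "R \<le> norm x" "norm x \<le> 2 * R" using R by (auto intro: power2_le_imp_le)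
    have "norm x powr \<gamma> \<le> 2 powr \<bar>\<gamma>\<bar> * R powr \<gamma>"
    proof (cases "0 \<le> \<gamma>")
      case True
      then have "norm x powr \<gamma> \<le> (2 * R) powr \<gamma>" using x R by (intro powr_mono2) auto
      then show ?thesis using True R by (simp add: powr_mult)
    next
      case False
      then have "norm x powr \<gamma> \<le> R powr \<gamma>" using x R by (intro powr_mono2') auto
      also have "\<dots> \<le> 2 powr \<bar>\<gamma>\<bar> * R powr \<gamma>" using mult_right_mono[OF ge_one_powr_ge_zero[of 2 "\<bar>\<gamma>\<bar>"], of "R powr \<gamma>"] by simp
      finally show ?thesis .
    qed
    then have "v x * norm x powr (- \<gamma>) * norm x powr \<gamma> \<le> v x * norm x powr (- \<gamma>) * (2 powr \<bar>\<gamma>\<bar> * R powr \<gamma>)"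
      using that by (intro mult_left_mono) auto
    moreover have "norm x powr (- \<gamma>) * norm x powr \<gamma> = 1"
      using less_le_trans[OF R x(1)] by (simp add: powr_minus)
    ultimately have "v x \<le> (2 powr \<bar>\<gamma>\<bar> * R powr \<gamma>) * (v x * norm x powr (- \<gamma>))"
      by (simp add: mult_ac)
    then have "a powr m / a * v x \<le> a powr m / a * ((2 powr \<bar>\<gamma>\<bar> * R powr \<gamma>) * (v x * norm x powr (- \<gamma>)))"
      using a by (intro mult_left_mono) auto
    then have v_le: "v x powr m \<le> a powr m + a powr m / a * ((2 powr \<bar>\<gamma>\<bar> * R powr \<gamma>) * (v x * norm x powr (- \<gamma>)))"
      using concave[OF that] by linarith
    have "\<bar>v x powr m\<bar> * \<bar>P ((norm x)\<^sup>2 / R\<^sup>2)\<bar>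
        \<le> (a powr m + a powr m / a * ((2 powr \<bar>\<gamma>\<bar> * R powr \<gamma>) * (v x * norm x powr (- \<gamma>)))) * c"
      using v_le P(1) order_trans[OF powr_ge_zero v_le] by (intro mult_mono) auto
    then show ?thesis using x that by (simp add: algebra_simps)
  qed
  have [measurable]: "cball (0::'a) (2 * R) \<in> sets borel" by simp
  define c1 c2 where "c1 = c * a powr m" and "c2 = c * (a powr m / a * (2 powr \<bar>\<gamma>\<bar> * R powr \<gamma>))"
  have c12: "0 \<le> c1" "0 \<le> c2" using a c by (simp_all add: c1_def c2_def)
  have split: "ennreal (c1 * indicator (cball 0 (2 * R)) x + c2 * y)
      = ennreal c1 * indicator (cball 0 (2 * R)) x + ennreal c2 * ennreal y"
    if "0 \<le> y" for y and x :: 'a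
    using that c12 by (cases "x \<in> cball 0 (2 * R)") (simp_all add: ennreal_mult')
  have "(\<integral>\<^sup>+ x. ennreal (\<bar>v x powr m\<bar> * \<bar>P ((norm x)\<^sup>2 / R\<^sup>2)\<bar>) \<partial>lborel)
      \<le> (\<integral>\<^sup>+ x. ennreal c1 * indicator (cball 0 (2 * R)) x
        + ennreal c2 * ennreal (\<bar>v x\<bar> * norm x powr (- \<gamma>)) \<partial>lborel)"
  proof (rule nn_integral_mono_AE)
    show "AE x in lborel. ennreal (\<bar>v x powr m\<bar> * \<bar>P ((norm x)\<^sup>2 / R\<^sup>2)\<bar>)
        \<le> ennreal c1 * indicator (cball 0 (2 * R)) x + ennreal c2 * ennreal (\<bar>v x\<bar> * norm x powr (- \<gamma>))"
      using v
    proof eventually_elim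
      case (elim x)
      show ?case
        using ennreal_leI[OF pt[OF elim, folded c1_def c2_def]]
        by (subst (asm) split) auto
    qed
  qed
  also have "\<dots> = (\<integral>\<^sup>+ x. ennreal c1 * indicator (cball (0::'a) (2 * R)) x \<partial>lborel)
        + (\<integral>\<^sup>+ x. ennreal c2 * ennreal (\<bar>v x\<bar> * norm x powr (- \<gamma>)) \<partial>lborel)"
    by (rule nn_integral_add) measurable
  also have "(\<integral>\<^sup>+ x. ennreal c1 * indicator (cball (0::'a) (2 * R)) x \<partial>lborel)
      = ennreal c1 * emeasure lborel (cball (0::'a) (2 * R))"
    by (rule nn_integral_cmult_indicator) simp
  also have "(\<integral>\<^sup>+ x. ennreal c2 * ennreal (\<bar>v x\<bar> * norm x powr (- \<gamma>)) \<partial>lborel) = ennreal c2 * L1w_norm \<gamma> v"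
    unfolding L1w_norm_def by (rule nn_integral_cmult) measurable
  also have "ennreal c1 * emeasure lborel (cball (0::'a) (2 * R)) + ennreal c2 * L1w_norm \<gamma> v
      \<le> ennreal c1 * ennreal (unit_ball_vol ?d * (2 * R) ^ DIM('a)) + ennreal c2 * ennreal S"
    using S R by (intro add_mono mult_left_mono) (auto simp: emeasure_cball)
  also have "\<dots> = ennreal (c1 * (unit_ball_vol ?d * (2 * R) ^ DIM('a)) + c2 * S)"
    using c12 S R by (subst ennreal_plus) (auto simp: ennreal_mult')
  also have "c1 * (unit_ball_vol ?d * (2 * R) ^ DIM('a)) + c2 * S = c * (a powr m) * (unit_ball_vol ?d * (2 * R) ^ DIM('a))
        + c * (a powr m / a * (2 powr \<bar>\<gamma>\<bar> * R powr \<gamma>)) * S"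
    by (simp only: c1_def c2_def)
  also have "c * (a powr m) * (unit_ball_vol ?d * (2 * R) ^ DIM('a))
        + c * (a powr m / a * (2 powr \<bar>\<gamma>\<bar> * R powr \<gamma>)) * S
      = c * (unit_ball_vol ?d * 2 ^ DIM('a)) * (a powr m * R ^ DIM('a))
        + c * 2 powr \<bar>\<gamma>\<bar> * (a powr m / a * R powr \<gamma>) * S"
    by (simp add: power_mult_distrib)
  also have "\<dots> = c * (unit_ball_vol ?d * 2 ^ DIM('a)) * ?E * 1 + c * 2 powr \<bar>\<gamma>\<bar> * ?E * S"
    unfolding am am1 by simp
  also have "ennreal \<dots> \<le> ennreal (c * (unit_ball_vol ?d * 2 ^ DIM('a) + 2 powr \<bar>\<gamma>\<bar>) * ?E * (1 + S))"
  proof (rule ennreal_leI)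
    have "c * (unit_ball_vol ?d * 2 ^ DIM('a)) * ?E * 1 \<le> c * (unit_ball_vol ?d * 2 ^ DIM('a)) * ?E * (1 + S)"
      "c * 2 powr \<bar>\<gamma>\<bar> * ?E * S \<le> c * 2 powr \<bar>\<gamma>\<bar> * ?E * (1 + S)"
      using c S by (intro mult_left_mono; simp)+
    then show "c * (unit_ball_vol ?d * 2 ^ DIM('a)) * ?E * 1 + c * 2 powr \<bar>\<gamma>\<bar> * ?E * S
        \<le> c * (unit_ball_vol ?d * 2 ^ DIM('a) + 2 powr \<bar>\<gamma>\<bar>) * ?E * (1 + S)"
      by (simp only: distrib_left distrib_right) 
  qed
  finally show ?thesis .
qed

lemma smooth_cutoff_exists:
  obtains h h' :: "real \<Rightarrow> real" where "smooth h" "smooth h'" "\<And>s. (h has_real_derivative h' s) (at s)"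
    "\<And>s. 0 \<le> h s" "\<And>s. h s \<le> 1" "\<And>s. s \<le> 1 \<Longrightarrow> h s = 1" "\<And>s. 4 < s \<Longrightarrow> h s = 0"
    "\<And>s. s \<notin> {1..4} \<Longrightarrow> h' s = 0"
proof -
  obtain H \<eta> :: "real \<Rightarrow> real" where H: "smooth H" "smooth \<eta>"
    "\<And>s. (H has_real_derivative \<eta> s) (at s)" "\<And>s. 0 \<le> \<eta> s"
    "\<And>s. s \<le> 0 \<Longrightarrow> H s = 0" "\<And>s. 1 \<le> s \<Longrightarrow> H s = 1" "\<And>s. s \<notin> {0<..<1} \<Longrightarrow> \<eta> s = 0"
    "\<And>s. 0 \<le> H s" "\<And>s. H s \<le> 1"
    using smooth_step_exists by blast
  have "smooth (\<lambda>s::real. 1 / 3 * s + - (1 / 3))"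
    by (intro allI cd_add cd_const cd_bounded_linear bounded_linear_mult_right)
  then have aff: "smooth (\<lambda>s::real. (s - 1) / 3)" by (simp add: diff_divide_distrib)
  have comp: "smooth (\<lambda>s. a + b * f ((s - 1) / 3))" if "smooth f" for a b and f :: "real \<Rightarrow> real"
    by (rule allI, rule cd_add[OF cd_const cd_mult[OF cd_const cd_compose[OF that[rule_format] aff[rule_format]]]])
  show thesis
  proof (rule that)
    show "smooth (\<lambda>s. 1 + - 1 * H ((s - 1) / 3))" by (rule comp[OF H(1)])
    show "smooth (\<lambda>s. 0 + - (1 / 3) * \<eta> ((s - 1) / 3))" by (rule comp[OF H(2)])
    show "((\<lambda>s. 1 + - 1 * H ((s - 1) / 3)) has_real_derivative 0 + - (1 / 3) * \<eta> ((s - 1) / 3)) (at s)" for s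
      using DERIV_diff[OF DERIV_const[of 1] DERIV_rescale[OF H(3), of 1 3]] by simp
    show "0 + - (1 / 3) * \<eta> ((s - 1) / 3) = 0" if "s \<notin> {1..4}" for s
    proof -
      have "(s - 1) / 3 \<notin> {0<..<1}" using that by auto
      then show ?thesis using H(7) by simp
    qed
  qed (use H in auto)
qed

text \<open>The annulus bound controls the time derivative of the local mass in the weak sense, and
  \<open>lipschitz_if_weak_derivative_bounded\<close> turns this into a bound for increments. The factor \<open>R\<^bsup>-1/\<theta>\<^esup>\<close> combines
  \<open>R\<^bsup>-\<beta>-2\<^esup>\<close> from the divergence of the flux with \<open>R\<^bsup>d-(d-\<gamma>)m\<^esup>\<close> from the integral of \<open>u\<^sup>m\<close>.\<close>

lemma local_mass_lipschitz:
  assumes d: "\<gamma> < real DIM('a::euclidean_space)" and m: "m_crit (real DIM('a)) \<gamma> \<beta> < m" "0 < m" "m < 1"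
  obtains h :: "real \<Rightarrow> real" and C where "continuous_on UNIV h" "\<And>s. 0 \<le> h s" "\<And>s. h s \<le> 1"
    "\<And>s. s \<le> 1 \<Longrightarrow> h s = 1" "\<And>s. 4 < s \<Longrightarrow> h s = 0" "0 \<le> C"
    "\<And>u0 (u :: real \<Rightarrow> 'a \<Rightarrow> real) R S T b. weak_solution \<gamma> \<beta> m u0 u \<Longrightarrow> 0 < R \<Longrightarrow> 0 \<le> S \<Longrightarrow>
      (\<And>t. 0 < t \<Longrightarrow> t \<le> T \<Longrightarrow> L1w_norm \<gamma> (u t) \<le> ennreal S) \<Longrightarrow> 0 < b \<Longrightarrow> b < T \<Longrightarrow>
      \<bar>weighted_integral \<gamma> (\<lambda>x. h ((norm x)\<^sup>2 / R\<^sup>2)) (u b) - weighted_integral \<gamma> (\<lambda>x. h ((norm x)\<^sup>2 / R\<^sup>2)) (u 0)\<bar>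
      \<le> C * R powr (- (1 / theta_exp (real DIM('a)) \<gamma> \<beta> m)) * (1 + S) * b"
proof -
  let ?d = "real DIM('a)"
  obtain h h' :: "real \<Rightarrow> real" where h: "smooth h" "smooth h'" "\<And>s. (h has_real_derivative h' s) (at s)"
    "\<And>s. 0 \<le> h s" "\<And>s. h s \<le> 1" "\<And>s. s \<le> 1 \<Longrightarrow> h s = 1" "\<And>s. 4 < s \<Longrightarrow> h s = 0"
    "\<And>s. s \<notin> {1..4} \<Longrightarrow> h' s = 0"
    using smooth_cutoff_exists by blast
  define k where "k s = s powr (- \<beta> / 2) * (2 * h' s)" for s
  have k: "smooth k"
    unfolding k_def
  proof (rule smooth_powr_mult)
    show "smooth (\<lambda>s. 2 * h' s)" using h(2) by (intro allI cd_mult cd_const) blast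
  qed (use h(8) in auto)
  have k_eq: "k s = 2 * (s powr (- \<beta> / 2) * h' s)" for s by (simp add: k_def)
  have k_0: "k s = 0" if "s \<notin> {1..4}" for s using h(8)[OF that] by (simp add: k_def)
  obtain k' where k': "smooth k'" "\<And>s. (k has_real_derivative k' s) (at s)"
    using smooth_real_derivative[OF k] by blast
  have k'_0: "k' s = 0" if "s \<notin> {1..4}" for s by (rule DERIV_zero_outside[OF k_0 k'(2) that])
  define P where "P s = ?d * k s + 2 * s * k' s" for s
  have P_0: "P s = 0" if "s \<notin> {1..4}" for s using k_0[OF that] k'_0[OF that] by (simp add: P_def)
  have P_cont: "continuous_on S P" for S
    unfolding P_def by (intro continuous_intros smooth_continuous k k'(1))
  then have "bounded (P ` {1..4})" by (intro compact_imp_bounded compact_continuous_image) auto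
  then obtain c where "\<forall>s\<in>{1..4}. \<bar>P s\<bar> \<le> c" by (auto simp: bounded_iff)
  then have c: "\<bar>P s\<bar> \<le> \<bar>c\<bar>" for s
    using P_0[of s] order_trans[OF _ abs_ge_self, of _ c] by (cases "s \<in> {1..4}") auto
  define A where "A = \<bar>c\<bar> * (unit_ball_vol ?d * 2 ^ DIM('a) + 2 powr \<bar>\<gamma>\<bar>)"
  have A: "0 \<le> A" by (simp add: A_def)
  let ?\<theta> = "theta_exp ?d \<gamma> \<beta> m"
  have exponent: "R powr (- \<beta> - 2) * R powr (?d - (?d - \<gamma>) * m) = R powr (- (1 / ?\<theta>))" for R
    unfolding tail_exponent(3)[OF d m(1,3), symmetric] by (simp add: powr_add[symmetric] algebra_simps)
  have main: "\<bar>weighted_integral \<gamma> (\<lambda>x. h ((norm x)\<^sup>2 / R\<^sup>2)) (u b) - weighted_integral \<gamma> (\<lambda>x. h ((norm x)\<^sup>2 / R\<^sup>2)) (u 0)\<bar>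
      \<le> A * R powr (- (1 / ?\<theta>)) * (1 + S) * b"
    if u: "weak_solution \<gamma> \<beta> m u0 u" and R: "0 < R" and S: "0 \<le> S"
      "\<And>t. 0 < t \<Longrightarrow> t \<le> T \<Longrightarrow> L1w_norm \<gamma> (u t) \<le> ennreal S" and b: "0 < b" "b < T"
    for u0 :: "'a \<Rightarrow> real" and u R S T b
  proof -
    let ?\<rho> = "\<lambda>x::'a. (norm x)\<^sup>2 / R\<^sup>2"
    define F where "F t = weighted_integral \<gamma> (\<lambda>x. h (?\<rho> x)) (u t)" for t
    let ?K = "A * R powr (- (1 / ?\<theta>)) * (1 + S)"
    have "continuous_on UNIV (\<lambda>x. h (?\<rho> x))"
      using R by (intro continuous_on_compose2[OF smooth_continuous[OF h(1), of UNIV]] continuous_intros) auto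
    then have h_meas: "(\<lambda>x. h (?\<rho> x)) \<in> borel_measurable borel" by (rule borel_measurable_continuous_onI)
    have F_cont: "continuous_on {0..} F"
      unfolding F_def by (rule weighted_integral_continuous[OF u h_meas]) (simp add: abs_of_nonneg h(4,5))
    have weak: "\<bar>LINT t|lborel. F t * \<xi>' t\<bar> \<le> ?K * (q - p)"
      if \<xi>: "smooth \<xi>" "\<And>t. (\<xi> has_real_derivative \<xi>' t) (at t)" "\<And>t. 0 \<le> \<xi> t \<and> \<xi> t \<le> 1"
        "\<And>t. t \<notin> {p..q} \<Longrightarrow> \<xi> t = 0" "0 < p" "p < q" "q \<le> T" for \<xi> \<xi>' p q
    proof -
      let ?Z = "\<lambda>z. u (fst z) (snd z) powr m * (\<xi> (fst z) * P (?\<rho> (snd z)))"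
      have Sq: "L1w_norm \<gamma> (u t) \<le> ennreal S" if "t \<in> {p..q}" for t
        using that \<xi>(5,7) by (intro S(2)) auto
      note test = weak_solution_separated_test[OF u \<xi>(1,2,4,5) h(1,3,7,4,5) k k'(2) k_eq k_0 R Sq S(1),
          folded P_def]
      have "(LINT t|lborel. F t * \<xi>' t) = - (R powr (- \<beta> - 2)) * (LINT z|lborel. ?Z z)"
        unfolding F_def weighted_integral_def by (rule test(2))
      then have eq: "\<bar>LINT t|lborel. F t * \<xi>' t\<bar> = R powr (- \<beta> - 2) * \<bar>LINT z|lborel. ?Z z\<bar>"
        by (simp add: abs_mult)
      let ?B = "A * R powr (?d - (?d - \<gamma>) * m) * (1 + S)"
      have Z_int: "integrable (lborel \<Otimes>\<^sub>M lborel) ?Z" using test(1) by (simp add: lborel_prod)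
      have "ennreal \<bar>LINT z|lborel. ?Z z\<bar> \<le> (\<integral>\<^sup>+ z. ennreal \<bar>?Z z\<bar> \<partial>lborel)"
        using integral_norm_bound_ennreal[OF test(1)] by simp
      also have "\<dots> = (\<integral>\<^sup>+ z. ennreal \<bar>?Z z\<bar> \<partial>(lborel \<Otimes>\<^sub>M lborel))" by (simp add: lborel_prod)
      also have "\<dots> = (\<integral>\<^sup>+ t. \<integral>\<^sup>+ x. ennreal \<bar>?Z (t, x)\<bar> \<partial>lborel \<partial>lborel)"
      proof (rule lborel.nn_integral_fst[symmetric])
        show "(\<lambda>z. ennreal \<bar>?Z z\<bar>) \<in> borel_measurable (lborel \<Otimes>\<^sub>M lborel)"
          by (rule measurable_compose[OF borel_measurable_integrable[OF Z_int]]) measurable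
      qed
      also have "\<dots> \<le> (\<integral>\<^sup>+ t. ennreal ?B * indicator {p..q} t \<partial>lborel)"
      proof (intro nn_integral_mono)
        fix t :: real
        show "(\<integral>\<^sup>+ x. ennreal \<bar>?Z (t, x)\<bar> \<partial>lborel) \<le> ennreal ?B * indicator {p..q} t"
        proof (cases "t \<in> {p..q}")
          case True
          then have t: "0 \<le> t" using \<xi>(5) by simp
          have meas: "u t \<in> borel_measurable borel" using weak_solutionD(1)[OF u t] by (simp add: L1w_def)
          have "(\<integral>\<^sup>+ x. ennreal \<bar>?Z (t, x)\<bar> \<partial>lborel)
              \<le> (\<integral>\<^sup>+ x. ennreal (\<bar>u t x powr m\<bar> * \<bar>P (?\<rho> x)\<bar>) \<partial>lborel)"
          proof (intro nn_integral_mono ennreal_leI)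
            fix x
            have "\<bar>?Z (t, x)\<bar> = \<bar>\<xi> t\<bar> * (\<bar>u t x powr m\<bar> * \<bar>P (?\<rho> x)\<bar>)" by (simp add: abs_mult mult_ac)
            also have "\<dots> \<le> 1 * (\<bar>u t x powr m\<bar> * \<bar>P (?\<rho> x)\<bar>)"
              using \<xi>(3)[of t] by (intro mult_right_mono) auto
            finally show "\<bar>?Z (t, x)\<bar> \<le> \<bar>u t x powr m\<bar> * \<bar>P (?\<rho> x)\<bar>" by simp
          qed
          also have "\<dots> \<le> ennreal ?B"
            unfolding A_def
            by (rule annulus_power_bound[OF meas weak_solutionD(2)[OF u t] Sq[OF True] S(1) m(2,3) R c P_0])
          finally show ?thesis using True by simp
        next
          case False
          then show ?thesis using \<xi>(4) by simp
        qed
      qed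
      also have "\<dots> = ennreal (?B * (q - p))"
        using \<xi>(6) A S(1) by (simp add: nn_integral_cmult_indicator ennreal_mult)
      finally have "\<bar>LINT z|lborel. ?Z z\<bar> \<le> ?B * (q - p)"
        using \<xi>(6) A S(1) by (subst (asm) ennreal_le_iff) auto
      then have "\<bar>LINT t|lborel. F t * \<xi>' t\<bar> \<le> R powr (- \<beta> - 2) * (?B * (q - p))"
        unfolding eq by (intro mult_left_mono) auto
      also have "\<dots> = ?K * (q - p)"
        unfolding exponent[symmetric] by (simp add: mult_ac)
      finally show ?thesis .
    qed
    have lip: "\<bar>F b - F a\<bar> \<le> ?K * (b - a)" if "0 < a" "a < b" for a
    proof (rule lipschitz_if_weak_derivative_bounded[OF _ that b(2)])
      show "continuous_on {0<..} F" by (rule continuous_on_subset[OF F_cont]) auto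
    qed (rule weak)
    have "(F \<longlongrightarrow> F 0) (at 0 within {0..})" using F_cont by (simp add: continuous_on_def)
    then have F0: "(F \<longlongrightarrow> F 0) (at_right 0)"
      by (rule tendsto_within_subset) auto
    have "\<bar>F b - F 0\<bar> \<le> ?K * (b - 0)"
    proof (rule tendsto_le)
      show "((\<lambda>a. \<bar>F b - F a\<bar>) \<longlongrightarrow> \<bar>F b - F 0\<bar>) (at_right 0)"
        by (intro tendsto_intros F0)
      show "((\<lambda>a. ?K * (b - a)) \<longlongrightarrow> ?K * (b - 0)) (at_right 0)"
        by (intro tendsto_intros)
      show "\<forall>\<^sub>F a in at_right 0. \<bar>F b - F a\<bar> \<le> ?K * (b - a)"
        using eventually_at_right_less eventually_at_right[of 0 b] b(1)
        by (intro eventually_at_rightI[of 0 b] lip) auto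
    qed simp
    then show ?thesis by (simp add: F_def)
  qed
  show thesis
    by (rule that[of h A]) (fact smooth_continuous[OF h(1), of UNIV] h(4-7) A main)+
qed

text \<open>The bound for the local mass at radius \<open>R\<close> has a factor \<open>R\<^bsup>-1/\<theta>\<^esup>\<close>. On a bounded time interval
  the masses are bounded by continuity, so letting \<open>R \<longrightarrow> \<infinity>\<close> shows that no mass is created.\<close>

lemma weak_solution_mass_le:
  fixes u :: "real \<Rightarrow> 'a::euclidean_space \<Rightarrow> real"
  assumes d: "\<gamma> < real DIM('a)" and m: "m_crit (real DIM('a)) \<gamma> \<beta> < m" "0 < m" "m < 1"
    and u: "weak_solution \<gamma> \<beta> m u0 u" and b: "0 < b"
  shows "L1w_norm \<gamma> (u b) \<le> L1w_norm \<gamma> (u 0)"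
proof -
  let ?\<theta> = "theta_exp (real DIM('a)) \<gamma> \<beta> m"
  obtain h :: "real \<Rightarrow> real" and C where h: "continuous_on UNIV h" "\<And>s. 0 \<le> h s" "\<And>s. h s \<le> 1"
    "\<And>s. s \<le> 1 \<Longrightarrow> h s = 1" "\<And>s. 4 < s \<Longrightarrow> h s = 0" "0 \<le> C"
    and est: "\<And>u0 (u :: real \<Rightarrow> 'a \<Rightarrow> real) R S T b. weak_solution \<gamma> \<beta> m u0 u \<Longrightarrow> 0 < R \<Longrightarrow> 0 \<le> S \<Longrightarrow>
      (\<And>t. 0 < t \<Longrightarrow> t \<le> T \<Longrightarrow> L1w_norm \<gamma> (u t) \<le> ennreal S) \<Longrightarrow> 0 < b \<Longrightarrow> b < T \<Longrightarrow>
      \<bar>weighted_integral \<gamma> (\<lambda>x. h ((norm x)\<^sup>2 / R\<^sup>2)) (u b) - weighted_integral \<gamma> (\<lambda>x. h ((norm x)\<^sup>2 / R\<^sup>2)) (u 0)\<bar>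
      \<le> C * R powr (- (1 / ?\<theta>)) * (1 + S) * b"
    using local_mass_lipschitz[OF d m] by blast
  have [measurable]: "h \<in> borel_measurable borel" by (rule borel_measurable_continuous_onI[OF h(1)])
  let ?N = "\<lambda>t. weighted_integral \<gamma> (\<lambda>_. 1) (u t)"
  have N: "L1w_norm \<gamma> (u t) = ennreal (?N t)" if "0 \<le> t" for t
    by (rule L1w_norm_eq_weighted_integral[OF weak_solutionD[OF u that]])
  have "continuous_on {0..b + 1} ?N"
    by (rule continuous_on_subset[OF weighted_integral_continuous[OF u]]) auto
  then have "bounded (?N ` {0..b + 1})" by (intro compact_imp_bounded compact_continuous_image) auto
  then obtain S where "\<forall>t\<in>{0..b + 1}. \<bar>?N t\<bar> \<le> S" by (auto simp: bounded_iff)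
  then have S_bound: "\<bar>?N t\<bar> \<le> S" if "t \<in> {0..b + 1}" for t using that by blast
  have S: "0 \<le> S" using S_bound[of 0] b by simp
  have S': "L1w_norm \<gamma> (u t) \<le> ennreal S" if "0 < t" "t \<le> b + 1" for t
    using S_bound[of t] that by (simp add: N ennreal_leI)
  define r where "r n = real n + 1" for n
  let ?w = "\<lambda>n x. h ((norm (x::'a))\<^sup>2 / (r n)\<^sup>2)"
  have w: "?w n \<in> borel_measurable borel" "\<bar>?w n x\<bar> \<le> 1" for n x
    by (simp_all add: abs_of_nonneg h(2,3))
  have le: "weighted_integral \<gamma> (?w n) (u b) \<le> ?N 0 + C * (r n) powr (- (1 / ?\<theta>)) * (1 + S) * b" for n
  proof -
    have "weighted_integral \<gamma> (?w n) (u 0) \<le> ?N 0"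
      using h(3) by (intro weighted_integral_mono weak_solutionD[OF u] w) auto
    moreover have "\<bar>weighted_integral \<gamma> (?w n) (u b) - weighted_integral \<gamma> (?w n) (u 0)\<bar>
        \<le> C * (r n) powr (- (1 / ?\<theta>)) * (1 + S) * b"
      by (rule est[OF u _ S S']) (use b in \<open>auto simp: r_def\<close>)
    ultimately show ?thesis by linarith
  qed
  have r_lim: "filterlim r at_top sequentially"
    by (rule filterlim_at_top_mono[OF filterlim_real_sequentially]) (simp add: r_def)
  have ub: "u b \<in> L1w \<gamma>" using weak_solutionD(1)[OF u] b by simp
  have [measurable]: "u b \<in> borel_measurable borel" using ub by (simp add: L1w_def)
  have "?N b \<le> ?N 0 + C * 0 * (1 + S) * b"
  proof (rule tendsto_le)
    show "(\<lambda>n. weighted_integral \<gamma> (?w n) (u b)) \<longlonglongrightarrow> ?N b"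
      unfolding weighted_integral_def
    proof (rule integral_dominated_convergence)
      show "integrable lborel (\<lambda>x. \<bar>u b x * 1 * norm x powr (- \<gamma>)\<bar>)"
        by (intro integrable_abs weighted_integrable[OF ub]) auto
      show "AE x in lborel. norm (u b x * ?w n x * norm x powr (- \<gamma>)) \<le> \<bar>u b x * 1 * norm x powr (- \<gamma>)\<bar>" for n
      proof (rule AE_I2)
        fix x
        show "norm (u b x * ?w n x * norm x powr (- \<gamma>)) \<le> \<bar>u b x * 1 * norm x powr (- \<gamma>)\<bar>"
          using mult_left_mono[OF w(2)[where n = n and x = x], of "\<bar>u b x\<bar> * norm x powr (- \<gamma>)"] by (simp add: abs_mult mult_ac)
      qed
      show "AE x in lborel. (\<lambda>n. u b x * ?w n x * norm x powr (- \<gamma>)) \<longlonglongrightarrow> u b x * 1 * norm x powr (- \<gamma>)"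
      proof (rule AE_I2, rule tendsto_eventually)
        fix x :: 'a
        have "\<forall>\<^sub>F n in sequentially. norm x \<le> r n"
          using r_lim by (auto simp: filterlim_at_top)
        then show "\<forall>\<^sub>F n in sequentially. u b x * ?w n x * norm x powr (- \<gamma>) = u b x * 1 * norm x powr (- \<gamma>)"
        proof eventually_elim
          case (elim n)
          then have "(norm x)\<^sup>2 \<le> (r n)\<^sup>2" by (intro power_mono) auto
          then have "?w n x = 1" by (intro h(4)) (simp add: divide_le_eq_1 r_def)
          then show ?case by simp
        qed
      qed
    qed measurable
    have "0 < 1 / ?\<theta>" using tail_exponent(1)[OF d m(1,3)] by simp
    then have "(\<lambda>n. (r n) powr (- (1 / ?\<theta>))) \<longlonglongrightarrow> 0"
      by (intro tendsto_neg_powr r_lim) auto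
    then show "(\<lambda>n. ?N 0 + C * (r n) powr (- (1 / ?\<theta>)) * (1 + S) * b) \<longlonglongrightarrow> ?N 0 + C * 0 * (1 + S) * b"
      by (intro tendsto_intros)
  qed (use le in auto)
  then show ?thesis using b by (simp add: N ennreal_leI)
qed

section \<open>Slow convergence for data with a heavy tail\<close>

lemma const_mult_powr_at_top:
  fixes c a :: real
  assumes "0 < c" "0 < a"
  shows "filterlim (\<lambda>t. c * t powr a) at_top at_top"
proof -
  have "filterlim (\<lambda>t. exp (a * ln t)) at_top at_top"
    by (intro filterlim_compose[OF exp_at_top] filterlim_tendsto_pos_mult_at_top[OF tendsto_const assms(2)] ln_at_top)
  then have "filterlim (\<lambda>t. t powr a) at_top at_top"
    by (rule filterlim_mono_eventually[OF _ order_refl order_refl])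
      (auto simp: powr_def intro: eventually_mono[OF eventually_gt_at_top[of 0]])
  then show ?thesis by (rule filterlim_tendsto_pos_mult_at_top[OF tendsto_const assms(1)])
qed

lemma tendsto_infinity_if_ge_power:
  fixes f :: "real \<Rightarrow> ennreal"
  assumes "0 < c" "0 < a" "eventually (\<lambda>t. ennreal (c * t powr a) \<le> f t) at_top"
  shows "(f \<longlongrightarrow> \<infinity>) at_top"
proof -
  have "filterlim (\<lambda>t. c * t powr a) at_top at_top"
    by (rule const_mult_powr_at_top[OF assms(1,2)])
  then have lim: "((\<lambda>t. ennreal (c * t powr a)) \<longlongrightarrow> \<infinity>) at_top"
    by (simp add: ennreal_tendsto_top_eq_at_top)
  show ?thesis
    by (rule tendsto_sandwich[OF assms(3) _ lim tendsto_const]) simp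
qed

lemma ennreal_eq_imp_eq_pos: "ennreal a = ennreal b \<Longrightarrow> 0 < b \<Longrightarrow> a = b"
  by (cases "0 \<le> a") (auto simp: ennreal_neg ennreal_eq_0_iff)

lemma heavy_tail_datum:
  fixes \<gamma> \<epsilon> :: real
  assumes \<epsilon>: "0 < \<epsilon>"
  defines "v \<equiv> \<lambda>x::'a::euclidean_space. indicator {x. 1 \<le> norm x} x * norm x powr (- (real DIM('a) - \<gamma> + \<epsilon>))"
  obtains M where "0 < M" "v \<in> L1w \<gamma>" "L1w_norm \<gamma> v = ennreal M"
    "\<And>\<rho>. 1 \<le> \<rho> \<Longrightarrow> L1w_norm \<gamma> (\<lambda>x. indicator {x. \<rho> \<le> norm x} x * v x) = ennreal (\<rho> powr (- \<epsilon>) * M)"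
proof -
  let ?q = "real DIM('a) + \<epsilon>"
  let ?T = "\<integral>\<^sup>+ (x::'a). indicator {x. 1 \<le> norm x} x * ennreal (norm x powr (- ?q)) \<partial>lborel"
  have tail: "L1w_norm \<gamma> (\<lambda>x. indicator {x. \<rho> \<le> norm x} x * v x)
      = (\<integral>\<^sup>+ (x::'a). indicator {x. \<rho> \<le> norm x} x * ennreal (norm x powr (- ?q)) \<partial>lborel)"
    if "1 \<le> \<rho>" for \<rho>
    unfolding L1w_norm_def
  proof (intro nn_integral_cong)
    fix x :: 'a
    have "norm x powr (- (real DIM('a) - \<gamma> + \<epsilon>)) * norm x powr (- \<gamma>) = norm x powr (- ?q)"
      by (simp add: powr_add[symmetric])
    then show "ennreal (\<bar>indicator {x. \<rho> \<le> norm x} x * v x\<bar> * norm x powr (- \<gamma>))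
        = indicator {x. \<rho> \<le> norm x} x * ennreal (norm x powr (- ?q))"
      using that by (auto simp: v_def indicator_def)
  qed
  have "(\<lambda>x. indicator {x. 1 \<le> norm x} x * v x) = v" by (simp add: v_def indicator_def fun_eq_iff)
  then have v: "L1w_norm \<gamma> v = ?T" using tail[of 1] by simp
  have fin: "?T < \<infinity>" using \<epsilon> by (intro power_weight_integrable_at_infinity) simp
  have "?T \<noteq> 0"
  proof
    assume "?T = 0"
    then have "AE x::'a in lborel. indicator {x. 1 \<le> norm x} x * ennreal (norm x powr (- ?q)) = 0"
      by (subst (asm) nn_integral_0_iff_AE) measurable
    then have "AE x in lborel. x \<notin> {x::'a. 1 \<le> norm x}"
      by eventually_elim (auto simp: indicator_def)
    then have "emeasure lborel {x::'a. 1 \<le> norm x} = 0"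
      by (subst (asm) AE_iff_measurable[OF _ refl]) auto
    moreover have "emeasure lborel {x::'a. 1 \<le> norm x} + emeasure lborel (cball (0::'a) 1) = \<infinity>"
    proof -
      have "{x::'a. 1 \<le> norm x} \<union> cball 0 1 = UNIV" by auto
      then have "emeasure lborel (UNIV::'a set) \<le> emeasure lborel {x::'a. 1 \<le> norm x} + emeasure lborel (cball (0::'a) 1)"
        using emeasure_subadditive[of "{x::'a. 1 \<le> norm x}" lborel "cball 0 1"] by simp
      then show ?thesis by (simp add: top_unique)
    qed
    ultimately show False using emeasure_lborel_cball_finite[of "0::'a" 1] by simp
  qed
  with fin obtain M where M: "?T = ennreal M" "0 < M" by (cases ?T) (auto simp: ennreal_eq_0_iff)
  show thesis
  proof (rule that[of M])
    show "v \<in> L1w \<gamma>" using v fin by (simp add: L1w_def) (simp add: v_def)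
    show "L1w_norm \<gamma> (\<lambda>x. indicator {x. \<rho> \<le> norm x} x * v x) = ennreal (\<rho> powr (- \<epsilon>) * M)"
      if "1 \<le> \<rho>" for \<rho>
    proof -
      have "L1w_norm \<gamma> (\<lambda>x. indicator {x. \<rho> \<le> norm x} x * v x) = ennreal (\<rho> powr (real DIM('a) - ?q)) * ?T"
        unfolding tail[OF that] by (rule power_weight_mass_outside) (use that \<epsilon> in auto)
      then show ?thesis unfolding M(1) by (simp add: ennreal_mult')
    qed
  qed (use v M in auto)
qed

theorem theorem4p6:
  fixes \<gamma> \<beta> m \<delta> :: real
  assumes "3 \<le> DIM('a::euclidean_space)"
    and "\<gamma> < real DIM('a)"
    and "\<gamma> - 2 < \<beta>" and "\<beta> \<le> \<gamma> * (real DIM('a) - 2) / real DIM('a)"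
    and "m_crit (real DIM('a)) \<gamma> \<beta> < m" and "m < 1"
    and "0 < \<delta>"
  shows "\<exists>u0 \<in> L1w \<gamma>. (AE x in lborel. 0 \<le> u0 x) \<and> \<not> (AE x in lborel. u0 x = 0) \<and>
    (\<forall>u :: real \<Rightarrow> 'a \<Rightarrow> real. weak_solution \<gamma> \<beta> m u0 u \<longrightarrow>
      (let M = enn2real (L1w_norm \<gamma> u0) in
        ((\<lambda>t. ennreal (t powr (\<delta> + (real DIM('a) - \<gamma>) * theta_exp (real DIM('a)) \<gamma> \<beta> m))
               * Linf_norm (\<lambda>x. u t x - barenblatt \<gamma> \<beta> m M t x)) \<longlongrightarrow> \<infinity>) at_top \<and>
        ((\<lambda>t. ennreal (t powr \<delta>)
               * L1w_norm \<gamma> (\<lambda>x. u t x - barenblatt \<gamma> \<beta> m M t x)) \<longlongrightarrow> \<infinity>) at_top))"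
proof -
  let ?d = "real DIM('a)"
  define \<theta> where "\<theta> = theta_exp ?d \<gamma> \<beta> m"
  note d = assms(2) and mc = assms(5) and m1 = assms(6)
  have \<sigma>: "0 < sigma_exp \<gamma> \<beta>" using assms(3) by (simp add: sigma_exp_def)
  have m0: "0 < m"
  proof -
    have "\<gamma> * (?d - 2) / ?d < ?d - 2"
    proof -
      have "\<gamma> * (?d - 2) < ?d * (?d - 2)" using assms(1,2) by (intro mult_strict_right_mono) auto
      then show ?thesis using assms(1) by (simp add: divide_less_eq mult.commute)
    qed
    then have "0 < m_crit ?d \<gamma> \<beta>" using assms(2,4) by (simp add: m_crit_def)
    then show ?thesis using mc by simp
  qed
  have \<theta>: "0 < \<theta>" unfolding \<theta>_def by (rule tail_exponent(1)[OF d mc m1])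

  \<comment> \<open>The radius is \<open>t\<^bsup>\<theta>(1+\<kappa>)\<^esup>\<close>. The excess \<open>\<kappa>\<close> costs \<open>\<delta>/2\<close> in the \<open>L\<^sup>\<infinity>\<close> rate, and the tail mass of the
    datum decays like \<open>t\<^sup>-\<^sup>e\<close> with \<open>e\<close> smaller than both \<open>\<delta>/2\<close> and the rate \<open>\<kappa>\<close> of the errors.\<close>
  define \<kappa> where "\<kappa> = \<delta> / (2 * ((?d - \<gamma>) * \<theta>))"
  define e where "e = min \<kappa> (\<delta> / 2) / 2"
  define \<epsilon> where "\<epsilon> = e / (\<theta> * (1 + \<kappa>))"
  have \<kappa>: "0 < \<kappa>" "(?d - \<gamma>) * \<theta> * \<kappa> = \<delta> / 2" using assms(7) d \<theta> by (simp_all add: \<kappa>_def)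
  have e: "0 < e" "e < \<kappa>" "e < \<delta> / 2" using \<kappa>(1) assms(7) by (auto simp: e_def min_def)
  have \<epsilon>: "0 < \<epsilon>" "\<theta> * (1 + \<kappa>) * \<epsilon> = e" using e \<theta> \<kappa> by (simp_all add: \<epsilon>_def)
  define u0 where "u0 = (\<lambda>x::'a. indicator {x. 1 \<le> norm x} x * norm x powr (- (?d - \<gamma> + \<epsilon>)))"
  obtain M where M: "0 < M" "u0 \<in> L1w \<gamma>" "L1w_norm \<gamma> u0 = ennreal M"
    and tail_u0: "\<And>\<rho>. 1 \<le> \<rho> \<Longrightarrow> L1w_norm \<gamma> (\<lambda>x. indicator {x. \<rho> \<le> norm x} x * u0 x) = ennreal (\<rho> powr (- \<epsilon>) * M)"
    using heavy_tail_datum[OF \<epsilon>(1), where ?'a = 'a and \<gamma> = \<gamma>] unfolding u0_def by blast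
  define B :: "real \<Rightarrow> 'a \<Rightarrow> real" where "B = barenblatt \<gamma> \<beta> m M"
  obtain K where K: "0 \<le> K"
    and B: "\<And>t. B t \<in> borel_measurable borel" "\<And>t x. 0 \<le> B t x"
      "\<And>t. 0 < t \<Longrightarrow> L1w_norm \<gamma> (B t) = ennreal M"
    and tail_B: "\<And>t \<rho>. 0 < t \<Longrightarrow> 0 < \<rho> \<Longrightarrow> L1w_norm \<gamma> (\<lambda>x. indicator {x. \<rho> \<le> norm x} x * B t x)
      \<le> ennreal (K * (\<rho> / t powr \<theta>) powr (- (1 / (\<theta> * (1 - m)))))"
    using barenblatt_mass_and_tail[OF d \<sigma> mc m1 m0 M(1)] unfolding B_def \<theta>_def by blast
  obtain h :: "real \<Rightarrow> real" and C where h: "continuous_on UNIV h" "\<And>s. 0 \<le> h s" "\<And>s. h s \<le> 1"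
    "\<And>s. s \<le> 1 \<Longrightarrow> h s = 1" "\<And>s. 4 < s \<Longrightarrow> h s = 0" and C: "0 \<le> C"
    and est: "\<And>u0 (u :: real \<Rightarrow> 'a \<Rightarrow> real) R S T b. weak_solution \<gamma> \<beta> m u0 u \<Longrightarrow> 0 < R \<Longrightarrow> 0 \<le> S \<Longrightarrow>
      (\<And>t. 0 < t \<Longrightarrow> t \<le> T \<Longrightarrow> L1w_norm \<gamma> (u t) \<le> ennreal S) \<Longrightarrow> 0 < b \<Longrightarrow> b < T \<Longrightarrow>
      \<bar>weighted_integral \<gamma> (\<lambda>x. h ((norm x)\<^sup>2 / R\<^sup>2)) (u b) - weighted_integral \<gamma> (\<lambda>x. h ((norm x)\<^sup>2 / R\<^sup>2)) (u 0)\<bar>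
      \<le> C * R powr (- (1 / \<theta>)) * (1 + S) * b"
    using local_mass_lipschitz[OF d mc m0 m1] unfolding \<theta>_def by blast
  obtain i0 where i0: "0 \<le> i0"
    "(\<integral>\<^sup>+ (x::'a). indicator {x. norm x \<le> 1} x * ennreal (norm x powr (- \<gamma>)) \<partial>lborel) = ennreal i0"
    using power_weight_integrable_at_origin[OF d]
    by (cases "\<integral>\<^sup>+ (x::'a). indicator {x. norm x \<le> 1} x * ennreal (norm x powr (- \<gamma>)) \<partial>lborel") auto
  define c0 where "c0 = 2 powr (?d - \<gamma>) * i0 + 1"
  have c0: "0 < c0" using i0 by (simp add: c0_def add_nonneg_pos)
  define c where "c = 3 powr (- \<epsilon>) * M / 2"
  have c: "0 < c" using M by (simp add: c_def)

  have limits: "((\<lambda>t. ennreal (t powr (\<delta> + (?d - \<gamma>) * \<theta>)) * Linf_norm (\<lambda>x. u t x - B t x)) \<longlongrightarrow> \<infinity>) at_top \<and>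
      ((\<lambda>t. ennreal (t powr \<delta>) * L1w_norm \<gamma> (\<lambda>x. u t x - B t x)) \<longlongrightarrow> \<infinity>) at_top"
    if u: "weak_solution \<gamma> \<beta> m u0 u" for u :: "real \<Rightarrow> 'a \<Rightarrow> real"
  proof -
    have u_eq: "AE x in lborel. u 0 x = u0 x" using u by (simp add: weak_solution_def)
    note u_t = weak_solutionD[OF u]
    have norm_0: "L1w_norm \<gamma> (\<lambda>x. f x * u 0 x) = L1w_norm \<gamma> (\<lambda>x. f x * u0 x)" for f
      unfolding L1w_norm_def by (rule nn_integral_cong_AE) (use u_eq in eventually_elim, simp)
    have u_mass: "L1w_norm \<gamma> (u t) \<le> ennreal M" if "0 < t" for t
      using weak_solution_mass_le[OF d mc m0 m1 u that] norm_0[of "\<lambda>_. 1"] M(3) by simp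
    let ?\<psi> = "\<lambda>R x::'a. h ((norm x)\<^sup>2 / R\<^sup>2)"
    let ?I = "\<lambda>w f. weighted_integral \<gamma> w f"
    define D where "D t R = ?I (?\<psi> R) (B t) - ?I (?\<psi> R) (u t)" for t R
    have \<psi>: "?\<psi> R \<in> borel_measurable borel" "\<bar>?\<psi> R x\<bar> \<le> 1" for R x
    proof -
      have [measurable]: "h \<in> borel_measurable borel" by (rule borel_measurable_continuous_onI[OF h(1)])
      show "?\<psi> R \<in> borel_measurable borel" by measurable
    qed (simp add: abs_of_nonneg h(2,3))
    have ind: "(indicator {x. \<rho> \<le> norm x} :: 'a \<Rightarrow> real) \<in> borel_measurable borel"
      "\<bar>indicator {x. \<rho> \<le> norm x} x\<bar> \<le> (1::real)"
      "(\<lambda>x::'a. 1 - indicator {x. \<rho> \<le> norm x} x :: real) \<in> borel_measurable borel"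
      "\<bar>1 - indicator {x. \<rho> \<le> norm x} x\<bar> \<le> (1::real)" for \<rho> and x :: 'a
      by (auto simp: indicator_def)
    have B_L1: "B t \<in> L1w \<gamma>" if "0 < t" for t using B(1,3) that by (simp add: L1w_def)
    have ind_norm: "L1w_norm \<gamma> (\<lambda>x. indicator {x. \<rho> \<le> norm x} x * f x) = ennreal (?I (indicator {x. \<rho> \<le> norm x}) f)"
      if "f \<in> L1w \<gamma>" "AE x in lborel. 0 \<le> f x" for f :: "'a \<Rightarrow> real" and \<rho>
      using that ind(1) by (rule L1w_norm_mult_eq_weighted_integral) (auto simp: indicator_def)

    \<comment> \<open>Tail mass of the datum, less the tail mass of the Barenblatt function and the mass transported
      across the cutoff region. The radius \<open>3R\<close> exceeds \<open>2R\<close>, so the cutoff vanishes there.\<close>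
    have D_lower: "(3 * R) powr (- \<epsilon>) * M - K * (R / t powr \<theta>) powr (- (1 / (\<theta> * (1 - m))))
        - C * R powr (- (1 / \<theta>)) * (1 + M) * t \<le> D t R" if t: "0 < t" and R: "1 \<le> R" for t R
    proof -
      have Bt: "B t \<in> L1w \<gamma>" "AE x in lborel. 0 \<le> B t x" using B_L1[OF t] B(2) by auto
      have u_0: "u 0 \<in> L1w \<gamma>" "AE x in lborel. 0 \<le> u 0 x" using u_t[of 0] by auto
      have "ennreal (?I (\<lambda>_. 1) (B t)) = ennreal M"
        using L1w_norm_eq_weighted_integral[OF Bt] B(3)[OF t] by simp
      then have mass_B: "?I (\<lambda>_. 1) (B t) = M" using M(1) by (rule ennreal_eq_imp_eq_pos)
      have "ennreal (?I (\<lambda>_. 1) (u 0)) = ennreal M"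
        using L1w_norm_eq_weighted_integral[OF u_0] norm_0[of "\<lambda>_. 1"] M(3) by simp
      then have mass_u: "?I (\<lambda>_. 1) (u 0) = M" using M(1) by (rule ennreal_eq_imp_eq_pos)
      have "ennreal (?I (indicator {x. R \<le> norm x}) (B t)) \<le> ennreal (K * (R / t powr \<theta>) powr (- (1 / (\<theta> * (1 - m)))))"
        using tail_B[OF t, of R] R unfolding ind_norm[OF Bt] by simp
      then have 1: "?I (indicator {x. R \<le> norm x}) (B t) \<le> K * (R / t powr \<theta>) powr (- (1 / (\<theta> * (1 - m))))"
        using K by (subst (asm) ennreal_le_iff) auto
      have "ennreal (?I (indicator {x. 3 * R \<le> norm x}) (u 0)) = ennreal ((3 * R) powr (- \<epsilon>) * M)"
        using tail_u0[of "3 * R"] R unfolding ind_norm[OF u_0, symmetric] norm_0 by simp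
      then have 2: "?I (indicator {x. 3 * R \<le> norm x}) (u 0) = (3 * R) powr (- \<epsilon>) * M"
        by (rule ennreal_eq_imp_eq_pos) (use M(1) R in simp)
      have "?I (\<lambda>x. 1 - indicator {x. R \<le> norm x} x) (B t) \<le> ?I (?\<psi> R) (B t)"
      proof (rule weighted_integral_mono[OF Bt ind(3,4) \<psi>])
        fix x :: 'a
        show "1 - indicator {x. R \<le> norm x} x \<le> ?\<psi> R x"
        proof (cases "R \<le> norm x")
          case False
          then have "(norm x)\<^sup>2 \<le> R\<^sup>2" by (intro power_mono) auto
          then have "?\<psi> R x = 1" using R by (intro h(4)) (simp add: divide_le_eq_1)
          then show ?thesis by simp
        qed (simp add: h(2))
      qed
      then have 3: "M - ?I (indicator {x. R \<le> norm x}) (B t) \<le> ?I (?\<psi> R) (B t)"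
        unfolding weighted_integral_compl[OF Bt(1) ind(1,2)] mass_B .
      have "?I (?\<psi> R) (u 0) \<le> ?I (\<lambda>x. 1 - indicator {x. 3 * R \<le> norm x} x) (u 0)"
      proof (rule weighted_integral_mono[OF u_0 \<psi> ind(3,4)])
        fix x :: 'a
        show "?\<psi> R x \<le> 1 - indicator {x. 3 * R \<le> norm x} x"
        proof (cases "3 * R \<le> norm x")
          case True
          then have "(3 * R)\<^sup>2 \<le> (norm x)\<^sup>2" using R by (intro power_mono) auto
          then have "4 < (norm x)\<^sup>2 / R\<^sup>2"
            using R by (simp add: less_divide_eq power_mult_distrib) (smt (verit) zero_less_power)
          then show ?thesis using h(5) by simp
        qed (simp add: h(3))
      qed
      then have 4: "?I (?\<psi> R) (u 0) \<le> M - ?I (indicator {x. 3 * R \<le> norm x}) (u 0)"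
        unfolding weighted_integral_compl[OF u_0(1) ind(1,2)] mass_u .
      have 5: "\<bar>?I (?\<psi> R) (u t) - ?I (?\<psi> R) (u 0)\<bar> \<le> C * R powr (- (1 / \<theta>)) * (1 + M) * t"
        by (rule est[OF u, of _ _ "t + 1"]) (use R M(1) t u_mass in auto)
      show ?thesis unfolding D_def using 1 2 3 4 5 by linarith
    qed

    define R where "R t = t powr (\<theta> * (1 + \<kappa>))" for t :: real
    have D_R: "c * t powr (- e) \<le> D t (R t)"
      if t: "1 \<le> t" and large: "K + C * (1 + M) \<le> c * t powr (\<kappa> - e)" for t
    proof -
      have R: "1 \<le> R t" using t \<theta> \<kappa> unfolding R_def by (intro ge_one_powr_ge_zero) auto
      have r1: "(3 * R t) powr (- \<epsilon>) * M = 2 * c * t powr (- e)"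
        using R \<epsilon>(2) by (simp add: c_def R_def powr_mult powr_powr)
      have "R t / t powr \<theta> = t powr (\<theta> * \<kappa>)"
        using t by (simp add: R_def powr_diff[symmetric] algebra_simps)
      then have r2: "(R t / t powr \<theta>) powr (- (1 / (\<theta> * (1 - m)))) = t powr (- (\<kappa> / (1 - m)))"
        using \<theta> by (simp add: powr_powr)
      have "\<kappa> * (1 - m) \<le> \<kappa> * 1" using \<kappa>(1) m0 by (intro mult_left_mono) auto
      then have "\<kappa> \<le> \<kappa> / (1 - m)" using m1 by (simp add: le_divide_eq)
      then have "t powr (- (\<kappa> / (1 - m))) \<le> t powr (- \<kappa>)" using t by (intro powr_mono) auto
      then have r3: "K * t powr (- (\<kappa> / (1 - m))) \<le> K * t powr (- \<kappa>)" using K by (intro mult_left_mono)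
      have "R t powr (- (1 / \<theta>)) * t = t powr (- (1 + \<kappa>)) * t powr 1"
        using t \<theta> by (simp add: R_def powr_powr)
      also have "\<dots> = t powr (- \<kappa>)" unfolding powr_add[symmetric] by simp
      finally have r4: "C * R t powr (- (1 / \<theta>)) * (1 + M) * t = C * (1 + M) * t powr (- \<kappa>)"
        by (simp add: mult_ac)
      have "(K + C * (1 + M)) * t powr (- \<kappa>) \<le> c * t powr (\<kappa> - e) * t powr (- \<kappa>)"
        using large by (intro mult_right_mono) auto
      also have "\<dots> = c * t powr (- e)" by (simp add: mult.assoc powr_add[symmetric])
      finally have "(K + C * (1 + M)) * t powr (- \<kappa>) \<le> c * t powr (- e)" .
      then show ?thesis
        using D_lower[of t "R t"] t R r3 unfolding r1 r2 r4 by (simp add: algebra_simps)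
    qed
    have ev: "eventually (\<lambda>t. 1 \<le> t \<and> K + C * (1 + M) \<le> c * t powr (\<kappa> - e)) at_top"
    proof -
      have "filterlim (\<lambda>t. c * t powr (\<kappa> - e)) at_top at_top"
        using c e by (intro const_mult_powr_at_top) auto
      then show ?thesis
        by (intro eventually_conj eventually_ge_at_top) (simp add: filterlim_at_top)
    qed

    have "((\<lambda>t. ennreal (t powr \<delta>) * L1w_norm \<gamma> (\<lambda>x. u t x - B t x)) \<longlongrightarrow> \<infinity>) at_top"
    proof (rule tendsto_infinity_if_ge_power[OF c])
      show "0 < \<delta> - e" using e assms(7) by simp
      show "eventually (\<lambda>t. ennreal (c * t powr (\<delta> - e)) \<le> ennreal (t powr \<delta>) * L1w_norm \<gamma> (\<lambda>x. u t x - B t x)) at_top"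
        using ev
      proof eventually_elim
        case (elim t)
        have "c * t powr (\<delta> - e) = t powr \<delta> * (c * t powr (- e))"
          by (simp add: mult_ac powr_add[symmetric])
        also have "ennreal \<dots> = ennreal (t powr \<delta>) * ennreal (c * t powr (- e))" by (simp add: ennreal_mult')
        also have "\<dots> \<le> ennreal (t powr \<delta>) * ennreal \<bar>?I (?\<psi> (R t)) (u t) - ?I (?\<psi> (R t)) (B t)\<bar>"
          using D_R[of t] elim by (intro mult_left_mono ennreal_leI) (auto simp: D_def)
        also have "\<dots> \<le> ennreal (t powr \<delta>) * L1w_norm \<gamma> (\<lambda>x. u t x - B t x)"
          using elim u_t(1)[of t] B_L1[of t] \<psi> by (intro mult_left_mono weighted_integral_diff_le_L1w) auto
        finally show ?case .
      qed
    qed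
    moreover have "((\<lambda>t. ennreal (t powr (\<delta> + (?d - \<gamma>) * \<theta>)) * Linf_norm (\<lambda>x. u t x - B t x)) \<longlongrightarrow> \<infinity>) at_top"
    proof (rule tendsto_infinity_if_ge_power[of "c / c0"])
      show "0 < c / c0" using c c0 by simp
      show "0 < \<delta> / 2 - e" using e by simp
      show "eventually (\<lambda>t. ennreal (c / c0 * t powr (\<delta> / 2 - e))
          \<le> ennreal (t powr (\<delta> + (?d - \<gamma>) * \<theta>)) * Linf_norm (\<lambda>x. u t x - B t x)) at_top"
        using ev
      proof eventually_elim
        case (elim t)
        let ?L = "Linf_norm (\<lambda>x. u t x - B t x)"
        have t: "0 < t" using elim by simp
        have R: "0 < R t" using t by (simp add: R_def)
        have supp: "\<bar>?\<psi> (R t) x\<bar> \<le> indicator {x. norm x \<le> 2 * R t} x" for x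
        proof (cases "norm x \<le> 2 * R t")
          case False
          then have "(2 * R t)\<^sup>2 < (norm x)\<^sup>2" using R by (intro power_strict_mono) auto
          then have "4 < (norm x)\<^sup>2 / (R t)\<^sup>2" using R by (simp add: less_divide_eq power_mult_distrib)
          then show ?thesis using h(5) by simp
        qed (simp add: abs_of_nonneg h(2,3))
        let ?q = "(?d - \<gamma>) * \<theta> + \<delta> / 2"
        have "ennreal (c * t powr (- e)) \<le> ennreal \<bar>?I (?\<psi> (R t)) (u t) - ?I (?\<psi> (R t)) (B t)\<bar>"
          using D_R[of t] elim by (intro ennreal_leI) (auto simp: D_def)
        also have "\<dots> \<le> ?L * (\<integral>\<^sup>+ (x::'a). indicator {x. norm x \<le> 2 * R t} x * ennreal (norm x powr (- \<gamma>)) \<partial>lborel)"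
          using t u_t(1)[of t] B_L1[of t] \<psi>(1) supp by (intro weighted_integral_diff_le_Linf) auto
        also have "\<dots> = ?L * ennreal ((2 * R t) powr (?d - \<gamma>) * i0)"
          using R i0 by (subst power_weight_mass_ball[OF d]) (simp_all add: ennreal_mult')
        also have "\<dots> \<le> ?L * ennreal (c0 * t powr ?q)"
        proof (intro mult_left_mono ennreal_leI)
          have "\<theta> * (1 + \<kappa>) * (?d - \<gamma>) = ?q" using \<kappa>(2) by (simp add: algebra_simps)
          then have "R t powr (?d - \<gamma>) = t powr ?q" by (simp add: R_def powr_powr)
          then show "(2 * R t) powr (?d - \<gamma>) * i0 \<le> c0 * t powr ?q"
            using R by (simp add: powr_mult c0_def algebra_simps)
        qed simp
        finally have *: "ennreal (c * t powr (- e)) \<le> ?L * ennreal (c0 * t powr ?q)" .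
        have "c / c0 * t powr (\<delta> / 2 - e) = (t powr (\<delta> / 2) / c0) * (c * t powr (- e))"
          by (simp add: powr_add[symmetric])
        also have "ennreal \<dots> = ennreal (t powr (\<delta> / 2) / c0) * ennreal (c * t powr (- e))"
          using c0 by (intro ennreal_mult') simp
        also have "\<dots> \<le> ennreal (t powr (\<delta> / 2) / c0) * (?L * ennreal (c0 * t powr ?q))"
          by (intro mult_left_mono *) simp
        also have "\<dots> = ennreal ((t powr (\<delta> / 2) / c0) * (c0 * t powr ?q)) * ?L"
          using c0 by (subst ennreal_mult') (simp_all add: mult_ac)
        also have "(t powr (\<delta> / 2) / c0) * (c0 * t powr ?q) = t powr (\<delta> + (?d - \<gamma>) * \<theta>)"
          using c0 by (simp add: powr_add[symmetric] add.commute)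
        finally show ?case .
      qed
    qed
    ultimately show ?thesis by blast
  qed

  show ?thesis
  proof (intro bexI[OF _ M(2)] conjI allI impI)
    show "AE x in lborel. 0 \<le> u0 x" by (simp add: u0_def)
    show "\<not> (AE x in lborel. u0 x = 0)"
    proof
      assume z: "AE x in lborel. u0 x = 0"
      have "L1w_norm \<gamma> u0 = (\<integral>\<^sup>+ (x::'a). 0 \<partial>lborel)"
        unfolding L1w_norm_def by (intro nn_integral_cong_AE) (use z in eventually_elim, simp)
      then show False using M by simp
    qed
    fix u :: "real \<Rightarrow> 'a \<Rightarrow> real" assume "weak_solution \<gamma> \<beta> m u0 u"
    from limits[OF this] show "let M = enn2real (L1w_norm \<gamma> u0) in
        ((\<lambda>t. ennreal (t powr (\<delta> + (?d - \<gamma>) * theta_exp ?d \<gamma> \<beta> m))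
               * Linf_norm (\<lambda>x. u t x - barenblatt \<gamma> \<beta> m M t x)) \<longlongrightarrow> \<infinity>) at_top \<and>
        ((\<lambda>t. ennreal (t powr \<delta>)
               * L1w_norm \<gamma> (\<lambda>x. u t x - barenblatt \<gamma> \<beta> m M t x)) \<longlongrightarrow> \<infinity>) at_top"
      using M(1) by (simp add: Let_def M(3) B_def \<theta>_def)
  qed
qed

end
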